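(* Assume (Pur) and (Erg) hold. Let $m$ be the period of $\mu$ and let $M_1,\dots,M_m$ be the positive semi-definite matrices attached to an $m$-cycle of $\mu$ as described in the context. Then the subspace $\mathcal F$ spanned by the eigenvectors of $\Pi$ (acting on $C^\alpha(\mathrm P(\mathbb C^k),\mathbb C)$, $0<\alpha\le1$) corresponding to eigenvalues of modulus $1$ is the linear span of the functions $$\hat x\mapsto\langle x,M_rx\rangle,\qquad r\in\{1,\dots,m\}.$$ In particular $\dim\mathcal F=m$ and the peripheral spectrum of $\Pi$ is simple.
   Context: Let $k\in\mathbb N=\{1,2,\dots\}$ be fixed; $\mathbb C^k$ carries its canonical inner product and norm $\|\cdot\|$. $\mathrm P(\mathbb C^k)$ is the projective space; $\hat x$ is the class of a nonzero vector $x$, and given $\hat x$, $x$ denotes a unit-norm representative. The metric is $d(\hat x,\hat y)=\sqrt{1-|\langle x,y\rangle|^2}$. For $v\in\mathrm M_k(\mathbb C)$ with $vx\ne0$, $v\cdot\hat x$ is the class of $vx$. For $0<\alpha\le1$, $C^\alpha(\mathrm P(\mathbb C^k),\mathbb C)$ is the Banach space of $\alpha$-Hölder functions with norm $\|f\|_\alpha=\|f\|_\infty+m_\alpha(f)$, $m_\alpha(f)=\sup_{\hat x\ne\hat y}|f(\hat x)-f(\hat y)|/d(\hat x,\hat y)^\alpha$. $\mu$ is a (not necessarily finite) Borel measure on $\mathrm M_k(\mathbb C)$ with $\int\|v\|^2d\mu(v)<\infty$ and $\int v^*v\,d\mu(v)=\mathrm{Id}_{\mathbb C^k}$. The Markov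 operator is $\Pi f(\hat x)=\int_{\mathrm M_k(\mathbb C)}f(v\cdot\hat x)\|vx\|^2d\mu(v)$ (integrand $0$ when $vx=0$). The peripheral spectrum is the set of spectral values of modulus $1$. (Pur): any nonzero orthogonal projector $\pi$ on $\mathbb C^k$ such that, for every $n\in\mathbb N$, $\pi v_1^*\cdots v_n^*v_n\cdots v_1\pi\propto\pi$ (proportionality constant $0$ allowed) for $\mu^{\otimes n}$-almost every $(v_1,\dots,v_n)$, is of rank one. (Erg): there exists a unique minimal subspace $E\ne\{0\}$ of $\mathbb C^k$ such that $vE\subset E$ for $\mu$-almost every $v$. An $\ell$-cycle of $\mu$ is a set of orthogonal subspaces $\{E_1,\dots,E_\ell\}$ of $E$ such that $E=E_1\oplus\cdots\oplus E_\ell$ and, for $\mu$-almost every $v$ and all $i\in\{1,\dots,\ell\}$, $vE_i\subset E_{i+1}$ with $E_{\ell+1}=E_1$. The period $m$ of $\mu$ is the maximal $\ell$ such that there exists an $\ell$-cycle of $\mu$. Let $\Phi(X)=\int_{\mathrm M_k(\mathbb C)}v^*Xv\,d\mu(v)$ for $X\in\mathrm M_k(\mathbb C)$. Under (Erg) there exist positive semi-definite matrices $M_1,\dots,M_m$ and an $m$-cycle $\{E_1,\dots,E_m\}$ with $\Phi(M_r)=M_{r-1}$ ($M_0=M_m$), $M_rP_{E_r}=P_{E_r}M_r=P_{E_r}$, $M_rP_{E_{r'}}=P_{E_{r'}}M_r=0$ for $r\ne r'$ ($P_F$ the orthogonal projector onto $F$), and $\sum_{r=1}^mM_r=\mathrm{Id}$;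 the $M_r$ in the claim are such matrices. *)

theory Defs
  imports "HOL-Analysis.Analysis" "HOL-Library.Function_Algebras"
begin

section \<open>Hermitian linear algebra on complex vectors\<close>

text \<open>The library inner product on \<^typ>\<open>complex ^ 'k\<close> is the real one; this is the
  Hermitian one, antilinear in the first argument.  The library norm is the norm it induces.\<close>

definition cinner :: "complex ^ 'k \<Rightarrow> complex ^ 'k \<Rightarrow> complex" where
  "cinner x y = (\<Sum>i\<in>UNIV. cnj (x $ i) * y $ i)"

definition ctrans :: "complex ^ 'k ^ 'k \<Rightarrow> complex ^ 'k ^ 'k" where
  "ctrans A = map_matrix cnj (transpose A)"

definition orthogonal_projector :: "complex ^ 'k ^ 'k \<Rightarrow> bool" where
  "orthogonal_projector P \<longleftrightarrow> P ** P = P \<and> ctrans P = P"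

definition projector_onto :: "(complex ^ 'k) set \<Rightarrow> complex ^ 'k ^ 'k" where
  "projector_onto F = (THE P. orthogonal_projector P \<and> range ((*v) P) = F)"

definition pos_semidef :: "complex ^ 'k ^ 'k \<Rightarrow> bool" where
  "pos_semidef A \<longleftrightarrow> ctrans A = A \<and> (\<forall>x. 0 \<le> Re (cinner x (A *v x)))"

section \<open>Projective space\<close>

definition proj_rel :: "complex ^ 'k \<Rightarrow> complex ^ 'k \<Rightarrow> bool" where
  "proj_rel x y \<longleftrightarrow> x \<noteq> 0 \<and> y \<noteq> 0 \<and> (\<exists>c. y = c *s x)"

lemma part_equivp_proj_rel: "part_equivp (proj_rel :: complex ^ 'k \<Rightarrow> complex ^ 'k \<Rightarrow> bool)"
proof (rule part_equivpI)
  have "(1 :: complex ^ 'k) = 1 *s 1" by simp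
  moreover have "(1 :: complex ^ 'k) \<noteq> 0" by simp
  ultimately show "\<exists>x :: complex ^ 'k. proj_rel x x"
    unfolding proj_rel_def by blast
  show "symp (proj_rel :: complex ^ 'k \<Rightarrow> _)"
  proof (rule sympI)
    fix x y :: "complex ^ 'k"
    assume "proj_rel x y"
    then obtain c where c: "x \<noteq> 0" "y \<noteq> 0" "y = c *s x"
      unfolding proj_rel_def by blast
    then have "c \<noteq> 0" by auto
    then have "x = inverse c *s y" using c(3) by simp
    with c show "proj_rel y x" unfolding proj_rel_def by blast
  qed
  show "transp (proj_rel :: complex ^ 'k \<Rightarrow> _)"
    unfolding transp_def proj_rel_def by (metis vector_smult_assoc)
qed

quotient_type (overloaded) 'k cproj = "complex ^ 'k::finite" / partial: proj_rel
  morphisms rep_cproj proj_class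
  by (rule part_equivp_proj_rel)

definition unit_rep :: "'k::finite cproj \<Rightarrow> complex ^ 'k" where
  "unit_rep p = (SOME x. norm x = 1 \<and> proj_class x = p)"

definition proj_dist :: "'k::finite cproj \<Rightarrow> 'k cproj \<Rightarrow> real" where
  "proj_dist p q = sqrt (1 - (cmod (cinner (unit_rep p) (unit_rep q)))\<^sup>2)"

section \<open>Hoelder functions\<close>

definition holder_space :: "real \<Rightarrow> ('k::finite cproj \<Rightarrow> complex) set" where
  "holder_space \<alpha> = {f. bounded (range f) \<and>
     (\<exists>C. \<forall>p q. cmod (f p - f q) \<le> C * proj_dist p q powr \<alpha>)}"

text \<open>The inserted 0 only matters in complex dimension one, where the projective space is a
  single point and the supremum ranges over the empty set.\<close>

definition holder_seminorm :: "real \<Rightarrow> ('k::finite cproj \<Rightarrow> complex) \<Rightarrow> real" where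
  "holder_seminorm \<alpha> f =
     Sup (insert 0 {cmod (f p - f q) / proj_dist p q powr \<alpha> | p q. p \<noteq> q})"

definition holder_norm :: "real \<Rightarrow> ('k::finite cproj \<Rightarrow> complex) \<Rightarrow> real" where
  "holder_norm \<alpha> f = (SUP p. cmod (f p)) + holder_seminorm \<alpha> f"

text \<open>Span and dimension of sets of complex-valued functions, over the complex scalars.\<close>

interpretation cfun: vector_space "\<lambda>(c::complex) (f :: 'a \<Rightarrow> complex). (\<lambda>x. c * f x)"
  by unfold_locales (auto simp: fun_eq_iff algebra_simps)

section \<open>The measure and its Markov operator\<close>

definition admissible :: "(complex ^ 'k ^ 'k) measure \<Rightarrow> bool" where
  "admissible \<mu> \<longleftrightarrow> sets \<mu> = sets borel \<and>
     integrable \<mu> (\<lambda>v. (onorm ((*v) v))\<^sup>2) \<and>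
     (LINT v|\<mu>. ctrans v ** v) = mat 1"

definition markov_op ::
    "(complex ^ 'k ^ 'k) measure \<Rightarrow> ('k::finite cproj \<Rightarrow> complex) \<Rightarrow> 'k cproj \<Rightarrow> complex" where
  "markov_op \<mu> f p = (LINT v|\<mu>.
     (if v *v unit_rep p = 0 then 0
      else f (proj_class (v *v unit_rep p)) * of_real ((norm (v *v unit_rep p))\<^sup>2)))"

primrec left_prod :: "(nat \<Rightarrow> complex ^ 'k ^ 'k) \<Rightarrow> nat \<Rightarrow> complex ^ 'k ^ 'k" where
  "left_prod v 0 = mat 1"
| "left_prod v (Suc n) = v (Suc n) ** left_prod v n"

text \<open>An admissible measure is sigma-finite except possibly for an infinite atom at the zero
  matrix.  The product measure below still exists in that case, and it is uniquely determined
  on tuples of nonzero matrices; on all other tuples the condition holds with constant 0.\<close>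

definition Pur :: "(complex ^ 'k ^ 'k) measure \<Rightarrow> bool" where
  "Pur \<mu> \<longleftrightarrow> (\<forall>P. orthogonal_projector P \<and> P \<noteq> 0 \<and>
     (\<forall>n\<ge>1. AE v in (\<Pi>\<^sub>M i\<in>{1..n}. \<mu>).
        \<exists>c. P ** ctrans (left_prod v n) ** left_prod v n ** P = map_matrix ((*) c) P)
     \<longrightarrow> rank P = 1)"

definition invariant_subspace ::
    "(complex ^ 'k ^ 'k) measure \<Rightarrow> (complex ^ 'k) set \<Rightarrow> bool" where
  "invariant_subspace \<mu> E \<longleftrightarrow> vec.subspace E \<and> (AE v in \<mu>. (*v) v ` E \<subseteq> E)"

definition minimal_invariant ::
    "(complex ^ 'k ^ 'k) measure \<Rightarrow> (complex ^ 'k) set \<Rightarrow> bool" where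
  "minimal_invariant \<mu> E \<longleftrightarrow> invariant_subspace \<mu> E \<and> E \<noteq> {0} \<and>
     (\<forall>F. invariant_subspace \<mu> F \<and> F \<noteq> {0} \<and> F \<subseteq> E \<longrightarrow> F = E)"

definition Erg :: "(complex ^ 'k ^ 'k) measure \<Rightarrow> bool" where
  "Erg \<mu> \<longleftrightarrow> (\<exists>!E. minimal_invariant \<mu> E)"

definition erg_space :: "(complex ^ 'k ^ 'k) measure \<Rightarrow> (complex ^ 'k) set" where
  "erg_space \<mu> = (THE E. minimal_invariant \<mu> E)"

text \<open>The members of a cycle are indexed by 1, ..., l.\<close>

definition is_cycle ::
    "(complex ^ 'k ^ 'k) measure \<Rightarrow> nat \<Rightarrow> (nat \<Rightarrow> (complex ^ 'k) set) \<Rightarrow> bool" where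
  "is_cycle \<mu> l Es \<longleftrightarrow> 1 \<le> l \<and>
     (\<forall>i\<in>{1..l}. vec.subspace (Es i)) \<and>
     (\<forall>i\<in>{1..l}. \<forall>j\<in>{1..l}. i \<noteq> j \<longrightarrow> (\<forall>x\<in>Es i. \<forall>y\<in>Es j. cinner x y = 0)) \<and>
     vec.span (\<Union>i\<in>{1..l}. Es i) = erg_space \<mu> \<and>
     (AE v in \<mu>. \<forall>i\<in>{1..l}. (*v) v ` Es i \<subseteq> Es (if i = l then 1 else i + 1))"

definition is_period :: "(complex ^ 'k ^ 'k) measure \<Rightarrow> nat \<Rightarrow> bool" where
  "is_period \<mu> m \<longleftrightarrow> (\<exists>Es. is_cycle \<mu> m Es) \<and> (\<forall>l Es. is_cycle \<mu> l Es \<longrightarrow> l \<le> m)"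

definition quantum_map :: "(complex ^ 'k ^ 'k) measure \<Rightarrow> complex ^ 'k ^ 'k \<Rightarrow> complex ^ 'k ^ 'k" where
  "quantum_map \<mu> X = (LINT v|\<mu>. ctrans v ** X ** v)"

definition attached_matrices ::
    "(complex ^ 'k ^ 'k) measure \<Rightarrow> nat \<Rightarrow> (nat \<Rightarrow> (complex ^ 'k) set) \<Rightarrow>
      (nat \<Rightarrow> complex ^ 'k ^ 'k) \<Rightarrow> bool" where
  "attached_matrices \<mu> m Es M \<longleftrightarrow>
     (\<forall>r\<in>{1..m}. pos_semidef (M r)) \<and>
     (\<forall>r\<in>{1..m}. quantum_map \<mu> (M r) = M (if r = 1 then m else r - 1)) \<and>
     (\<forall>r\<in>{1..m}. M r ** projector_onto (Es r) = projector_onto (Es r) \<and>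
                  projector_onto (Es r) ** M r = projector_onto (Es r)) \<and>
     (\<forall>r\<in>{1..m}. \<forall>s\<in>{1..m}. r \<noteq> s \<longrightarrow>
        M r ** projector_onto (Es s) = 0 \<and> projector_onto (Es s) ** M r = 0) \<and>
     (\<Sum>r\<in>{1..m}. M r) = mat 1"

section \<open>Peripheral spectrum\<close>

definition shifted_op ::
    "(complex ^ 'k ^ 'k) measure \<Rightarrow> complex \<Rightarrow> ('k::finite cproj \<Rightarrow> complex) \<Rightarrow> 'k cproj \<Rightarrow> complex"
  where "shifted_op \<mu> z f = (\<lambda>p. z * f p - markov_op \<mu> f p)"

text \<open>Linearity of R is automatic, since R inverts a linear map on the Hoelder space.\<close>

definition spectrum_on :: "(complex ^ 'k::finite ^ 'k) measure \<Rightarrow> real \<Rightarrow> complex set" where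
  "spectrum_on \<mu> \<alpha> = {z. \<not> (\<exists>R.
     (\<forall>f\<in>holder_space \<alpha>. R f \<in> holder_space \<alpha> \<and>
        shifted_op \<mu> z (R f) = f \<and> R (shifted_op \<mu> z f) = f) \<and>
     (\<exists>B. \<forall>f\<in>holder_space \<alpha>. holder_norm \<alpha> (R f) \<le> B * holder_norm \<alpha> f))}"

definition peripheral_spectrum :: "(complex ^ 'k::finite ^ 'k) measure \<Rightarrow> real \<Rightarrow> complex set" where
  "peripheral_spectrum \<mu> \<alpha> = {z \<in> spectrum_on \<mu> \<alpha>. cmod z = 1}"

definition gen_eigenspace ::
    "(complex ^ 'k ^ 'k) measure \<Rightarrow> real \<Rightarrow> complex \<Rightarrow> ('k::finite cproj \<Rightarrow> complex) set" where
  "gen_eigenspace \<mu> \<alpha> z = {f \<in> holder_space \<alpha>. \<exists>n. (shifted_op \<mu> z ^^ n) f = 0}"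

text \<open>Algebraic multiplicity one: the generalised eigenspace is a line.  The remaining clauses
  say that it is complemented by the range of the shifted operator, so that multiplicity one
  also holds in the sense of the Riesz spectral projection (z is isolated in the spectrum and its
  projection has rank one).\<close>

definition simple_spectral_value ::
    "(complex ^ 'k::finite ^ 'k) measure \<Rightarrow> real \<Rightarrow> complex \<Rightarrow> bool" where
  "simple_spectral_value \<mu> \<alpha> z \<longleftrightarrow>
     cfun.dim (gen_eigenspace \<mu> \<alpha> z) = 1 \<and>
     gen_eigenspace \<mu> \<alpha> z \<inter> shifted_op \<mu> z ` holder_space \<alpha> = {0} \<and>
     {u + w | u w. u \<in> gen_eigenspace \<mu> \<alpha> z \<and> w \<in> shifted_op \<mu> z ` holder_space \<alpha>}
       = holder_space \<alpha>"

definition peripheral_eigenvectors ::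
    "(complex ^ 'k ^ 'k) measure \<Rightarrow> real \<Rightarrow> ('k::finite cproj \<Rightarrow> complex) set" where
  "peripheral_eigenvectors \<mu> \<alpha> = {f \<in> holder_space \<alpha>. f \<noteq> 0 \<and>
     (\<exists>z. cmod z = 1 \<and> markov_op \<mu> f = (\<lambda>p. z * f p))}"

end

theory Submission
  imports Defs "HOL-Probability.Giry_Monad" "HOL-Computational_Algebra.Fundamental_Theorem_Algebra"
begin

text \<open>
  Two ideas carry the proof.  The first turns a spectral question about Hoelder functions into
  one about matrices.  Extend a function \<open>f\<close> on the projective space to vectors by
  \<open>lift f x = f [x] * |x|^2\<close>.  Then \<open>markov_op\<close> integrates \<open>lift f (v x)\<close>, its \<open>n\<close>-th power
  integrates \<open>lift f (W x)\<close> over random products \<open>W = v_n ... v_1\<close>, and a quadratic form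
  \<open>\<langle>x, A x\<rangle>\<close> is sent to the quadratic form of \<open>quantum_map \<mu> A\<close>.  If \<open>W\<close> is nearly of rank one,
  then \<open>f [W x]\<close> hardly depends on \<open>x\<close>, so that \<open>lift f (W x)\<close> is nearly a constant times
  \<open>\<langle>x, W* W x\<rangle>\<close>.  Hence a high power of the operator yields a quadratic form up to a
  remainder that halves Hoelder bounds (\<open>remainder_bound\<close>, \<open>contracting_remainder_exists\<close>).  By a Neumann
  series everything on the unit circle happens on the finite-dimensional, invariant space of
  quadratic forms: generalised peripheral eigenvectors are quadratic forms
  (\<open>quadform_of_peripheral\<close>), \<open>z - \<Pi>\<close> can be inverted modulo quadratic forms with a bound
  (\<open>shifted_solve_mod_quadform\<close>), and, as \<open>\<Pi>\<close> does not increase the supremum, there are no Jordan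
  blocks (\<open>peripheral_semisimple\<close>).

  Products are nearly of rank one because of the following contraction.  The area of the
  parallelogram spanned by \<open>v x\<close> and \<open>v y\<close> is at most \<open>(|v x|^2 + |v y|^2) / 2\<close>, whose integral is 1
  for orthonormal \<open>x, y\<close>; so the mean area never increases.  If along all powers it stays equal
  to 1 for some pair, then almost all products map \<open>x, y\<close> to orthogonal vectors of the same
  length, and the projector onto their plane contradicts (Pur) (\<open>Pur_contraction\<close>).
  Otherwise compactness makes the contraction uniform, and products make it geometric
  (\<open>uniform_area_contraction\<close>, \<open>mean_area_geometric\<close>).

  The second idea describes the matrices \<open>A \<noteq> 0\<close> with \<open>quantum_map \<mu> A = z A\<close>, \<open>|z| = 1\<close>.  The
  vectors on which \<open>A\<close> attains its norm form an invariant subspace, so they contain the minimal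
  subspace \<open>E\<close> given by (Erg); the case of equality also yields \<open>A v = z v A\<close> on \<open>E\<close>, hence
  \<open>A E\<close> is invariant as well and equals \<open>E\<close> (\<open>peripheral_intertwiner\<close>).  Thus \<open>A\<close> is a multiple
  of a unitary on \<open>E\<close>.  Almost every \<open>v\<close> maps its eigenspace for \<open>a\<close> into that for \<open>z a\<close>, so
  an orbit of eigenspaces is a cycle, of length the order of \<open>z\<close>
  (\<open>intertwiner_cycle\<close>).  Products of such operators realise the least
  common multiple of two orders, so maximality of the period \<open>m\<close> forces \<open>z^m = 1\<close>
  (\<open>intertwiner_root_of_unity\<close>), and \<open>A\<close> is then a multiple of
  \<open>\<Sum>\<^sub>r z^r M\<^sub>r\<close> (\<open>peripheral_structure\<close>).  Fourier inversion over the \<open>m\<close>-th roots of unity gives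
  the span of the forms of the \<open>M\<^sub>r\<close>.

  All of this is carried out for the probability measure obtained by weighting \<open>\<mu>\<close>
  with \<open>|v|^2 / k\<close> (Frobenius norm) and scaling \<open>v\<close> to constant norm.  It has bounded support,
  and it gives the same integrals of functions that are homogeneous of degree two and the same
  invariant subspaces.
\<close>

section \<open>Hermitian geometry and areas\<close>

lemma norm_vec_sq: "(norm (x :: complex ^ 'k::finite))\<^sup>2 = (\<Sum>i\<in>UNIV. (cmod (x $ i))\<^sup>2)"
  by (simp add: norm_vec_def L2_set_def sum_nonneg)

lemma cinner_self: "cinner x x = of_real ((norm x)\<^sup>2)"
  by (simp add: cinner_def norm_vec_sq complex_norm_square mult.commute del: of_real_power)

lemma cinner_add_left: "cinner (x + y) z = cinner x z + cinner y z"
  by (simp add: cinner_def sum.distrib algebra_simps)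
lemma cinner_add_right: "cinner x (y + z) = cinner x y + cinner x z"
  by (simp add: cinner_def sum.distrib algebra_simps)
lemma cinner_diff_left: "cinner (x - y) z = cinner x z - cinner y z"
  by (simp add: cinner_def sum_subtractf algebra_simps)
lemma cinner_diff_right: "cinner x (y - z) = cinner x y - cinner x z"
  by (simp add: cinner_def sum_subtractf algebra_simps)
lemma cinner_scale_left: "cinner (c *s x) y = cnj c * cinner x y"
  by (simp add: cinner_def sum_distrib_left algebra_simps)
lemma cinner_scale_right: "cinner x (c *s y) = c * cinner x y"
  by (simp add: cinner_def sum_distrib_left algebra_simps)
lemma cinner_commute: "cinner y x = cnj (cinner x y)"
  by (simp add: cinner_def mult.commute)
lemma cinner_zero [simp]: "cinner 0 x = 0" "cinner x 0 = 0"
  by (simp_all add: cinner_def)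
lemma cinner_sum_right: "cinner x (sum f S) = (\<Sum>i\<in>S. cinner x (f i))"
  by (induction S rule: infinite_finite_induct) (auto simp: cinner_add_right)

lemmas cinner_simps = cinner_add_left cinner_add_right cinner_diff_left cinner_diff_right
  cinner_scale_left cinner_scale_right

lemma cinner_ctrans: "cinner (ctrans A *v x) y = cinner x (A *v y)"
proof -
  have "cinner (ctrans A *v x) y = (\<Sum>i\<in>UNIV. \<Sum>j\<in>UNIV. A$j$i * cnj (x$j) * y$i)"
    by (simp add: cinner_def ctrans_def map_matrix_def transpose_def matrix_vector_mult_def sum_distrib_right)
  also have "\<dots> = (\<Sum>j\<in>UNIV. \<Sum>i\<in>UNIV. A$j$i * cnj (x$j) * y$i)"
    by (rule sum.swap)
  also have "\<dots> = cinner x (A *v y)"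
    by (simp add: cinner_def matrix_vector_mult_def sum_distrib_left algebra_simps)
  finally show ?thesis .
qed

lemma norm_smult: "norm (c *s (x :: complex ^ 'k::finite)) = cmod c * norm x"
proof -
  have "(norm (c *s x))\<^sup>2 = (cmod c * norm x)\<^sup>2"
    by (simp add: norm_vec_sq norm_mult power_mult_distrib sum_distrib_left)
  thus ?thesis by simp
qed

lemma norm_add_sq:
  "(norm (x + y))\<^sup>2 = (norm x)\<^sup>2 + 2 * Re (cinner x y) + (norm (y :: complex ^ 'k::finite))\<^sup>2"
proof -
  have "complex_of_real ((norm (x + y))\<^sup>2) = cinner (x + y) (x + y)" by (simp only: cinner_self)
  also have "\<dots> = cinner x x + (cinner x y + cnj (cinner x y)) + cinner y y"
    by (simp add: cinner_simps cinner_commute[of y x])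
  also have "\<dots> = of_real ((norm x)\<^sup>2 + 2 * Re (cinner x y) + (norm y)\<^sup>2)"
    by (simp only: cinner_self complex_add_cnj of_real_add)
  finally show ?thesis by (simp only: of_real_eq_iff)
qed

lemma norm_diff_sq:
  "(norm (x - y))\<^sup>2 = (norm x)\<^sup>2 - 2 * Re (cinner x y) + (norm (y :: complex ^ 'k::finite))\<^sup>2"
  using norm_add_sq[of x "- y"] cinner_diff_right[of x 0 y] by simp

text \<open>The antisymmetric matrix of the exterior product.\<close>
definition wedge :: "complex ^ 'k \<Rightarrow> complex ^ 'k \<Rightarrow> complex ^ 'k ^ 'k" where
  "wedge x y = (\<chi> i j. x $ i * y $ j - x $ j * y $ i)"

text \<open>The factor makes this the area of the parallelogram spanned by the vectors: \<open>wedge\<close>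
  holds every minor twice.\<close>
definition area :: "complex ^ 'k::finite \<Rightarrow> complex ^ 'k \<Rightarrow> real" where
  "area x y = norm (wedge x y) / sqrt 2"

lemma norm_mat_sq: "(norm (A :: complex ^ 'k::finite ^ 'k))\<^sup>2 = (\<Sum>i\<in>UNIV. \<Sum>j\<in>UNIV. (cmod (A $ i $ j))\<^sup>2)"
  unfolding norm_vec_def[of A] L2_set_def by (simp add: sum_nonneg norm_vec_sq)

lemma area_nonneg [simp]: "0 \<le> area x y" by (simp add: area_def)

text \<open>Lagrange's identity; it contains the Cauchy--Schwarz inequality.\<close>
lemma area_sq: "(area x y)\<^sup>2 = (norm x)\<^sup>2 * (norm y)\<^sup>2 - (cmod (cinner x y))\<^sup>2"
proof -
  have "complex_of_real ((norm (wedge x y))\<^sup>2)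
     = (\<Sum>i\<in>UNIV. \<Sum>j\<in>UNIV. (x$i*y$j - x$j*y$i) * cnj (x$i*y$j - x$j*y$i))"
    unfolding norm_mat_sq wedge_def of_real_sum complex_norm_square by simp
  also have "\<dots> = (\<Sum>i\<in>UNIV. \<Sum>j\<in>UNIV. (cnj(x$i)*x$i)*(cnj(y$j)*y$j) + (cnj(y$i)*y$i)*(cnj(x$j)*x$j)
      - (cnj(y$i)*x$i)*(cnj(x$j)*y$j) - (cnj(x$i)*y$i)*(cnj(y$j)*x$j))"
    by (intro sum.cong refl) (simp add: algebra_simps)
  also have "\<dots> = cinner x x * cinner y y + cinner y y * cinner x x
      - cinner y x * cinner x y - cinner x y * cinner y x"
    by (simp only: sum.distrib sum_subtractf sum_product cinner_def)
  also have "\<dots> = 2 * (cinner x x * cinner y y - cinner x y * cnj (cinner x y))"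
    unfolding cinner_commute[of y x] by algebra
  also have "\<dots> = of_real (2 * ((norm x)\<^sup>2 * (norm y)\<^sup>2 - (cmod (cinner x y))\<^sup>2))"
    by (simp only: cinner_self complex_norm_square[symmetric] of_real_mult of_real_diff of_real_numeral)
  finally have "(norm (wedge x y))\<^sup>2 = 2 * ((norm x)\<^sup>2 * (norm y)\<^sup>2 - (cmod (cinner x y))\<^sup>2)"
    by (simp only: of_real_eq_iff)
  thus ?thesis by (simp add: area_def power_divide)
qed

lemma cinner_bound: "cmod (cinner x y) \<le> norm x * norm y"
proof (rule power2_le_imp_le)
  show "(cmod (cinner x y))\<^sup>2 \<le> (norm x * norm y)\<^sup>2"
    using area_sq[of x y] zero_le_power2[of "area x y"] by (simp add: power_mult_distrib)
qed simp

lemma area_le: "area x y \<le> norm x * norm y"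
proof (rule power2_le_imp_le)
  show "(area x y)\<^sup>2 \<le> (norm x * norm y)\<^sup>2"
    using area_sq[of x y] by (simp add: power_mult_distrib)
qed simp

lemma area_le_mean: "area x y \<le> ((norm x)\<^sup>2 + (norm y)\<^sup>2) / 2"
  using area_le[of x y] sum_squares_bound[of "norm x" "norm y"] by simp

text \<open>Both inequalities in \<open>area x y \<le> |x| |y| \<le> (|x|^2 + |y|^2) / 2\<close> are sharp here.\<close>
lemma area_eq_mean:
  assumes "area x y = ((norm x)\<^sup>2 + (norm y)\<^sup>2) / 2"
  shows "norm x = norm y" "cinner x y = 0"
proof -
  have "norm x * norm y \<ge> ((norm x)\<^sup>2 + (norm y)\<^sup>2) / 2" using assms area_le[of x y] by simp
  hence "(norm x - norm y)\<^sup>2 \<le> 0" by (simp add: power2_diff)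
  thus eq: "norm x = norm y" by simp
  have "(cmod (cinner x y))\<^sup>2 = (norm x)\<^sup>2 * (norm y)\<^sup>2 - (((norm x)\<^sup>2 + (norm y)\<^sup>2) / 2)\<^sup>2"
    using area_sq[of x y] assms by simp
  also have "\<dots> = 0" using eq by (simp add: power2_eq_square)
  finally show "cinner x y = 0" by simp
qed

lemma area_orthonormal:
  assumes "norm x = 1" "norm y = 1" "cinner x y = 0" shows "area x y = 1"
  using area_sq[of x y] assms area_nonneg[of x y] by (simp add: power2_eq_1_iff)

lemma area_scale: "area (a *s x) (b *s y) = cmod a * cmod b * area x y"
proof (rule power2_eq_imp_eq)
  show "(area (a *s x) (b *s y))\<^sup>2 = (cmod a * cmod b * area x y)\<^sup>2"
    by (simp add: area_sq cinner_simps norm_smult norm_mult power_mult_distrib algebra_simps)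
qed auto

lemma area_shear: "area x (y + c *s x) = area x y"
  unfolding area_def by (rule arg_cong[of _ _ "\<lambda>w. norm w / sqrt 2"]) (simp add: wedge_def vec_eq_iff algebra_simps)

lemma area_self [simp]: "area x x = 0"
proof -
  have "wedge x x = 0" by (simp add: wedge_def vec_eq_iff)
  thus ?thesis by (simp add: area_def)
qed

text \<open>The second exterior power of a matrix acts linearly on \<open>wedge x y\<close>.  Every pair of
  indices is counted twice, which explains the factor 1/2.\<close>
lemma wedge_matrix:
  "wedge (v *v x) (v *v y) $ a $ b =
     (\<Sum>i\<in>UNIV. \<Sum>j\<in>UNIV. wedge x y $ i $ j * wedge (v *v axis i 1) (v *v axis j 1) $ a $ b) / 2"
proof -
  have col: "(v *v axis i 1) $ a = v $ a $ i" for i a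
    by (simp add: matrix_vector_mult_def axis_def if_distrib cong: if_cong)
  let ?d = "\<lambda>i j. v$a$i * v$b$j - v$b$i * v$a$j"
  let ?S = "\<Sum>i\<in>UNIV. \<Sum>j\<in>UNIV. (x$i*y$j) * ?d i j"
  let ?T = "\<Sum>i\<in>UNIV. \<Sum>j\<in>UNIV. (x$j*y$i) * ?d i j"
  have "?T = (\<Sum>i\<in>UNIV. \<Sum>j\<in>UNIV. (x$i*y$j) * ?d j i)"
    by (rule sum.swap)
  also have "\<dots> = (\<Sum>i\<in>UNIV. \<Sum>j\<in>UNIV. - ((x$i*y$j) * ?d i j))"
    by (intro sum.cong refl) (simp add: algebra_simps)
  also have "\<dots> = - ?S" by (simp only: sum_negf)
  finally have T: "?T = - ?S" .
  have "(\<Sum>i\<in>UNIV. \<Sum>j\<in>UNIV. wedge x y $ i $ j * wedge (v *v axis i 1) (v *v axis j 1) $ a $ b)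
      = (\<Sum>i\<in>UNIV. \<Sum>j\<in>UNIV. (x$i*y$j) * ?d i j - (x$j*y$i) * ?d i j)"
    by (intro sum.cong refl) (simp add: wedge_def col algebra_simps)
  also have "\<dots> = ?S - ?T" by (simp only: sum_subtractf)
  also have "\<dots> = 2 * ?S" using T by simp
  also have "?S = (\<Sum>i\<in>UNIV. \<Sum>j\<in>UNIV. (v$a$i*x$i)*(v$b$j*y$j) - (v$b$i*x$i)*(v$a$j*y$j))"
    by (intro sum.cong refl) (simp add: algebra_simps)
  also have "\<dots> = wedge (v *v x) (v *v y) $ a $ b"
    unfolding wedge_def matrix_vector_mult_def
    by (simp add: sum_product sum_subtractf)
  finally show ?thesis by simp
qed

text \<open>An upper bound for the norm of the second exterior power of \<open>v\<close>.  It measures how far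
  \<open>v\<close> is from rank one: compared with \<open>|v|^2\<close> it is small exactly when \<open>v\<close> nearly collapses
  all directions to one.\<close>
definition spread :: "complex ^ 'k::finite ^ 'k \<Rightarrow> real" where
  "spread v = (\<Sum>i\<in>UNIV. \<Sum>j\<in>UNIV. area (v *v axis i 1) (v *v axis j 1))"

lemma spread_nonneg [simp]: "0 \<le> spread v" by (simp add: spread_def sum_nonneg)

lemma cmod_entry_le: "cmod ((A :: complex ^ 'k::finite ^ 'k) $ i $ j) \<le> norm A"
  by (meson Finite_Cartesian_Product.norm_nth_le order_trans)

lemma norm_smult_mat: "norm (\<chi> i. c *s ((A :: complex ^ 'k::finite ^ 'k) $ i)) = cmod c * norm A"
proof -
  have "(norm (\<chi> i. c *s (A $ i)))\<^sup>2 = (cmod c * norm A)\<^sup>2"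
    by (simp add: norm_mat_sq norm_mult power_mult_distrib sum_distrib_left)
  thus ?thesis by simp
qed

lemma area_matrix_le: "area (v *v x) (v *v y) \<le> spread v * area x y"
proof -
  let ?w = "\<lambda>i j. wedge (v *v axis i 1) (v *v axis j 1)"
  have "wedge (v *v x) (v *v y) = (\<Sum>i\<in>UNIV. \<Sum>j\<in>UNIV. (\<chi> a. (wedge x y $ i $ j / 2) *s (?w i j $ a)))"
    unfolding vec_eq_iff
    by (intro allI, subst wedge_matrix) (simp add: sum_divide_distrib)
  hence "norm (wedge (v *v x) (v *v y)) \<le> (\<Sum>i\<in>UNIV. \<Sum>j\<in>UNIV. norm (\<chi> a. (wedge x y $ i $ j / 2) *s (?w i j $ a)))"
    by (simp add: order_trans[OF norm_sum sum_mono[OF norm_sum]])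
  also have "\<dots> = (\<Sum>i\<in>UNIV. \<Sum>j\<in>UNIV. cmod (wedge x y $ i $ j) / 2 * norm (?w i j))"
    by (simp add: norm_smult_mat norm_divide)
  also have "\<dots> \<le> (\<Sum>i\<in>UNIV. \<Sum>j\<in>UNIV. norm (wedge x y) / 2 * norm (?w i j))"
    by (intro sum_mono mult_right_mono divide_right_mono cmod_entry_le) auto
  also have "\<dots> = spread v * area x y"
    by (simp add: spread_def area_def sum_distrib_left sum_distrib_right field_simps)
  also have "\<dots> \<le> spread v * area x y * sqrt 2"
    using mult_left_mono[of 1 "sqrt 2" "spread v * area x y"] by simp
  finally show ?thesis by (simp add: area_def field_simps)
qed

lemma cauchy_schwarz_parallel:
  assumes "area x y = 0" "x \<noteq> 0" shows "\<exists>c. y = c *s x"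
proof -
  from assms obtain i where i: "x $ i \<noteq> 0" by (auto simp: vec_eq_iff)
  have "wedge x y = 0" using assms by (simp add: area_def)
  hence "x $ i * y $ j - x $ j * y $ i = 0" for j unfolding wedge_def by (simp add: vec_eq_iff)
  hence "y = (y $ i / x $ i) *s x" using i by (simp add: vec_eq_iff field_simps)
  thus ?thesis by blast
qed

lemma norm_mat_columns: "(norm (v :: complex ^ 'k::finite ^ 'k))\<^sup>2 = (\<Sum>i\<in>UNIV. (norm (v *v axis i 1))\<^sup>2)"
proof -
  have col: "(v *v axis i 1) $ a = v $ a $ i" for i a
    by (simp add: matrix_vector_mult_def axis_def if_distrib cong: if_cong)
  show ?thesis unfolding norm_mat_sq norm_vec_sq col by (rule sum.swap)
qed

lemma norm_column_le: "norm (v *v axis i 1) \<le> norm (v :: complex ^ 'k::finite ^ 'k)"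
proof (rule power2_le_imp_le)
  show "(norm (v *v axis i 1))\<^sup>2 \<le> (norm v)\<^sup>2"
    unfolding norm_mat_columns by (rule member_le_sum) auto
qed simp

lemma norm_matrix_vector_le: "norm (v *v x) \<le> norm (v :: complex ^ 'k::finite ^ 'k) * norm x"
proof (rule power2_le_imp_le)
  have "(v *v x) $ i = cinner (\<chi> j. cnj (v $ i $ j)) x" for i
    by (simp add: matrix_vector_mult_def cinner_def)
  hence "(cmod ((v *v x) $ i))\<^sup>2 \<le> (norm (\<chi> j. cnj (v $ i $ j)))\<^sup>2 * (norm x)\<^sup>2" for i
    using power_mono[OF cinner_bound[of "\<chi> j. cnj (v $ i $ j)" x], of 2] by (simp add: power_mult_distrib)
  hence "(norm (v *v x))\<^sup>2 \<le> (\<Sum>i\<in>UNIV. (norm (\<chi> j. cnj (v $ i $ j)))\<^sup>2 * (norm x)\<^sup>2)"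
    unfolding norm_vec_sq[of "v *v x"] by (intro sum_mono) auto
  also have "\<dots> = (norm v * norm x)\<^sup>2"
    by (simp add: norm_mat_sq norm_vec_sq sum_distrib_right power_mult_distrib)
  finally show "(norm (v *v x))\<^sup>2 \<le> (norm v * norm x)\<^sup>2" .
qed simp

lemma spread_le: "spread v \<le> (real CARD('k))\<^sup>2 * (norm (v :: complex ^ 'k::finite ^ 'k))\<^sup>2"
proof -
  have "spread v \<le> (\<Sum>i\<in>(UNIV::'k set). \<Sum>j\<in>(UNIV::'k set). norm v * norm v)"
    unfolding spread_def
    by (intro sum_mono order_trans[OF area_le] mult_mono norm_column_le) auto
  thus ?thesis by (simp add: power2_eq_square mult.assoc)
qed

lemma matrix_vector_scaleC: "(v :: complex ^ 'k::finite ^ 'k) *v (c *s x) = c *s (v *v x)"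
  by (simp add: vec_eq_iff matrix_vector_mult_def sum_distrib_left algebra_simps)

lemma scaleR_matrix_vector: "(c *\<^sub>R (v :: complex ^ 'k::finite ^ 'k)) *v x = of_real c *s (v *v x)"
  by (simp add: vec_eq_iff matrix_vector_mult_def sum_distrib_left scaleR_conv_of_real[where 'a=complex] algebra_simps)

lemma scaleR_mat_mult: "(c *\<^sub>R (v :: complex ^ 'k::finite ^ 'k)) ** W = c *\<^sub>R (v ** W)"
  "(v :: complex ^ 'k::finite ^ 'k) ** (c *\<^sub>R W) = c *\<^sub>R (v ** W)"
  by (simp_all add: vec_eq_iff matrix_matrix_mult_def scaleR_sum_right)

lemma continuous_wedge [continuous_intros]:
  "continuous_on S f \<Longrightarrow> continuous_on S g \<Longrightarrow> continuous_on S (\<lambda>t. wedge (f t) (g t))"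
  unfolding wedge_def by (intro continuous_intros)

lemma continuous_area [continuous_intros]:
  "continuous_on S f \<Longrightarrow> continuous_on S g \<Longrightarrow> continuous_on S (\<lambda>t. area (f t) (g t))"
  unfolding area_def by (intro continuous_intros) auto

lemma continuous_cinner [continuous_intros]:
  "continuous_on S f \<Longrightarrow> continuous_on S g \<Longrightarrow> continuous_on S (\<lambda>t. cinner (f t) (g t))"
  unfolding cinner_def by (intro continuous_intros)

lemma continuous_matrix_vector [continuous_intros]:
  fixes f :: "'a::topological_space \<Rightarrow> complex ^ 'k::finite ^ 'k"
  shows "continuous_on S f \<Longrightarrow> continuous_on S g \<Longrightarrow> continuous_on S (\<lambda>t. f t *v g t)"
  unfolding matrix_vector_mult_def by (intro continuous_intros)

lemma continuous_matrix_matrix [continuous_intros]: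
  fixes f :: "'a::topological_space \<Rightarrow> complex ^ 'k::finite ^ 'k"
  shows "continuous_on S f \<Longrightarrow> continuous_on S g \<Longrightarrow> continuous_on S (\<lambda>t. f t ** g t)"
  unfolding matrix_matrix_mult_def by (intro continuous_intros)

lemma continuous_ctrans [continuous_intros]:
  "continuous_on S f \<Longrightarrow> continuous_on S (\<lambda>t. ctrans (f t :: complex ^ 'k::finite ^ 'k))"
  unfolding ctrans_def map_matrix_def transpose_def by simp (intro continuous_intros)

lemma continuous_smult [continuous_intros]:
  fixes g :: "'a::topological_space \<Rightarrow> complex ^ 'k::finite"
  shows "continuous_on S f \<Longrightarrow> continuous_on S g \<Longrightarrow> continuous_on S (\<lambda>t. f t *s g t)"
  unfolding vector_scalar_mult_def by (intro continuous_intros)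

section \<open>Functions on projective space\<close>

lemma proj_class_eq_iff:
  assumes "x \<noteq> 0" "y \<noteq> 0"
  shows "proj_class x = proj_class y \<longleftrightarrow> (\<exists>c. y = c *s x)"
proof -
  have refl: "proj_rel z z" if "z \<noteq> 0" for z :: "complex ^ 'a"
    using that unfolding proj_rel_def by (metis vector_smult_lid)
  show ?thesis
    using Quotient_rel[OF Quotient_cproj, of x y] refl[OF assms(1)] refl[OF assms(2)] assms
    unfolding proj_rel_def by blast
qed

lemma unit_rep: "norm (unit_rep p) = 1" "proj_class (unit_rep p) = p"
proof -
  define z where "z = rep_cproj p"
  have "proj_rel z z" and z: "proj_class z = p"
    unfolding z_def using Quotient_rep_reflp[OF Quotient_cproj] Quotient_abs_rep[OF Quotient_cproj] by blast+
  hence nz: "z \<noteq> 0" unfolding proj_rel_def by blast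
  define x where "x = of_real (1 / norm z) *s z"
  have "norm x = 1" using nz by (simp add: x_def norm_smult norm_divide)
  moreover from this have "x \<noteq> 0" by auto
  hence "proj_class z = proj_class x" using nz proj_class_eq_iff x_def by blast
  ultimately have "\<exists>x. norm x = 1 \<and> proj_class x = p" using z by auto
  from someI_ex[OF this] show "norm (unit_rep p) = 1" "proj_class (unit_rep p) = p"
    unfolding unit_rep_def by auto
qed

lemma unit_rep_nonzero [simp]: "unit_rep p \<noteq> 0"
  using unit_rep(1)[of p] by auto

lemma proj_class_scale:
  assumes "c \<noteq> 0" "x \<noteq> 0" shows "proj_class (c *s x) = proj_class x"
  using proj_class_eq_iff[of x "c *s x"] assms by auto

lemma unit_rep_proj_class:
  assumes "x \<noteq> 0"
  obtains c where "x = c *s unit_rep (proj_class x)" "cmod c = norm x"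
proof -
  obtain c where c: "x = c *s unit_rep (proj_class x)"
    using proj_class_eq_iff[of "unit_rep (proj_class x)" x] assms by (auto simp: unit_rep)
  moreover have "cmod c = norm x"
    using arg_cong[OF c, of norm] by (simp add: norm_smult unit_rep)
  ultimately show ?thesis using that by blast
qed

lemma proj_dist_area: "proj_dist p q = area (unit_rep p) (unit_rep q)"
  using area_sq[of "unit_rep p" "unit_rep q"]
  by (simp add: proj_dist_def unit_rep) (metis area_nonneg real_sqrt_unique)

lemma proj_dist_class:
  assumes "x \<noteq> 0" "y \<noteq> 0"
  shows "proj_dist (proj_class x) (proj_class y) = area x y / (norm x * norm y)"
proof -
  obtain a where a: "x = a *s unit_rep (proj_class x)" "cmod a = norm x"
    using unit_rep_proj_class[OF assms(1)] .
  obtain b where b: "y = b *s unit_rep (proj_class y)" "cmod b = norm y"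
    using unit_rep_proj_class[OF assms(2)] .
  have "area x y = cmod a * cmod b * proj_dist (proj_class x) (proj_class y)"
    unfolding proj_dist_area by (subst a(1), subst b(1), rule area_scale)
  thus ?thesis using assms a b by simp
qed

lemma proj_dist_nonneg [simp]: "0 \<le> proj_dist p q" by (simp add: proj_dist_area)

lemma proj_dist_le_1: "proj_dist p q \<le> 1"
  unfolding proj_dist_area using area_le[of "unit_rep p" "unit_rep q"] by (simp add: unit_rep)

lemma proj_dist_pos: assumes "p \<noteq> q" shows "0 < proj_dist p q"
proof (rule ccontr)
  assume "\<not> 0 < proj_dist p q"
  hence "proj_dist p q = 0" using proj_dist_nonneg[of p q] by linarith
  then obtain c where "unit_rep q = c *s unit_rep p"
    unfolding proj_dist_area using cauchy_schwarz_parallel[of "unit_rep p" "unit_rep q"] by auto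
  hence "proj_class (unit_rep p) = proj_class (unit_rep q)"
    using proj_class_eq_iff[OF unit_rep_nonzero unit_rep_nonzero] by blast
  thus False using assms by (simp add: unit_rep)
qed

lemma proj_dist_le_powr: assumes "0 < \<alpha>" "\<alpha> \<le> 1" shows "proj_dist p q \<le> proj_dist p q powr \<alpha>"
proof (cases "proj_dist p q = 0")
  case False
  hence "proj_dist p q powr 1 \<le> proj_dist p q powr \<alpha>"
    using assms proj_dist_le_1[of p q] proj_dist_nonneg[of p q] by (intro powr_mono') auto
  thus ?thesis by simp
qed auto

text \<open>The chordal metric ignores phases.  With the best phase,
  \<open>|x - u y|^2 = 2 - 2 |\<langle>x, y\<rangle>|\<close>, and \<open>1 - t \<le> 1 - t^2\<close> for \<open>0 \<le> t \<le> 1\<close>.\<close>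
lemma phase_alignment:
  assumes "norm x = 1" "norm y = 1"
  obtains u where "cmod u = 1" "norm (x - u *s y) \<le> sqrt 2 * area x y"
proof -
  define c where "c = cinner x y"
  define u where "u = (if c = 0 then 1 else cnj c / of_real (cmod c))"
  have u: "cmod u = 1" by (simp add: u_def norm_divide)
  have "u * c = of_real (cmod c)"
    using complex_norm_square[of c] by (simp add: u_def divide_eq_eq mult.commute[of "cnj c"] power2_eq_square)
  hence "(norm (x - u *s y))\<^sup>2 = 2 - 2 * cmod c"
    by (simp add: norm_diff_sq cinner_scale_right norm_smult assms u c_def[symmetric])
  also have "\<dots> \<le> 2 * (1 - (cmod c)\<^sup>2)"
    using cinner_bound[of x y] assms by (simp add: c_def power2_eq_square mult_left_le)
  also have "\<dots> = (sqrt 2 * area x y)\<^sup>2"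
    by (simp add: power_mult_distrib area_sq assms c_def)
  finally have "norm (x - u *s y) \<le> sqrt 2 * area x y"
    by (rule power2_le_imp_le) simp
  with u that show ?thesis by blast
qed

text \<open>The extension to vectors that is homogeneous of degree two.  On lifted functions the
  weight \<open>|v x|^2\<close> in the Markov operator is absorbed, and iterates become integrals over
  products.\<close>
definition lift :: "('k::finite cproj \<Rightarrow> complex) \<Rightarrow> complex ^ 'k \<Rightarrow> complex" where
  "lift f x = (if x = 0 then 0 else f (proj_class x) * of_real ((norm x)\<^sup>2))"

lemma lift_0 [simp]: "lift f 0 = 0" by (simp add: lift_def)

lemma lift_unit_rep: "lift f (unit_rep p) = f p"
  by (simp add: lift_def unit_rep)

lemma lift_scale: "lift f (c *s x) = of_real ((cmod c)\<^sup>2) * lift f x"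
  by (auto simp: lift_def proj_class_scale norm_smult power_mult_distrib)

lemma markov_op_lift: "markov_op \<mu> f p = (LINT v|\<mu>. lift f (v *v unit_rep p))"
  by (simp add: markov_op_def lift_def)

lemma lift_markov_op: "lift (markov_op \<mu> f) x = (LINT v|\<mu>. lift f (v *v x))"
proof (cases "x = 0")
  case False
  then obtain c where c: "x = c *s unit_rep (proj_class x)" "cmod c = norm x"
    using unit_rep_proj_class by blast
  have "(LINT v|\<mu>. lift f (v *v x)) = (LINT v|\<mu>. of_real ((cmod c)\<^sup>2) * lift f (v *v unit_rep (proj_class x)))"
    by (subst c(1)) (simp only: matrix_vector_scaleC lift_scale)
  also have "\<dots> = of_real ((cmod c)\<^sup>2) * markov_op \<mu> f (proj_class x)"
    by (simp add: markov_op_lift)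
  finally show ?thesis using False c by (simp add: lift_def)
qed simp

text \<open>A joint bound for the supremum and the Hoelder constant.  It avoids suprema and is
  equivalent to a bound on the Hoelder norm up to a factor 2.\<close>
definition holder_bound :: "real \<Rightarrow> ('k::finite cproj \<Rightarrow> complex) \<Rightarrow> real \<Rightarrow> bool" where
  "holder_bound \<alpha> f C \<longleftrightarrow> (\<forall>p. cmod (f p) \<le> C) \<and>
     (\<forall>p q. cmod (f p - f q) \<le> C * proj_dist p q powr \<alpha>)"

lemma holder_boundD:
  assumes "holder_bound \<alpha> f C"
  shows "cmod (f p) \<le> C" "cmod (f p - f q) \<le> C * proj_dist p q powr \<alpha>" "0 \<le> C"
proof -
  show "cmod (f p) \<le> C" "cmod (f p - f q) \<le> C * proj_dist p q powr \<alpha>"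
    using assms unfolding holder_bound_def by auto
  thus "0 \<le> C" using norm_ge_zero order_trans by blast
qed

lemma holder_bound_mono:
  assumes "holder_bound \<alpha> f C" "C \<le> D" shows "holder_bound \<alpha> f D"
  using assms unfolding holder_bound_def
  by (meson mult_right_mono order_trans powr_ge_zero)

lemma holder_space_iff: "f \<in> holder_space \<alpha> \<longleftrightarrow> (\<exists>C. holder_bound \<alpha> f C)"
proof
  assume "f \<in> holder_space \<alpha>"
  then obtain B C where B: "\<And>p. cmod (f p) \<le> B" and C: "\<And>p q. cmod (f p - f q) \<le> C * proj_dist p q powr \<alpha>"
    unfolding holder_space_def bounded_iff by blast
  have "holder_bound \<alpha> f (max B C)"
    unfolding holder_bound_def
    by (auto intro!: order_trans[OF B] order_trans[OF C] mult_right_mono)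
  thus "\<exists>C. holder_bound \<alpha> f C" ..
next
  assume "\<exists>C. holder_bound \<alpha> f C"
  thus "f \<in> holder_space \<alpha>"
    unfolding holder_space_def holder_bound_def bounded_iff by auto
qed

lemma holder_bound_holder_norm:
  assumes "f \<in> holder_space \<alpha>" shows "holder_bound \<alpha> f (holder_norm \<alpha> f)"
proof -
  obtain C where C: "holder_bound \<alpha> f C" using assms holder_space_iff by blast
  let ?T = "insert 0 {cmod (f p - f q) / proj_dist p q powr \<alpha> | p q. p \<noteq> q}"
  have "bdd_above ?T"
    using holder_boundD[OF C] proj_dist_pos
    by (intro bdd_aboveI[of _ C]) (auto simp: divide_le_eq)
  hence up: "t \<le> holder_seminorm \<alpha> f" if "t \<in> ?T" for t
    unfolding holder_seminorm_def using that by (rule cSup_upper[rotated])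
  have bdd: "bdd_above (range (\<lambda>p. cmod (f p)))"
    using holder_boundD(1)[OF C] by (intro bdd_aboveI[of _ C]) auto
  have sup: "cmod (f p) \<le> (SUP p. cmod (f p))" for p
    by (rule cSUP_upper[OF UNIV_I bdd])
  have nn: "0 \<le> holder_seminorm \<alpha> f" using up by auto
  have nn': "0 \<le> (SUP p. cmod (f p))" using sup norm_ge_zero order_trans by blast
  show ?thesis unfolding holder_bound_def
  proof (intro conjI allI)
    fix p q
    show "cmod (f p) \<le> holder_norm \<alpha> f" using sup[of p] nn by (simp add: holder_norm_def)
    show "cmod (f p - f q) \<le> holder_norm \<alpha> f * proj_dist p q powr \<alpha>"
    proof (cases "p = q")
      case False
      hence "cmod (f p - f q) / proj_dist p q powr \<alpha> \<le> holder_seminorm \<alpha> f" by (intro up) auto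
      also have "\<dots> \<le> holder_norm \<alpha> f" using nn' by (simp add: holder_norm_def)
      finally show ?thesis using proj_dist_pos[OF False] by (simp add: divide_le_eq)
    qed (simp add: nn nn' holder_norm_def)
  qed
qed

lemma holder_norm_le:
  assumes "holder_bound \<alpha> f C" shows "holder_norm \<alpha> f \<le> 2 * C"
proof -
  have "holder_seminorm \<alpha> f \<le> C"
    unfolding holder_seminorm_def using holder_boundD[OF assms] proj_dist_pos
    by (intro cSup_least) (auto simp: divide_le_eq)
  moreover have "(SUP p. cmod (f p)) \<le> C"
    by (intro cSUP_least) (auto simp: holder_boundD[OF assms])
  ultimately show ?thesis by (simp add: holder_norm_def)
qed

lemma holder_bound_add:
  assumes "holder_bound \<alpha> f C" "holder_bound \<alpha> g D" shows "holder_bound \<alpha> (\<lambda>p. f p + g p) (C + D)"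
  unfolding holder_bound_def
proof (intro conjI allI)
  fix p q
  show "cmod (f p + g p) \<le> C + D"
    using norm_triangle_ineq[of "f p" "g p"] holder_boundD(1)[OF assms(1), of p] holder_boundD(1)[OF assms(2), of p] by linarith
  have "cmod (f p + g p - (f q + g q)) \<le> cmod (f p - f q) + cmod (g p - g q)"
    using norm_triangle_ineq[of "f p - f q" "g p - g q"] by (simp add: algebra_simps)
  also have "\<dots> \<le> (C + D) * proj_dist p q powr \<alpha>"
    using holder_boundD(2)[OF assms(1), of p q] holder_boundD(2)[OF assms(2), of p q] by (simp add: distrib_right)
  finally show "cmod (f p + g p - (f q + g q)) \<le> (C + D) * proj_dist p q powr \<alpha>" .
qed

lemma holder_bound_scale:
  assumes "holder_bound \<alpha> f C" shows "holder_bound \<alpha> (\<lambda>p. c * f p) (cmod c * C)"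
  unfolding holder_bound_def
  using holder_boundD[OF assms]
  by (auto simp: norm_mult right_diff_distrib[symmetric] mult.assoc intro!: mult_left_mono)

lemma holder_bound_diff:
  assumes "holder_bound \<alpha> f C" "holder_bound \<alpha> g D" shows "holder_bound \<alpha> (\<lambda>p. f p - g p) (C + D)"
  using holder_bound_add[OF assms(1) holder_bound_scale[OF assms(2), of "-1"]] by simp

lemma lift_bound:
  assumes "\<And>p. cmod (f p) \<le> C" shows "cmod (lift f x) \<le> C * (norm x)\<^sup>2"
  using assms by (auto simp: lift_def norm_mult norm_power intro!: mult_right_mono)

text \<open>Away from 0 this is continuity of a Hoelder function; at 0 the factor \<open>|x|^2\<close> takes
  over.\<close>
lemma continuous_lift:
  assumes "holder_bound \<alpha> f C" "0 < \<alpha>"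
  shows "continuous_on UNIV (lift f)"
proof (rule continuous_at_imp_continuous_on, rule ballI)
  fix x :: "complex ^ 'a"
  show "isCont (lift f) x"
  proof (cases "x = 0")
    case True
    have "((\<lambda>y :: complex ^ 'a. C * (norm y)\<^sup>2) \<longlongrightarrow> C * (norm (0 :: complex ^ 'a))\<^sup>2) (at 0)"
      by (intro tendsto_mult tendsto_const tendsto_power tendsto_norm[OF tendsto_ident_at])
    hence "(lift f \<longlongrightarrow> 0) (at 0)"
      by (intro Lim_null_comparison[of "lift f" "\<lambda>y. C * (norm y)\<^sup>2"])
        (auto simp: lift_bound[OF holder_boundD(1)[OF assms(1)]])
    thus ?thesis unfolding True isCont_def by simp
  next
    case False
    have ev: "\<forall>\<^sub>F y in at x. y \<noteq> 0"
      using tendsto_imp_eventually_ne[OF tendsto_ident_at False] .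
    have cont: "((\<lambda>y. area y x) \<longlongrightarrow> area x x) (at x)"
      using continuous_area[OF continuous_on_id continuous_on_const, of UNIV x]
      by (auto simp: continuous_on_eq_continuous_at isCont_def simp del: area_self)
    have "((\<lambda>y. area y x / (norm y * norm x)) \<longlongrightarrow> 0 / (norm x * norm x)) (at x)"
      by (rule tendsto_divide) (use cont False in \<open>auto intro!: tendsto_intros\<close>)
    hence "((\<lambda>y. (area y x / (norm y * norm x)) powr \<alpha>) \<longlongrightarrow> 0) (at x)"
      using tendsto_zero_powrI[OF _ tendsto_const, of _ "at x" \<alpha>] assms(2) by simp
    hence "((\<lambda>y. C * (area y x / (norm y * norm x)) powr \<alpha>) \<longlongrightarrow> 0) (at x)"
      by (rule tendsto_mult_right_zero)
    hence "((\<lambda>y. f (proj_class y) - f (proj_class x)) \<longlongrightarrow> 0) (at x)"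
    proof (rule Lim_null_comparison[rotated])
      show "\<forall>\<^sub>F y in at x. cmod (f (proj_class y) - f (proj_class x)) \<le> C * (area y x / (norm y * norm x)) powr \<alpha>"
        using ev
      proof eventually_elim
        case (elim y)
        show ?case using holder_boundD(2)[OF assms(1), of "proj_class y" "proj_class x"]
            proj_dist_class[OF elim False] by simp
      qed
    qed
    hence "((\<lambda>y. f (proj_class y)) \<longlongrightarrow> f (proj_class x)) (at x)"
      by (simp add: LIM_zero_iff)
    hence "((\<lambda>y. f (proj_class y) * of_real ((norm y)\<^sup>2)) \<longlongrightarrow> f (proj_class x) * of_real ((norm x)\<^sup>2)) (at x)"
      by (intro tendsto_intros)
    moreover have "\<forall>\<^sub>F y in at x. f (proj_class y) * of_real ((norm y)\<^sup>2) = lift f y"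
      using ev by eventually_elim (simp add: lift_def)
    ultimately show ?thesis
      unfolding isCont_def using False by (auto simp: lift_def[of f x] elim: Lim_transform_eventually)
  qed
qed

definition quadform :: "complex ^ 'k::finite ^ 'k \<Rightarrow> 'k cproj \<Rightarrow> complex" where
  "quadform A p = cinner (unit_rep p) (A *v unit_rep p)"

lemma lift_quadform: "lift (quadform A) x = cinner x (A *v x)"
proof (cases "x = 0")
  case False
  then obtain c where c: "x = c *s unit_rep (proj_class x)" "cmod c = norm x"
    using unit_rep_proj_class by blast
  have "lift (quadform A) x = of_real ((cmod c)\<^sup>2) * quadform A (proj_class x)"
    using False c(2) by (simp add: lift_def mult.commute)
  also have "\<dots> = cinner (c *s unit_rep (proj_class x)) (A *v (c *s unit_rep (proj_class x)))"
    by (simp add: matrix_vector_scaleC cinner_simps quadform_def complex_norm_square mult.commute mult.left_commute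
        del: of_real_power)
  finally show ?thesis using c by simp
qed simp

text \<open>Expanding \<open>\<langle>x, A x\<rangle> - \<langle>w, A w\<rangle>\<close> for a representative \<open>w\<close> of the second point with
  aligned phase gives a Lipschitz bound, and the metric is at most 1.\<close>
lemma quadform_bound: assumes "0 < \<alpha>" "\<alpha> \<le> 1" shows "holder_bound \<alpha> (quadform A) (3 * norm A)"
  unfolding holder_bound_def
proof (intro conjI allI)
  fix p q :: "'a cproj"
  let ?x = "unit_rep p" and ?y = "unit_rep q"
  have b: "cmod (cinner w (A *v z)) \<le> norm A * (norm w * norm z)" for w z
    using order_trans[OF cinner_bound mult_left_mono[OF norm_matrix_vector_le norm_ge_zero], of w A z]
    by (simp add: mult_ac)
  show "cmod (quadform A p) \<le> 3 * norm A"
    using b[of ?x ?x] norm_ge_zero[of A] unfolding quadform_def by (simp add: unit_rep del: norm_ge_zero)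
  obtain u where u: "cmod u = 1" "norm (?x - u *s ?y) \<le> sqrt 2 * area ?x ?y"
    using phase_alignment[OF unit_rep(1) unit_rep(1)] .
  let ?w = "u *s ?y"
  have "cinner ?w (A *v ?w) = (cnj u * u) * quadform A q"
    by (simp add: quadform_def matrix_vector_scaleC cinner_simps)
  also have "cnj u * u = 1" using u(1) by (simp add: mult.commute complex_norm_square[symmetric])
  finally have "quadform A p - quadform A q = cinner ?x (A *v (?x - ?w)) + cinner (?x - ?w) (A *v ?w)"
    by (simp add: quadform_def cinner_simps matrix_vector_mult_diff_distrib)
  hence "cmod (quadform A p - quadform A q) \<le> norm A * norm (?x - ?w) + norm A * norm (?x - ?w)"
    using norm_triangle_ineq[of "cinner ?x (A *v (?x - ?w))" "cinner (?x - ?w) (A *v ?w)"]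
      b[of ?x "?x - ?w"] b[of "?x - ?w" ?w] by (simp add: unit_rep norm_smult u(1))
  also have "\<dots> \<le> 2 * norm A * (sqrt 2 * area ?x ?y)"
    using mult_left_mono[OF u(2), of "2 * norm A"] by simp
  also have "\<dots> = (2 * sqrt 2) * (norm A * proj_dist p q)" by (simp add: proj_dist_area)
  also have "\<dots> \<le> 3 * (norm A * proj_dist p q powr \<alpha>)"
    using proj_dist_le_powr[OF assms, of p q]
    using real_le_lsqrt[of "3/2" 2] by (intro mult_mono mult_left_mono) (auto simp: power2_eq_square)
  finally show "cmod (quadform A p - quadform A q) \<le> 3 * norm A * proj_dist p q powr \<alpha>" by (simp add: mult.assoc)
qed

lemma holder_bound_quotient:
  assumes "holder_bound \<alpha> f C" "x \<noteq> 0" "y \<noteq> 0"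
  shows "cmod (f (proj_class x) - f (proj_class y)) \<le> C * (area x y / (norm x * norm y)) powr \<alpha>"
  using holder_boundD(2)[OF assms(1), of "proj_class x" "proj_class y"] proj_dist_class[OF assms(2,3)] by simp

section \<open>Random products of matrices\<close>

lemma norm_matrix_mult_le: "norm ((v :: complex ^ 'k::finite ^ 'k) ** W) \<le> norm v * norm (W :: complex ^ 'k::finite ^ 'k)"
proof (rule power2_le_imp_le)
  have "(norm (v ** W))\<^sup>2 = (\<Sum>i\<in>UNIV. (norm (v *v (W *v axis i 1)))\<^sup>2)"
    by (simp only: norm_mat_columns[of "v ** W"] matrix_vector_mul_assoc)
  also have "\<dots> \<le> (\<Sum>i\<in>UNIV. (norm v)\<^sup>2 * (norm (W *v axis i 1))\<^sup>2)"
    unfolding power_mult_distrib[symmetric] by (intro sum_mono power_mono norm_matrix_vector_le) auto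
  also have "\<dots> = (norm v * norm W)\<^sup>2"
    unfolding norm_mat_columns[of W] power_mult_distrib sum_distrib_left ..
  finally show "(norm (v ** W))\<^sup>2 \<le> (norm v * norm W)\<^sup>2" .
qed simp

text \<open>The normalised measures.  Bounded support makes every continuous function integrable,
  and the class is closed under random products.\<close>
locale kraus_prob = prob_space Q for Q :: "(complex ^ 'k::finite ^ 'k) measure" +
  assumes sets_Q: "sets Q = sets borel"
    and norm_bounded: "\<exists>B. AE v in Q. norm v \<le> B"
    and unital: "(LINT v|Q. (norm (v *v x))\<^sup>2) = (norm x)\<^sup>2"
begin

lemma space_Q [simp]: "space Q = UNIV"
  using sets_eq_imp_space_eq[OF sets_Q] by simp

lemma measurable_Q: "f \<in> borel_measurable borel \<Longrightarrow> f \<in> borel_measurable Q"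
  using measurable_cong_sets[OF sets_Q refl] by blast

text \<open>The support is bounded, so quadratic growth is harmless.\<close>
lemma integrable_quadratic:
  fixes f :: "complex ^ 'k ^ 'k \<Rightarrow> 'b::{banach, second_countable_topology}"
  assumes "f \<in> borel_measurable borel" "\<And>v. norm (f v) \<le> C * (norm v)\<^sup>2"
  shows "integrable Q f"
proof -
  obtain B where B: "AE v in Q. norm v \<le> B" using norm_bounded by blast
  have "AE v in Q. norm (f v) \<le> \<bar>C\<bar> * B\<^sup>2"
    using B
  proof eventually_elim
    case (elim v)
    have "norm (f v) \<le> \<bar>C\<bar> * (norm v)\<^sup>2"
      by (rule order_trans[OF assms(2)]) (simp add: mult_right_mono)
    also have "\<dots> \<le> \<bar>C\<bar> * B\<^sup>2" using elim by (intro mult_left_mono power_mono) auto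
    finally show ?case .
  qed
  thus ?thesis using measurable_Q[OF assms(1)] by (rule integrable_const_bound)
qed

lemma integrable_continuous:
  fixes f :: "complex ^ 'k ^ 'k \<Rightarrow> 'b::{banach, second_countable_topology}"
  assumes "continuous_on UNIV f" shows "integrable Q f"
proof -
  obtain B where B: "AE v in Q. norm v \<le> B" using norm_bounded by blast
  have "compact (f ` cball 0 B)"
    by (intro compact_continuous_image continuous_on_subset[OF assms]) auto
  then obtain C where "\<And>v. norm v \<le> B \<Longrightarrow> norm (f v) \<le> C"
    using compact_imp_bounded[THEN bounded_iff[THEN iffD1]] by (metis image_eqI mem_cball_0)
  with B have "AE v in Q. norm (f v) \<le> C" by (auto elim: eventually_mono)
  thus ?thesis using measurable_Q[OF borel_measurable_continuous_onI[OF assms]]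
    by (rule integrable_const_bound)
qed

lemma integral_norm_sq: "(LINT v|Q. (norm v)\<^sup>2) = real CARD('k)"
proof -
  have "(LINT v|Q. (norm v)\<^sup>2) = (\<Sum>i\<in>UNIV. LINT v|Q. (norm (v *v axis i 1))\<^sup>2)"
    unfolding norm_mat_columns
    by (intro Bochner_Integration.integral_sum integrable_continuous continuous_intros)
  also have "\<dots> = real CARD('k)" by (simp add: unital)
  finally show ?thesis .
qed

end

text \<open>The law of \<open>v W\<close> for independent \<open>W\<close> and \<open>v\<close>.\<close>
definition step_law :: "(complex ^ 'k::finite ^ 'k) measure \<Rightarrow> (complex ^ 'k ^ 'k) measure \<Rightarrow> (complex ^ 'k ^ 'k) measure" where
  "step_law R Q = distr (R \<Otimes>\<^sub>M Q) borel (\<lambda>(W, v). v ** W)"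

lemma measurable_mult_pair:
  assumes "sets R = sets borel" "sets Q = sets borel"
  shows "(\<lambda>(W, v). (v :: complex ^ 'k::finite ^ 'k) ** (W :: complex ^ 'k ^ 'k)) \<in> measurable (R \<Otimes>\<^sub>M Q) borel"
proof -
  have "(\<lambda>p. (snd p :: complex ^ 'k ^ 'k) ** (fst p :: complex ^ 'k ^ 'k)) \<in> borel_measurable (borel :: ((complex ^ 'k ^ 'k) \<times> (complex ^ 'k ^ 'k)) measure)"
    by (intro borel_measurable_continuous_onI continuous_intros)
  hence "(\<lambda>(W :: complex ^ 'k ^ 'k, v :: complex ^ 'k ^ 'k). v ** W) \<in> measurable (borel \<Otimes>\<^sub>M borel) (borel :: (complex ^ 'k ^ 'k) measure)"
    by (simp add: borel_prod case_prod_unfold)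
  thus ?thesis
    using measurable_cong_sets[OF sets_pair_measure_cong[OF assms] refl] by blast
qed

lemma AE_step_law:
  assumes "kraus_prob (R :: (complex ^ 'k::finite ^ 'k) measure)" "kraus_prob Q" "{v. P v} \<in> sets borel"
  shows "(AE v in step_law R Q. P v) \<longleftrightarrow> (AE W in R. AE v in Q. P (v ** W))"
proof -
  interpret R: kraus_prob R by fact
  interpret Q: kraus_prob Q by fact
  interpret pair_prob_space R Q ..
  note m = measurable_mult_pair[OF R.sets_Q Q.sets_Q]
  have "(AE v in step_law R Q. P v) \<longleftrightarrow> (AE p in R \<Otimes>\<^sub>M Q. P (snd p ** fst p))"
    unfolding step_law_def using assms(3) by (subst AE_distr_iff[OF m]) (auto simp: case_prod_unfold)
  also have "\<dots> \<longleftrightarrow> (AE W in R. AE v in Q. P (v ** W))"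
  proof (rule AE_pair_iff[symmetric])
    have "(\<lambda>(W, v). v ** W) -` {v. P v} \<inter> space (R \<Otimes>\<^sub>M Q) \<in> sets (R \<Otimes>\<^sub>M Q)"
      by (rule measurable_sets[OF m assms(3)])
    thus "{x \<in> space (R \<Otimes>\<^sub>M Q). P (snd x ** fst x)} \<in> sets (R \<Otimes>\<^sub>M Q)"
      by (simp add: vimage_def case_prod_unfold Int_def conj_commute)
  qed
  finally show ?thesis .
qed

lemma integral_step_law_aux:
  fixes f :: "complex ^ 'k::finite ^ 'k \<Rightarrow> 'b::{banach, second_countable_topology}"
  assumes "kraus_prob R" "kraus_prob Q" "continuous_on UNIV f" "integrable (step_law R Q) f"
  shows "(LINT v|step_law R Q. f v) = (LINT W|R. LINT v|Q. f (v ** W))"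
proof -
  interpret R: kraus_prob R by fact
  interpret Q: kraus_prob Q by fact
  interpret pair_prob_space R Q ..
  note m = measurable_mult_pair[OF R.sets_Q Q.sets_Q]
  note f = borel_measurable_continuous_onI[OF assms(3)]
  have "integrable (R \<Otimes>\<^sub>M Q) (\<lambda>p. f (case p of (W, v) \<Rightarrow> v ** W))"
    using assms(4) unfolding step_law_def by (subst (asm) integrable_distr_eq[OF m f])
  hence "(LINT W|R. LINT v|Q. f (v ** W)) = (LINT p|(R \<Otimes>\<^sub>M Q). f (case p of (W, v) \<Rightarrow> v ** W))"
    using integral_fst'[of "\<lambda>p. f (case p of (W, v) \<Rightarrow> v ** W)"] by simp
  thus ?thesis unfolding step_law_def by (simp add: integral_distr[OF m f])
qed

text \<open>Conditioning on the first factor, \<open>|v W x|^2\<close> has mean \<open>|W x|^2\<close>.\<close>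
lemma kraus_step_law:
  assumes "kraus_prob (R :: (complex ^ 'k::finite ^ 'k) measure)" "kraus_prob Q" shows "kraus_prob (step_law R Q)"
proof -
  interpret R: kraus_prob R by fact
  interpret Q: kraus_prob Q by fact
  interpret pair_prob_space R Q ..
  note m = measurable_mult_pair[OF R.sets_Q Q.sets_Q]
  interpret D: prob_space "step_law R Q" unfolding step_law_def by (rule prob_space_distr[OF m])
  obtain B where B: "AE v in R. norm v \<le> B" using R.norm_bounded by blast
  obtain C where C: "AE v in Q. norm v \<le> C" using Q.norm_bounded by blast
  have "AE W in R. AE v in Q. norm (v ** W) \<le> \<bar>C\<bar> * \<bar>B\<bar>"
    using B
  proof eventually_elim
    case (elim W)
    note W = elim
    show ?case using C
    proof eventually_elim
      case (elim v)
      show ?case using elim W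
        by (intro order_trans[OF norm_matrix_mult_le] mult_mono) auto
    qed
  qed
  hence bound: "AE v in step_law R Q. norm v \<le> \<bar>C\<bar> * \<bar>B\<bar>"
    by (subst AE_step_law[OF assms]) (auto intro!: borel_closed closed_Collect_le continuous_intros)
  show ?thesis
  proof
    show "sets (step_law R Q) = sets borel" by (simp add: step_law_def)
    show "\<exists>B. AE v in step_law R Q. norm v \<le> B" using bound by blast
    fix x :: "complex ^ 'k"
    have cont: "continuous_on UNIV (\<lambda>v :: complex ^ 'k ^ 'k. (norm (v *v x))\<^sup>2)" by (intro continuous_intros)
    have "AE v in step_law R Q. norm ((norm (v *v x))\<^sup>2) \<le> ((\<bar>C\<bar> * \<bar>B\<bar>) * norm x)\<^sup>2"
      using bound
    proof eventually_elim
      case (elim v)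
      show ?case using elim
        by (auto intro!: power_mono order_trans[OF norm_matrix_vector_le] mult_right_mono)
    qed
    moreover have "(\<lambda>v. (norm (v *v x))\<^sup>2) \<in> borel_measurable (step_law R Q)"
      unfolding step_law_def using borel_measurable_continuous_onI[OF cont] by simp
    ultimately have "integrable (step_law R Q) (\<lambda>v. (norm (v *v x))\<^sup>2)"
      by (rule D.integrable_const_bound)
    from integral_step_law_aux[OF assms cont this]
    have "(LINT v|step_law R Q. (norm (v *v x))\<^sup>2) = (LINT W|R. LINT v|Q. (norm (v *v (W *v x)))\<^sup>2)"
      by (simp add: matrix_vector_mul_assoc)
    thus "(LINT v|step_law R Q. (norm (v *v x))\<^sup>2) = (norm x)\<^sup>2"
      by (simp add: Q.unital R.unital)
  qed
qed

lemma integral_step_law: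
  fixes f :: "complex ^ 'k::finite ^ 'k \<Rightarrow> 'b::{banach, second_countable_topology}"
  assumes "kraus_prob R" "kraus_prob Q" "continuous_on UNIV f"
  shows "(LINT v|step_law R Q. f v) = (LINT W|R. LINT v|Q. f (v ** W))"
  by (intro integral_step_law_aux assms kraus_prob.integrable_continuous kraus_step_law)

text \<open>The law of \<open>v_n ... v_1\<close> for independent factors.  The newest factor is on the left,
  as in \<open>left_prod\<close>.\<close>
primrec product_law :: "(complex ^ 'k::finite ^ 'k) measure \<Rightarrow> nat \<Rightarrow> (complex ^ 'k ^ 'k) measure" where
  "product_law Q 0 = return borel (mat 1)"
| "product_law Q (Suc n) = step_law (product_law Q n) Q"

lemma kraus_product_law: assumes "kraus_prob (Q :: (complex ^ 'a::finite ^ 'a) measure)" shows "kraus_prob (product_law Q n)"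
proof (induction n)
  case 0
  interpret prob_space "return borel (mat 1 :: complex ^ 'a ^ 'a)" by (rule prob_space_return) simp
  have "kraus_prob (return borel (mat 1 :: complex ^ 'a ^ 'a))"
  proof
    show "\<exists>B. AE v in return borel (mat 1 :: complex ^ 'a ^ 'a). norm v \<le> B"
      by (rule exI[of _ "norm (mat 1 :: complex ^ 'a ^ 'a)"], subst AE_return)
        (auto intro!: borel_closed closed_Collect_le continuous_intros)
    fix x :: "complex ^ 'a"
    have "(\<lambda>v :: complex ^ 'a ^ 'a. (norm (v *v x))\<^sup>2) \<in> borel_measurable borel"
      by (intro borel_measurable_continuous_onI continuous_intros)
    thus "(LINT v|return borel (mat 1 :: complex ^ 'a ^ 'a). (norm (v *v x))\<^sup>2) = (norm x)\<^sup>2"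
      by (subst integral_return) auto
  qed simp
  thus ?case by simp
next
  case (Suc n)
  thus ?case using assms by (auto intro: kraus_step_law)
qed

section \<open>Contraction of areas\<close>

definition mean_area :: "(complex ^ 'k::finite ^ 'k) measure \<Rightarrow> complex ^ 'k \<Rightarrow> complex ^ 'k \<Rightarrow> real" where
  "mean_area Q x y = (LINT v|Q. area (v *v x) (v *v y))"

definition orthonormal :: "complex ^ 'k::finite \<Rightarrow> complex ^ 'k \<Rightarrow> bool" where
  "orthonormal x y \<longleftrightarrow> norm x = 1 \<and> norm y = 1 \<and> cinner x y = 0"

text \<open>Gram--Schmidt: a shear changes neither the area of \<open>x, y\<close> nor that of their images.\<close>
lemma area_orthonormalize:
  assumes "area x (y :: complex ^ 'k::finite) \<noteq> 0"
  obtains x' y' where "orthonormal x' y'" "\<And>v :: complex ^ 'k ^ 'k. area (v *v x) (v *v y) = area x y * area (v *v x') (v *v y')"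
proof -
  have x: "x \<noteq> 0"
    using assms area_le[of x y] area_nonneg[of x y] by (metis antisym mult_zero_left norm_zero)
  define x' where "x' = of_real (1 / norm x) *s x"
  have x': "norm x' = 1" "x = of_real (norm x) *s x'" using x by (simp_all add: x'_def norm_smult norm_divide)
  define y1 where "y1 = y - cinner x' y *s x'"
  have y: "y = y1 + (cinner x' y / of_real (norm x)) *s x"
    using x by (simp add: y1_def x'_def)
  have o: "cinner x' y1 = 0"
    by (simp add: y1_def cinner_simps cinner_self x')
  have a: "area (v *v x) (v *v y) = norm x * area (v *v x') (v *v y1)" for v :: "complex ^ 'k ^ 'k"
  proof -
    have "area (v *v x) (v *v y) = area (v *v x) (v *v y1)"
      by (subst y) (simp add: matrix_vector_right_distrib matrix_vector_scaleC area_shear)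
    also have "\<dots> = norm x * area (v *v x') (v *v y1)"
      by (subst x'(2)) (use area_scale[of "of_real (norm x)" "v *v x'" 1 "v *v y1"] in \<open>simp add: matrix_vector_scaleC\<close>)
    finally show ?thesis .
  qed
  have y1: "y1 \<noteq> 0"
  proof
    assume "y1 = 0"
    hence "area x y = norm x * area x' 0" using a[of "mat 1"] by simp
    also have "area x' 0 = 0" using area_le[of x' 0] area_nonneg[of x' 0] by simp
    finally show False using assms by simp
  qed
  define y' where "y' = of_real (1 / norm y1) *s y1"
  have y': "norm y' = 1" "y1 = of_real (norm y1) *s y'" using y1 by (simp_all add: y'_def norm_smult norm_divide)
  have on: "orthonormal x' y'"
    unfolding orthonormal_def using x' y' o by (auto simp: y'_def cinner_simps)
  have a': "area (v *v x) (v *v y) = norm x * norm y1 * area (v *v x') (v *v y')" for v :: "complex ^ 'k ^ 'k"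
    unfolding a by (subst y'(2)) (use area_scale[of 1 "v *v x'" "of_real (norm y1)" "v *v y'"] in \<open>simp add: matrix_vector_scaleC\<close>)
  have "area x y = norm x * norm y1"
    using a'[of "mat 1"] area_orthonormal[of x' y'] on unfolding orthonormal_def by simp
  with a' on that show ?thesis by simp
qed

lemma mean_area_le_factor:
  assumes "\<And>x y. orthonormal x y \<Longrightarrow> mean_area Q x y \<le> c"
  shows "mean_area (Q :: (complex ^ 'a::finite ^ 'a) measure) x y \<le> c * area x y"
proof (cases "area x y = 0")
  case True
  have "area (v *v x) (v *v y) = 0" for v :: "complex ^ 'a ^ 'a"
    using area_matrix_le[of v x y] area_nonneg[of "v *v x" "v *v y"] True by simp
  thus ?thesis using True by (simp add: mean_area_def)
next
  case False
  then obtain x' y' where *: "orthonormal x' y'" "\<And>v :: complex ^ 'a ^ 'a. area (v *v x) (v *v y) = area x y * area (v *v x') (v *v y')"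
    using area_orthonormalize by blast
  have "mean_area Q x y = area x y * mean_area Q x' y'"
    unfolding mean_area_def *(2) by simp
  also have "\<dots> \<le> area x y * c" using assms[OF *(1)] by (intro mult_left_mono) auto
  finally show ?thesis by (simp add: mult.commute)
qed

text \<open>The mean of \<open>(|v x|^2 + |v y|^2) / 2\<close> is 1.\<close>
lemma (in kraus_prob) mean_area_orthonormal_le:
  assumes "orthonormal x y" shows "mean_area Q x y \<le> 1"
proof -
  have "mean_area Q x y \<le> (LINT v|Q. ((norm (v *v x))\<^sup>2 + (norm (v *v y))\<^sup>2) / 2)"
    unfolding mean_area_def
    by (intro integral_mono integrable_continuous continuous_intros area_le_mean) auto
  also have "\<dots> = ((LINT v|Q. (norm (v *v x))\<^sup>2) + (LINT v|Q. (norm (v *v y))\<^sup>2)) / 2"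
    by (subst Bochner_Integration.integral_add[symmetric]) (auto intro!: integrable_continuous continuous_intros)
  also have "\<dots> = 1" using assms by (simp add: unital orthonormal_def)
  finally show ?thesis .
qed

lemma (in kraus_prob) mean_area_le: "mean_area Q x y \<le> area x y"
  using mean_area_le_factor[of Q 1] mean_area_orthonormal_le by simp

lemma mean_area_Suc:
  assumes "kraus_prob Q"
  shows "mean_area (product_law Q (Suc n)) x y = (LINT W|product_law Q n. mean_area Q (W *v x) (W *v y))"
  unfolding mean_area_def product_law.simps
  by (subst integral_step_law[OF kraus_product_law[OF assms] assms])
    (auto intro!: continuous_intros simp: matrix_vector_mul_assoc)

lemma (in kraus_prob) continuous_mean_area:
  assumes "f \<longlonglongrightarrow> x" "g \<longlonglongrightarrow> y" shows "(\<lambda>n. mean_area Q (f n) (g n)) \<longlonglongrightarrow> mean_area Q x y"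
proof -
  have "Bseq f" "Bseq g" using assms convergent_def convergent_imp_Bseq by blast+
  then obtain A B where A: "\<And>n. norm (f n) \<le> A" and B: "\<And>n. norm (g n) \<le> B" and "0 < A" "0 < B"
    unfolding Bseq_def by blast
  have cont: "continuous_on UNIV (\<lambda>p. area (v *v fst p) (v *v snd p))" for v :: "complex ^ 'k ^ 'k"
    by (intro continuous_intros)
  show ?thesis unfolding mean_area_def
  proof (rule integral_dominated_convergence[where w = "\<lambda>v. (norm v)\<^sup>2 * (A * B)"])
    show "integrable Q (\<lambda>v. (norm v)\<^sup>2 * (A * B))" by (intro integrable_continuous continuous_intros)
    show "AE v in Q. (\<lambda>n. area (v *v f n) (v *v g n)) \<longlonglongrightarrow> area (v *v x) (v *v y)"
    proof (rule AE_I2)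
      fix v :: "complex ^ 'k ^ 'k"
      have "isCont (\<lambda>p. area (v *v fst p) (v *v snd p)) (x, y)"
        using cont[of v] by (simp add: continuous_on_eq_continuous_at)
      from isCont_tendsto_compose[OF this tendsto_Pair[OF assms]]
      show "(\<lambda>n. area (v *v f n) (v *v g n)) \<longlonglongrightarrow> area (v *v x) (v *v y)" by simp
    qed
    show "AE v in Q. norm (area (v *v f n) (v *v g n)) \<le> (norm v)\<^sup>2 * (A * B)" for n
    proof (rule AE_I2)
      fix v :: "complex ^ 'k ^ 'k"
      have "area (v *v f n) (v *v g n) \<le> norm (v *v f n) * norm (v *v g n)" by (rule area_le)
      also have "\<dots> \<le> (norm v * A) * (norm v * B)"
        using \<open>0 < A\<close> A B by (intro mult_mono order_trans[OF norm_matrix_vector_le] mult_left_mono) auto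
      finally show "norm (area (v *v f n) (v *v g n)) \<le> (norm v)\<^sup>2 * (A * B)"
        by (simp add: power2_eq_square mult_ac)
    qed
  qed (auto intro!: measurable_Q borel_measurable_continuous_onI continuous_intros)
qed

lemma (in kraus_prob) continuous_mean_area_image:
  "continuous_on UNIV (\<lambda>W :: complex ^ 'k ^ 'k. mean_area Q (W *v x) (W *v y))"
  unfolding continuous_on_sequentially o_def
proof (intro ballI allI impI, elim conjE)
  fix f :: "nat \<Rightarrow> complex ^ 'k ^ 'k" and W assume f: "f \<longlonglongrightarrow> W"
  have c: "isCont (\<lambda>W :: complex ^ 'k ^ 'k. W *v z) W" for z
  proof -
    have "continuous_on UNIV (\<lambda>W :: complex ^ 'k ^ 'k. W *v z)" by (intro continuous_intros)
    thus ?thesis by (simp add: continuous_on_eq_continuous_at)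
  qed
  show "(\<lambda>n. mean_area Q (f n *v x) (f n *v y)) \<longlonglongrightarrow> mean_area Q (W *v x) (W *v y)"
    by (intro continuous_mean_area isCont_tendsto_compose[OF c f])
qed

lemma mean_area_antimono:
  assumes "kraus_prob (Q :: (complex ^ 'a::finite ^ 'a) measure)" "j \<le> n" shows "mean_area (product_law Q n) x y \<le> mean_area (product_law Q j) x y"
  using assms(2)
proof (induction n rule: dec_induct)
  case (step n)
  interpret Q: kraus_prob Q by fact
  interpret Qn: kraus_prob "product_law Q n" by (rule kraus_product_law) fact
  have "mean_area (product_law Q (Suc n)) x y \<le> mean_area (product_law Q n) x y"
    unfolding mean_area_Suc[OF assms(1)]
  proof (unfold mean_area_def[of "product_law Q n"], rule integral_mono)
  qed (auto intro!: Qn.integrable_continuous Q.continuous_mean_area_image continuous_intros Q.mean_area_le)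
  with step show ?case by linarith
qed simp

text \<open>Conditionally on the product of the first \<open>n\<close> factors, the next one multiplies the
  area by at most \<open>c\<close> in the mean.\<close>
lemma mean_area_geometric:
  assumes "kraus_prob (Q :: (complex ^ 'a::finite ^ 'a) measure)" "0 \<le> c" "\<And>x y. mean_area Q x y \<le> c * area x y"
  shows "mean_area (product_law Q n) x y \<le> c ^ n * area x y"
proof (induction n)
  case 0
  have "(\<lambda>v. area (v *v x) (v *v y)) \<in> borel_measurable (borel :: (complex ^ 'a ^ 'a) measure)"
    by (intro borel_measurable_continuous_onI continuous_intros)
  thus ?case unfolding mean_area_def product_law.simps by (subst integral_return) auto
next
  case (Suc n)
  interpret Q: kraus_prob Q by fact
  interpret Qn: kraus_prob "product_law Q n" by (rule kraus_product_law) fact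
  have "mean_area (product_law Q (Suc n)) x y \<le> (LINT W|product_law Q n. c * area (W *v x) (W *v y))"
    unfolding mean_area_Suc[OF assms(1)]
    by (intro integral_mono assms(3) Qn.integrable_continuous Q.continuous_mean_area_image continuous_intros)
  also have "\<dots> = c * mean_area (product_law Q n) x y" by (simp add: mean_area_def)
  also have "\<dots> \<le> c * (c ^ n * area x y)" using Suc assms(2) by (intro mult_left_mono)
  finally show ?case by (simp add: mult.assoc)
qed

text \<open>The mean areas do not increase in \<open>n\<close> and are continuous, and orthonormal pairs form a
  compact set.  So if no \<open>n\<close> had a uniform constant below 1, a limit of bad pairs would have
  mean area at least 1 for all \<open>n\<close>.\<close>
lemma uniform_area_contraction:
  assumes "kraus_prob (Q :: (complex ^ 'k::finite ^ 'k) measure)"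
    and "\<And>x y. orthonormal x y \<Longrightarrow> \<exists>n. mean_area (product_law Q n) x y < 1"
  obtains n c where "0 \<le> c" "c < 1" "\<And>x y. mean_area (product_law Q n) x y \<le> c * area x y"
proof -
  interpret Q: kraus_prob Q by fact
  have "\<exists>n. \<exists>c\<ge>0. c < 1 \<and> (\<forall>x y. orthonormal x y \<longrightarrow> mean_area (product_law Q n) x y \<le> c)"
  proof (rule ccontr)
    assume neg: "\<not> ?thesis"
    (* Failure of the constants 1 - 1 / (n + 1) provides a sequence of bad pairs. *)
    have "\<exists>p. orthonormal (fst p) (snd p) \<and> 1 - 1 / real (Suc n) < mean_area (product_law Q n) (fst p) (snd p)" for n
      using neg[simplified, rule_format, of "1 - 1 / real (Suc n)" n] by (force simp: not_le)
    then obtain p where p: "\<And>n. orthonormal (fst (p n)) (snd (p n))"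
        "\<And>n. 1 - 1 / real (Suc n) < mean_area (product_law Q n) (fst (p n)) (snd (p n))"
      by metis
    let ?K = "{q :: (complex ^ 'k) \<times> (complex ^ 'k). orthonormal (fst q) (snd q)}"
    have "compact ?K"
    proof (subst compact_eq_bounded_closed, intro conjI)
      have "norm q \<le> 2" if "q \<in> ?K" for q
        using that norm_Pair_le[of "fst q" "snd q"] by (simp add: orthonormal_def)
      thus "bounded ?K" unfolding bounded_iff by blast
      show "closed ?K" unfolding orthonormal_def
        by (intro closed_Collect_conj closed_Collect_eq continuous_intros)
    qed
    then obtain q r where qr: "q \<in> ?K" "strict_mono r" "(p \<circ> r) \<longlonglongrightarrow> q"
      using p(1) unfolding compact_def by (metis (mono_tags, lifting) mem_Collect_eq)
    obtain j where j: "mean_area (product_law Q j) (fst q) (snd q) < 1" using assms(2) qr(1) by blast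
    interpret Qj: kraus_prob "product_law Q j" by (rule kraus_product_law) fact
    have "(\<lambda>n. mean_area (product_law Q j) (fst ((p \<circ> r) n)) (snd ((p \<circ> r) n))) \<longlonglongrightarrow> mean_area (product_law Q j) (fst q) (snd q)"
      by (intro Qj.continuous_mean_area tendsto_fst tendsto_snd qr(3))
    moreover have "(\<lambda>n. 1 - 1 / real (Suc (r n))) \<longlonglongrightarrow> 1 - 0"
      using LIMSEQ_subseq_LIMSEQ[OF LIMSEQ_inverse_real_of_nat qr(2)]
      by (intro tendsto_diff tendsto_const) (simp add: o_def inverse_eq_divide)
    moreover have "1 - 1 / real (Suc (r n)) \<le> mean_area (product_law Q j) (fst ((p \<circ> r) n)) (snd ((p \<circ> r) n))" if "n \<ge> j" for n
      using p(2)[of "r n"] mean_area_antimono[OF assms(1), of j "r n"] seq_suble[OF qr(2), of n] that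
      by (smt (verit) comp_apply le_trans)
    ultimately have "1 - 0 \<le> mean_area (product_law Q j) (fst q) (snd q)"
      by (intro LIMSEQ_le) auto
    with j show False by simp
  qed
  with mean_area_le_factor that show ?thesis by metis
qed

text \<open>Up to a constant, this bounds the distance from the Markov operator to the quadratic
  forms.  The exponents are such that both factors together are homogeneous of degree two.\<close>
definition holder_defect :: "real \<Rightarrow> (complex ^ 'k::finite ^ 'k) measure \<Rightarrow> real" where
  "holder_defect \<alpha> Q = (LINT v|Q. spread v powr \<alpha> * ((norm v)\<^sup>2) powr (1 - \<alpha>))"

text \<open>An elementary form of the weighted inequality of arithmetic and geometric means.  The
  parameter \<open>d\<close> balances a small \<open>a\<close> against a \<open>b\<close> of order one.\<close>
lemma powr_interpolate:
  assumes "0 \<le> a" "0 \<le> b" "0 < d" "0 < \<alpha>" "\<alpha> \<le> (1::real)"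
  shows "a powr \<alpha> * b powr (1 - \<alpha>) \<le> d powr \<alpha> * (a / d + b)"
proof -
  let ?m = "a / d + b"
  have "(a / d) powr \<alpha> * b powr (1 - \<alpha>) \<le> ?m powr \<alpha> * ?m powr (1 - \<alpha>)"
    using assms by (intro mult_mono powr_mono2) auto
  also have "\<dots> = ?m" using assms by (simp add: powr_add[symmetric])
  finally have "d powr \<alpha> * ((a / d) powr \<alpha> * b powr (1 - \<alpha>)) \<le> d powr \<alpha> * ?m"
    by (intro mult_left_mono) auto
  thus ?thesis using assms by (simp add: powr_divide)
qed

lemma continuous_spread [continuous_intros]:
  "continuous_on S f \<Longrightarrow> continuous_on S (\<lambda>t. spread (f t :: complex ^ 'k::finite ^ 'k))"
  unfolding spread_def by (intro continuous_intros)

lemma (in kraus_prob) integrable_defect: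
  assumes "0 < \<alpha>" "\<alpha> \<le> 1"
  shows "integrable Q (\<lambda>v. spread v powr \<alpha> * ((norm v)\<^sup>2) powr (1 - \<alpha>))"
proof (rule integrable_quadratic)
  have "spread \<in> borel_measurable (borel :: (complex ^ 'k ^ 'k) measure)"
    by (intro borel_measurable_continuous_onI continuous_intros)
  thus "(\<lambda>v :: complex ^ 'k ^ 'k. spread v powr \<alpha> * ((norm v)\<^sup>2) powr (1 - \<alpha>)) \<in> borel_measurable borel" by measurable
  fix v :: "complex ^ 'k ^ 'k"
  have "norm (spread v powr \<alpha> * ((norm v)\<^sup>2) powr (1 - \<alpha>)) \<le> 1 powr \<alpha> * (spread v / 1 + (norm v)\<^sup>2)"
    using powr_interpolate[of "spread v" "(norm v)\<^sup>2" 1 \<alpha>] assms by simp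
  also have "\<dots> \<le> ((real CARD('k))\<^sup>2 + 1) * (norm v)\<^sup>2"
    using spread_le[of v] by (simp add: distrib_right)
  finally show "norm (spread v powr \<alpha> * ((norm v)\<^sup>2) powr (1 - \<alpha>)) \<le> ((real CARD('k))\<^sup>2 + 1) * (norm v)\<^sup>2" .
qed

text \<open>The mean spread is of order \<open>c^j\<close>.  Interpolating with \<open>d\<close> of the same order turns
  this into \<open>d powr \<alpha>\<close>, times a constant.\<close>
lemma holder_defect_small:
  assumes "kraus_prob (Q :: (complex ^ 'k::finite ^ 'k) measure)"
    and c: "0 \<le> c" "c < 1" "\<And>x y. mean_area Q x y \<le> c * area x y"
    and \<alpha>: "0 < \<alpha>" "\<alpha> \<le> 1" and e: "0 < e"
  obtains j where "holder_defect \<alpha> (product_law Q j) \<le> e"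
proof -
  let ?k = "real CARD('k)"
  (* The solution of d powr alpha * (k^2 + k) = e. *)
  define d where "d = (e / (?k\<^sup>2 + ?k)) powr (1 / \<alpha>)"
  have d: "0 < d" "d powr \<alpha> * (?k\<^sup>2 + ?k) = e"
    using e \<alpha> by (auto simp: d_def powr_powr add_nonneg_eq_0_iff)
  obtain j where j: "c ^ j < d" using real_arch_pow_inv[OF d(1) c(2)] by blast
  interpret Qj: kraus_prob "product_law Q j" by (rule kraus_product_law) fact
  have a: "integrable (product_law Q j) (\<lambda>v. area (v *v axis i 1) (v *v axis l 1))" for i l
    by (intro Qj.integrable_continuous continuous_intros)
  have "(LINT v|product_law Q j. spread v)
      = (\<Sum>i\<in>UNIV. (LINT v|product_law Q j. (\<Sum>l\<in>UNIV. area (v *v axis i 1) (v *v axis l 1))))"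
    unfolding spread_def by (intro Bochner_Integration.integral_sum Bochner_Integration.integrable_sum a)
  also have "\<dots> = (\<Sum>i\<in>UNIV. \<Sum>l\<in>UNIV. mean_area (product_law Q j) (axis i 1) (axis l 1))"
    unfolding mean_area_def by (intro sum.cong refl Bochner_Integration.integral_sum a)
  also have "\<dots> \<le> (\<Sum>i\<in>(UNIV::'k set). \<Sum>l\<in>(UNIV::'k set). d)"
  proof (intro sum_mono)
    fix i l :: 'k
    have "area (axis i 1 :: complex ^ 'k) (axis l 1) \<le> 1" using area_le[of "axis i 1 :: complex ^ 'k" "axis l 1"] by simp
    hence "c ^ j * area (axis i 1 :: complex ^ 'k) (axis l 1) \<le> c ^ j"
      using c by (simp add: mult_left_le)
    thus "mean_area (product_law Q j) (axis i 1) (axis l 1 :: complex ^ 'k) \<le> d"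
      using mean_area_geometric[OF assms(1) c(1,3), of j "axis i 1" "axis l 1"] j by linarith
  qed
  also have "\<dots> = ?k\<^sup>2 * d" by (simp add: power2_eq_square mult.assoc)
  finally have s: "(LINT v|product_law Q j. spread v) \<le> ?k\<^sup>2 * d" .
  have "holder_defect \<alpha> (product_law Q j) \<le> (LINT v|product_law Q j. d powr \<alpha> * (spread v / d + (norm v)\<^sup>2))"
    unfolding holder_defect_def
    using powr_interpolate \<alpha> d(1)
    by (intro integral_mono Qj.integrable_defect Qj.integrable_continuous continuous_intros) auto
  also have "\<dots> = d powr \<alpha> * ((LINT v|product_law Q j. spread v) / d + (LINT v|product_law Q j. (norm v)\<^sup>2))"
    by (subst integral_mult_right_zero, subst Bochner_Integration.integral_add)
      (use d(1) in \<open>auto intro!: Qj.integrable_continuous continuous_intros\<close>)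
  also have "\<dots> \<le> d powr \<alpha> * (?k\<^sup>2 + ?k)"
    using s d(1) by (intro mult_left_mono) (auto simp: Qj.integral_norm_sq divide_le_eq)
  also have "\<dots> = e" by (rule d(2))
  finally show ?thesis using that by blast
qed

section \<open>Quadratic approximation of the Markov operator\<close>

lemma cinner_sandwich: "cinner x ((ctrans v ** A ** v) *v y) = cinner (v *v x) (A *v (v *v y))"
proof -
  have "(ctrans v ** A ** v) *v y = ctrans v *v (A *v (v *v y))"
    by (simp add: matrix_vector_mul_assoc[symmetric] matrix_mul_assoc[symmetric])
  moreover have "cinner x (ctrans v *v z) = cinner (v *v x) z" for z
    using cinner_ctrans[of v z x] by (metis cinner_commute)
  ultimately show ?thesis by simp
qed

lemma cinner_gram: "cinner x ((ctrans v ** v) *v y) = cinner (v *v x) (v *v y)"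
  using cinner_sandwich[of x v "mat 1" y] by simp

lemma cinner_matrix_expand:
  "cinner x (A *v y) = (\<Sum>a\<in>UNIV. \<Sum>b\<in>UNIV. cnj (x $ a) * A $ a $ b * y $ b)"
  by (simp add: cinner_def matrix_vector_mult_def sum_distrib_left mult.assoc)

lemma cinner_axis: "cinner (axis a 1) z = z $ a"
proof -
  have "cnj (axis a 1 $ i) * z $ i = (if i = a then z $ a else 0)" for i by (simp add: axis_def)
  thus ?thesis by (simp add: cinner_def)
qed

lemma matrix_axis_entry: "(A *v axis b 1) $ a = (A :: complex ^ 'k::finite ^ 'k) $ a $ b"
proof -
  have "A $ a $ j * axis b 1 $ j = (if j = b then A $ a $ b else 0)" for j by (simp add: axis_def)
  thus ?thesis by (simp add: matrix_vector_mult_def)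
qed

lemma cmod_gram_entry_le: "cmod ((ctrans v ** v) $ a $ b) \<le> (norm (v :: complex ^ 'k::finite ^ 'k))\<^sup>2"
proof -
  have "(ctrans v ** v) $ a $ b = cinner (axis a 1) ((ctrans v ** v) *v axis b 1)"
    by (simp add: cinner_axis matrix_axis_entry)
  also have "cmod \<dots> \<le> norm v * norm v"
    unfolding cinner_gram by (intro order_trans[OF cinner_bound] mult_mono norm_column_le) auto
  finally show ?thesis by (simp add: power2_eq_square)
qed

lemma norm_mat_le_sum: "norm (A :: complex ^ 'k::finite ^ 'k) \<le> (\<Sum>a\<in>UNIV. \<Sum>b\<in>UNIV. cmod (A $ a $ b))"
  unfolding norm_vec_def[of A]
  by (rule order_trans[OF L2_set_le_sum sum_mono]) (auto simp: norm_vec_def intro!: L2_set_le_sum)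

text \<open>A mean of the values of \<open>f\<close> at the directions \<open>v e_i\<close>, with weights
  \<open>|v e_i|^2 / |v|^2\<close>.  If \<open>v\<close> is nearly of rank one this is close to the value at the image
  direction of \<open>v\<close>, and it depends on \<open>v\<close> measurably without any choice of a singular vector.\<close>
definition center :: "('k::finite cproj \<Rightarrow> complex) \<Rightarrow> complex ^ 'k ^ 'k \<Rightarrow> complex" where
  "center f v = (\<Sum>i\<in>UNIV. lift f (v *v axis i 1)) / of_real ((norm v)\<^sup>2)"

text \<open>What is left of \<open>lift f (v x)\<close> when \<open>f [v x]\<close> is replaced by a value independent of
  \<open>x\<close>.  The subtracted term is a quadratic form in \<open>x\<close>.\<close>
definition residual :: "('k::finite cproj \<Rightarrow> complex) \<Rightarrow> complex ^ 'k ^ 'k \<Rightarrow> complex ^ 'k \<Rightarrow> complex" where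
  "residual f v x = lift f (v *v x) - center f v * of_real ((norm (v *v x))\<^sup>2)"

lemma residual_eq:
  "residual f v x = (f (proj_class (v *v x)) - center f v) * of_real ((norm (v *v x))\<^sup>2)"
  by (simp add: residual_def lift_def left_diff_distrib)

lemma center_bound:
  assumes "\<And>p. cmod (f p) \<le> C" shows "cmod (center f v) \<le> C"
proof -
  have "0 \<le> C" using assms norm_ge_zero order_trans by blast
  have "cmod (\<Sum>i\<in>UNIV. lift f (v *v axis i 1)) \<le> C * (norm v)\<^sup>2"
    unfolding norm_mat_columns sum_distrib_left by (intro sum_norm_le lift_bound assms)
  thus ?thesis using \<open>0 \<le> C\<close> by (cases "v = 0") (auto simp: center_def norm_divide norm_power divide_le_eq)
qed

lemma powr_quotient_le:
  assumes "0 < X" "X \<le> t" "0 \<le> J" "\<alpha> \<le> (1::real)"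
  shows "X * (J / X) powr \<alpha> \<le> J powr \<alpha> * t powr (1 - \<alpha>)"
proof -
  have "X * (J / X) powr \<alpha> = J powr \<alpha> * X powr (1 - \<alpha>)"
    using assms by (simp add: powr_divide powr_diff)
  also have "\<dots> \<le> J powr \<alpha> * t powr (1 - \<alpha>)"
    using assms by (intro mult_left_mono powr_mono2) auto
  finally show ?thesis .
qed

text \<open>The distance between the directions of \<open>v x\<close> and \<open>v e_i\<close> is at most
  \<open>spread v / (|v x| |v e_i|)\<close>.  This is bad for small \<open>|v e_i|\<close>, but there the weight is
  small, and \<open>(b/s)^2 \<le> (b/s) powr \<alpha>\<close> trades one for the other.\<close>
lemma center_estimate:
  fixes v :: "complex ^ 'k::finite ^ 'k"
  assumes f: "holder_bound \<alpha> f C" and \<alpha>: "0 < \<alpha>" "\<alpha> \<le> 1" and x: "norm x = 1" "v *v x \<noteq> 0"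
  shows "cmod (f (proj_class (v *v x)) - center f v)
     \<le> real CARD('k) * C * (spread v / (norm (v *v x) * norm v)) powr \<alpha>"
proof -
  let ?a = "norm (v *v x)" and ?s = "norm v" and ?p = "proj_class (v *v x)"
  have s: "0 < ?s" using x(2) by auto
  have a: "0 < ?a" using x by simp
  let ?w = "\<lambda>i. (norm (v *v axis i 1))\<^sup>2 / ?s\<^sup>2"
  have "(\<Sum>i\<in>UNIV. ?w i) = 1"
    using s by (simp add: norm_mat_columns[of v, symmetric] sum_divide_distrib[symmetric])
  hence "f ?p = (\<Sum>i\<in>UNIV. of_real (?w i) * f ?p)"
  proof -
    assume "(\<Sum>i\<in>UNIV. ?w i) = 1"
    hence "f ?p = of_real (\<Sum>i\<in>UNIV. ?w i) * f ?p" by simp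
    thus ?thesis by (simp only: of_real_sum sum_distrib_right)
  qed
  hence "f ?p - center f v = (\<Sum>i\<in>UNIV. of_real (?w i) * f ?p - lift f (v *v axis i 1) / of_real (?s\<^sup>2))"
    by (simp add: sum_subtractf center_def sum_divide_distrib)
  also have "cmod \<dots> \<le> (\<Sum>i\<in>(UNIV::'k set). C * (spread v / (?a * ?s)) powr \<alpha>)"
  proof (rule sum_norm_le)
    fix i :: 'k
    let ?b = "norm (v *v axis i 1)"
    show "cmod (of_real (?w i) * f ?p - lift f (v *v axis i 1) / of_real (?s\<^sup>2)) \<le> C * (spread v / (?a * ?s)) powr \<alpha>"
    proof (cases "v *v axis i 1 = 0")
      case True
      thus ?thesis using holder_boundD(3)[OF f] by simp
    next
      case False
      hence b: "0 < ?b" by simp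
      have bs: "?b / ?s \<le> 1" using norm_column_le[of v i] s by simp
      have "area (v *v x) (v *v axis i 1) \<le> spread v * area x (axis i 1)" by (rule area_matrix_le)
      also have "\<dots> \<le> spread v * 1"
        using area_le[of x "axis i 1"] x by (intro mult_left_mono) auto
      finally have ar: "area (v *v x) (v *v axis i 1) \<le> spread v" by simp
      have "of_real (?w i) * f ?p - lift f (v *v axis i 1) / of_real (?s\<^sup>2)
          = of_real (?w i) * (f ?p - f (proj_class (v *v axis i 1)))"
        using False by (simp add: lift_def field_simps)
      also have "cmod \<dots> = (?b / ?s) powr 2 * cmod (f ?p - f (proj_class (v *v axis i 1)))"
        using b s by (simp add: norm_mult power_divide norm_divide norm_power powr_numeral del: of_real_divide of_real_power)
      also have "\<dots> \<le> (?b / ?s) powr \<alpha> * (C * (spread v / (?a * ?b)) powr \<alpha>)"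
        using bs b s a \<alpha> ar holder_boundD(3)[OF f]
        by (intro mult_mono powr_mono' order_trans[OF holder_bound_quotient[OF f x(2) False]] mult_left_mono powr_mono2 divide_right_mono) auto
      also have "\<dots> = C * ((?b / ?s) * (spread v / (?a * ?b))) powr \<alpha>"
        using b s a by (subst powr_mult) auto
      also have "(?b / ?s) * (spread v / (?a * ?b)) = spread v / (?a * ?s)"
        using b by simp
      finally show ?thesis .
    qed
  qed
  finally show ?thesis by simp
qed

abbreviation defect :: "real \<Rightarrow> complex ^ 'k::finite ^ 'k \<Rightarrow> real" where
  "defect \<alpha> v \<equiv> spread v powr \<alpha> * ((norm v)\<^sup>2) powr (1 - \<alpha>)"

lemma norm_unit_image_le: "norm x = 1 \<Longrightarrow> norm (v *v x) \<le> norm (v :: complex ^ 'k::finite ^ 'k)"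
  using norm_matrix_vector_le[of v x] by simp

lemma residual_estimate:
  fixes v :: "complex ^ 'k::finite ^ 'k"
  assumes f: "holder_bound \<alpha> f C" and \<alpha>: "0 < \<alpha>" "\<alpha> \<le> 1" and x: "norm x = 1"
  shows "cmod (residual f v x) \<le> real CARD('k) * C * defect \<alpha> v"
proof (cases "v *v x = 0")
  case True
  thus ?thesis using holder_boundD(3)[OF f] by (simp add: residual_def)
next
  case False
  let ?a = "norm (v *v x)" and ?s = "norm v"
  have a: "0 < ?a" "?a \<le> ?s" using False norm_unit_image_le[OF x] by auto
  hence as: "0 < ?a * ?s" "?a * ?s \<le> ?s\<^sup>2" by (auto simp: power2_eq_square simp del: zero_less_norm_iff)
  have "cmod (residual f v x) \<le> (real CARD('k) * C * (spread v / (?a * ?s)) powr \<alpha>) * ?a\<^sup>2"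
    unfolding residual_eq norm_mult using center_estimate[OF f \<alpha> x False]
    by (simp add: norm_power mult_right_mono)
  also have "\<dots> \<le> (real CARD('k) * C * (spread v / (?a * ?s)) powr \<alpha>) * (?a * ?s)"
    using a holder_boundD(3)[OF f] by (intro mult_left_mono) (auto simp: power2_eq_square)
  also have "\<dots> = real CARD('k) * C * ((?a * ?s) * (spread v / (?a * ?s)) powr \<alpha>)" by simp
  also have "\<dots> \<le> real CARD('k) * C * defect \<alpha> v"
    using as holder_boundD(3)[OF f] \<alpha> by (intro mult_left_mono powr_quotient_le) auto
  finally show ?thesis .
qed

text \<open>Assume \<open>|v y| \<le> |v x|\<close> and write \<open>a, b\<close> for the two norms and \<open>c\<close> for the center.  The
  difference is \<open>(f [v x] - f [v y]) b^2 + (f [v x] - c) (a^2 - b^2)\<close>.  The first term is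
  small since the directions of \<open>v x\<close> and \<open>v y\<close> are close, the second by \<open>center_estimate\<close> and
  because \<open>a - b\<close> is at most \<open>|v|\<close> times the distance of the points.\<close>
lemma residual_diff_estimate:
  fixes v :: "complex ^ 'k::finite ^ 'k"
  assumes f: "holder_bound \<alpha> f C" and \<alpha>: "0 < \<alpha>" "\<alpha> \<le> 1"
  shows "cmod (residual f v (unit_rep p) - residual f v (unit_rep q))
    \<le> 4 * real CARD('k) * C * defect \<alpha> v * proj_dist p q powr \<alpha>"
proof -
  let ?k = "real CARD('k)"
  (* By symmetry, the point with the longer image comes first. *)
  have main: "cmod (residual f v (unit_rep p) - residual f v (unit_rep q))
      \<le> 4 * ?k * C * defect \<alpha> v * proj_dist p q powr \<alpha>"
    if le: "norm (v *v unit_rep q) \<le> norm (v *v unit_rep p)" for p q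
  proof (cases "v *v unit_rep p = 0")
    case True
    thus ?thesis using le holder_boundD(3)[OF f] by (simp add: residual_def)
  next
    case False
    let ?x = "unit_rep p" and ?y = "unit_rep q"
    let ?a = "norm (v *v ?x)" and ?b = "norm (v *v ?y)" and ?s = "norm v" and ?d = "proj_dist p q"
    let ?fx = "f (proj_class (v *v ?x))" and ?fy = "f (proj_class (v *v ?y))" and ?c = "center f v"
    note C = holder_boundD(3)[OF f]
    have a: "0 < ?a" "?a \<le> ?s" "?b \<le> ?s" using False norm_unit_image_le[OF unit_rep(1)] by auto
    hence as: "0 < ?a * ?s" "?a * ?s \<le> ?s\<^sup>2" by (auto simp: power2_eq_square simp del: zero_less_norm_iff)
    have "residual f v ?x - residual f v ?y
        = (?fx - ?fy) * of_real (?b\<^sup>2) + (?fx - ?c) * of_real (?a\<^sup>2 - ?b\<^sup>2)"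
      by (simp add: residual_eq algebra_simps)
    hence "cmod (residual f v ?x - residual f v ?y)
        \<le> cmod (?fx - ?fy) * ?b\<^sup>2 + cmod (?fx - ?c) * \<bar>?a\<^sup>2 - ?b\<^sup>2\<bar>"
      using norm_triangle_ineq[of "(?fx - ?fy) * of_real (?b\<^sup>2)" "(?fx - ?c) * of_real (?a\<^sup>2 - ?b\<^sup>2)"]
      by (simp only: norm_mult norm_of_real abs_power2 power2_abs)
    moreover have "cmod (?fx - ?fy) * ?b\<^sup>2 \<le> C * defect \<alpha> v * ?d powr \<alpha>"
    proof (cases "v *v ?y = 0")
      case True
      thus ?thesis using C by simp
    next
      case b: False
      hence "0 < ?b" by simp
      hence ab: "0 < ?a * ?b" "?a * ?b \<le> ?s\<^sup>2"
        using a by (auto simp: power2_eq_square intro!: mult_mono simp del: zero_less_norm_iff)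
      have ar: "area (v *v ?x) (v *v ?y) \<le> spread v * ?d"
        unfolding proj_dist_area by (rule area_matrix_le)
      have "cmod (?fx - ?fy) \<le> C * (spread v * ?d / (?a * ?b)) powr \<alpha>"
        using ar C \<alpha>
        by (intro order_trans[OF holder_bound_quotient[OF f False b]] mult_left_mono powr_mono2 divide_right_mono) auto
      also have "\<dots> = C * (spread v / (?a * ?b)) powr \<alpha> * ?d powr \<alpha>"
        by (simp add: powr_mult[symmetric] mult.assoc)
      finally have "cmod (?fx - ?fy) * ?b\<^sup>2 \<le> C * (spread v / (?a * ?b)) powr \<alpha> * ?d powr \<alpha> * (?a * ?b)"
        using le C by (intro mult_mono) (auto simp: power2_eq_square mult_right_mono)
      also have "\<dots> = C * ?d powr \<alpha> * ((?a * ?b) * (spread v / (?a * ?b)) powr \<alpha>)" by simp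
      also have "\<dots> \<le> C * ?d powr \<alpha> * defect \<alpha> v"
        using ab C \<alpha> by (intro mult_left_mono powr_quotient_le) auto
      finally show ?thesis by (simp add: mult_ac)
    qed
    moreover have "cmod (?fx - ?c) * \<bar>?a\<^sup>2 - ?b\<^sup>2\<bar> \<le> 3 * (?k * C * defect \<alpha> v * ?d powr \<alpha>)"
    proof -
      obtain u where u: "cmod u = 1" "norm (?x - u *s ?y) \<le> sqrt 2 * area ?x ?y"
        using phase_alignment[OF unit_rep(1) unit_rep(1)] .
      have "?a - ?b \<le> norm (v *v (?x - u *s ?y))"
        using norm_triangle_ineq2[of "v *v ?x" "u *s (v *v ?y)"]
        by (simp add: matrix_vector_mult_diff_distrib matrix_vector_scaleC norm_smult u(1))
      also have "\<dots> \<le> ?s * (sqrt 2 * ?d)"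
        using u(2) by (intro order_trans[OF norm_matrix_vector_le] mult_left_mono) (auto simp: proj_dist_area)
      also have "\<dots> \<le> ?s * (3/2 * ?d powr \<alpha>)"
        using proj_dist_le_powr[OF \<alpha>, of p q] real_le_lsqrt[of "3/2" 2]
        by (intro mult_left_mono mult_mono) (auto simp: power2_eq_square)
      finally have ab: "?a - ?b \<le> 3/2 * ?s * ?d powr \<alpha>" by simp
      have "\<bar>?a\<^sup>2 - ?b\<^sup>2\<bar> = (?a - ?b) * (?a + ?b)"
        using le by (simp add: power2_eq_square square_diff_square_factored abs_mult mult.commute)
      also have "\<dots> \<le> (3/2 * ?s * ?d powr \<alpha>) * (2 * ?a)"
        using ab le by (intro mult_mono) auto
      finally have "cmod (?fx - ?c) * \<bar>?a\<^sup>2 - ?b\<^sup>2\<bar>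
          \<le> (?k * C * (spread v / (?a * ?s)) powr \<alpha>) * ((3/2 * ?s * ?d powr \<alpha>) * (2 * ?a))"
        using center_estimate[OF f \<alpha> unit_rep(1) False] C by (intro mult_mono) auto
      also have "\<dots> = 3 * ?k * C * ?d powr \<alpha> * ((?a * ?s) * (spread v / (?a * ?s)) powr \<alpha>)" by simp
      also have "\<dots> \<le> 3 * ?k * C * ?d powr \<alpha> * defect \<alpha> v"
        using as C \<alpha> by (intro mult_left_mono powr_quotient_le) auto
      finally show ?thesis by (simp add: mult_ac)
    qed
    moreover have "C * defect \<alpha> v * ?d powr \<alpha> \<le> ?k * (C * defect \<alpha> v * ?d powr \<alpha>)"
      using mult_right_mono[of 1 ?k "C * defect \<alpha> v * ?d powr \<alpha>"] C by simp
    ultimately show ?thesis by (simp add: mult.assoc)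
  qed
  show ?thesis
  proof (cases "norm (v *v unit_rep q) \<le> norm (v *v unit_rep p)")
    case False
    have "proj_dist q p = proj_dist p q"
      unfolding proj_dist_def by (metis cinner_commute complex_mod_cnj)
    thus ?thesis using main[of p q] False by (simp add: norm_minus_commute)
  qed (rule main)
qed

context kraus_prob begin

text \<open>The matrix of the quadratic form that approximates the Markov operator.\<close>
definition center_matrix :: "('k cproj \<Rightarrow> complex) \<Rightarrow> complex ^ 'k ^ 'k" where
  "center_matrix f = (\<chi> a b. LINT v|Q. center f v * (ctrans v ** v) $ a $ b)"

definition remainder :: "('k cproj \<Rightarrow> complex) \<Rightarrow> 'k cproj \<Rightarrow> complex" where
  "remainder f p = (LINT v|Q. residual f v (unit_rep p))"

context
  fixes \<alpha> C :: real and f :: "'k cproj \<Rightarrow> complex"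
  assumes f: "holder_bound \<alpha> f C" and \<alpha>: "0 < \<alpha>" "\<alpha> \<le> 1"
begin

lemma lift_image_borel: "(\<lambda>v :: complex ^ 'k ^ 'k. lift f (v *v x)) \<in> borel_measurable borel"
  by (intro borel_measurable_continuous_onI continuous_on_compose2[OF continuous_lift[OF f \<alpha>(1)]])
    (auto intro!: continuous_intros)

lemma center_borel: "center f \<in> borel_measurable (borel :: (complex ^ 'k ^ 'k) measure)"
  unfolding center_def[abs_def] using lift_image_borel by measurable

lemma integrable_lift: "integrable Q (\<lambda>v. lift f (v *v x))"
proof (rule integrable_quadratic[OF lift_image_borel])
  fix v :: "complex ^ 'k ^ 'k"
  have "cmod (lift f (v *v x)) \<le> C * (norm (v *v x))\<^sup>2" by (rule lift_bound[OF holder_boundD(1)[OF f]])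
  also have "\<dots> \<le> C * (norm v * norm x)\<^sup>2"
    by (intro mult_left_mono power_mono norm_matrix_vector_le holder_boundD(3)[OF f]) auto
  finally show "cmod (lift f (v *v x)) \<le> (C * (norm x)\<^sup>2) * (norm v)\<^sup>2" by (simp add: power_mult_distrib mult_ac)
qed

lemma integrable_center: "integrable Q (\<lambda>v. center f v * (ctrans v ** v) $ a $ b)"
proof (rule integrable_quadratic)
  have "(\<lambda>v :: complex ^ 'k ^ 'k. (ctrans v ** v) $ a $ b) \<in> borel_measurable borel"
    by (intro borel_measurable_continuous_onI continuous_intros)
  thus "(\<lambda>v. center f v * (ctrans v ** v) $ a $ b) \<in> borel_measurable borel"
    using center_borel by measurable
  show "cmod (center f v * (ctrans v ** v) $ a $ b) \<le> C * (norm v)\<^sup>2" for v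
    unfolding norm_mult
    by (intro mult_mono center_bound holder_boundD(1)[OF f] cmod_gram_entry_le holder_boundD(3)[OF f]) auto
qed

lemma cinner_center_matrix:
  "(LINT v|Q. center f v * of_real ((norm (v *v x))\<^sup>2)) = cinner x (center_matrix f *v x)"
  "integrable Q (\<lambda>v. center f v * of_real ((norm (v *v x))\<^sup>2))"
proof -
  have e: "center f v * of_real ((norm (v *v x))\<^sup>2)
      = (\<Sum>a\<in>UNIV. \<Sum>b\<in>UNIV. (cnj (x $ a) * x $ b) * (center f v * (ctrans v ** v) $ a $ b))" for v
  proof -
    have "complex_of_real ((norm (v *v x))\<^sup>2) = cinner x ((ctrans v ** v) *v x)"
      by (simp only: cinner_gram cinner_self)
    also have "center f v * \<dots> = (\<Sum>a\<in>UNIV. \<Sum>b\<in>UNIV. (cnj (x $ a) * x $ b) * (center f v * (ctrans v ** v) $ a $ b))"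
      unfolding cinner_matrix_expand sum_distrib_left by (intro sum.cong refl) (simp add: mult_ac)
    finally show ?thesis .
  qed
  show "integrable Q (\<lambda>v. center f v * of_real ((norm (v *v x))\<^sup>2))"
    unfolding e by (intro Bochner_Integration.integrable_sum integrable_mult_right integrable_center)
  have "(LINT v|Q. center f v * of_real ((norm (v *v x))\<^sup>2))
      = (\<Sum>a\<in>UNIV. (LINT v|Q. (\<Sum>b\<in>UNIV. (cnj (x $ a) * x $ b) * (center f v * (ctrans v ** v) $ a $ b))))"
    unfolding e
    by (intro Bochner_Integration.integral_sum Bochner_Integration.integrable_sum integrable_mult_right integrable_center)
  also have "\<dots> = (\<Sum>a\<in>UNIV. \<Sum>b\<in>UNIV. (LINT v|Q. (cnj (x $ a) * x $ b) * (center f v * (ctrans v ** v) $ a $ b)))"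
    by (intro sum.cong refl Bochner_Integration.integral_sum integrable_mult_right integrable_center)
  also have "\<dots> = cinner x (center_matrix f *v x)"
    unfolding cinner_matrix_expand center_matrix_def integral_mult_right_zero
    by (intro sum.cong refl) (simp add: mult_ac)
  finally show "(LINT v|Q. center f v * of_real ((norm (v *v x))\<^sup>2)) = cinner x (center_matrix f *v x)" .
qed

lemma integrable_residual: "integrable Q (\<lambda>v. residual f v x)"
  unfolding residual_def by (intro Bochner_Integration.integrable_diff integrable_lift cinner_center_matrix(2))

lemma markov_op_split: "markov_op Q f p = remainder f p + quadform (center_matrix f) p"
  unfolding markov_op_lift remainder_def residual_def quadform_def
  by (simp add: integrable_lift cinner_center_matrix del: of_real_power)

text \<open>The bound is proportional to the defect, which is small for long products.\<close>
lemma remainder_bound: "holder_bound \<alpha> (remainder f) (4 * real CARD('k) * holder_defect \<alpha> Q * C)"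
  unfolding holder_bound_def
proof (intro conjI allI)
  fix p q :: "'k cproj"
  let ?k = "real CARD('k)"
  note D = integrable_defect[OF \<alpha>]
  note C = holder_boundD(3)[OF f]
  have D0: "0 \<le> holder_defect \<alpha> Q" unfolding holder_defect_def by (intro integral_nonneg_AE AE_I2) auto
  have "cmod (remainder f p) \<le> (LINT v|Q. ?k * C * defect \<alpha> v)"
    unfolding remainder_def
    by (rule Bochner_Integration.integral_norm_bound_integral[OF integrable_residual])
      (use D residual_estimate[OF f \<alpha> unit_rep(1)] in \<open>auto intro: integrable_mult_right\<close>)
  also have "\<dots> = ?k * C * holder_defect \<alpha> Q" by (simp add: holder_defect_def)
  also have "\<dots> \<le> 4 * ?k * holder_defect \<alpha> Q * C" using C D0 by simp
  finally show "cmod (remainder f p) \<le> 4 * ?k * holder_defect \<alpha> Q * C" .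
  have "cmod (remainder f p - remainder f q) = cmod (LINT v|Q. residual f v (unit_rep p) - residual f v (unit_rep q))"
    unfolding remainder_def by (simp add: integrable_residual)
  also have "\<dots> \<le> (LINT v|Q. (4 * ?k * C * proj_dist p q powr \<alpha>) * defect \<alpha> v)"
  proof (rule Bochner_Integration.integral_norm_bound_integral)
    show "integrable Q (\<lambda>v. residual f v (unit_rep p) - residual f v (unit_rep q))"
      by (intro Bochner_Integration.integrable_diff integrable_residual)
    show "integrable Q (\<lambda>v. (4 * ?k * C * proj_dist p q powr \<alpha>) * defect \<alpha> v)"
      by (rule integrable_mult_right[OF D])
    show "norm (residual f v (unit_rep p) - residual f v (unit_rep q))
        \<le> (4 * ?k * C * proj_dist p q powr \<alpha>) * defect \<alpha> v" for v
      using residual_diff_estimate[OF f \<alpha>, of v p q] by (simp only: mult_ac)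
  qed
  also have "\<dots> = 4 * ?k * holder_defect \<alpha> Q * C * proj_dist p q powr \<alpha>" by (simp add: holder_defect_def)
  finally show "cmod (remainder f p - remainder f q) \<le> 4 * ?k * holder_defect \<alpha> Q * C * proj_dist p q powr \<alpha>" .
qed

lemma center_matrix_norm: "norm (center_matrix f) \<le> real CARD('k) ^ 3 * C"
proof -
  have "cmod (center_matrix f $ a $ b) \<le> real CARD('k) * C" for a b
  proof -
    have "cmod (center_matrix f $ a $ b) \<le> (LINT v|Q. C * (norm v)\<^sup>2)"
      unfolding center_matrix_def vec_lambda_beta
    proof (rule Bochner_Integration.integral_norm_bound_integral[OF integrable_center])
      show "integrable Q (\<lambda>v. C * (norm v)\<^sup>2)" by (intro integrable_continuous continuous_intros)
      show "cmod (center f v * (ctrans v ** v) $ a $ b) \<le> C * (norm v)\<^sup>2" for v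
        unfolding norm_mult
        by (intro mult_mono center_bound holder_boundD(1)[OF f] cmod_gram_entry_le holder_boundD(3)[OF f]) auto
    qed
    thus ?thesis by (simp add: integral_norm_sq mult.commute)
  qed
  hence "(\<Sum>a\<in>UNIV. \<Sum>b\<in>UNIV. cmod (center_matrix f $ a $ b)) \<le> (\<Sum>a\<in>(UNIV::'k set). \<Sum>b\<in>(UNIV::'k set). real CARD('k) * C)"
    by (intro sum_mono)
  thus ?thesis using norm_mat_le_sum[of "center_matrix f"] by (simp add: power3_eq_cube mult.assoc)
qed

end

definition markov_const :: "real \<Rightarrow> real" where
  "markov_const \<alpha> = 4 * real CARD('k) * holder_defect \<alpha> Q + 3 * real CARD('k) ^ 3"

lemma markov_op_holder:
  assumes "holder_bound \<alpha> f C" "0 < \<alpha>" "\<alpha> \<le> 1"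
  shows "holder_bound \<alpha> (markov_op Q f) (markov_const \<alpha> * C)"
proof -
  have "holder_bound \<alpha> (\<lambda>p. remainder f p + quadform (center_matrix f) p)
     (4 * real CARD('k) * holder_defect \<alpha> Q * C + 3 * norm (center_matrix f))"
    by (intro holder_bound_add remainder_bound quadform_bound assms)
  moreover have "(\<lambda>p. remainder f p + quadform (center_matrix f) p) = markov_op Q f"
    using markov_op_split[OF assms] by auto
  ultimately show ?thesis
    using center_matrix_norm[OF assms] by (auto elim!: holder_bound_mono simp: markov_const_def algebra_simps)
qed

lemma remainder_lincomb:
  assumes "holder_bound \<alpha> f C" "holder_bound \<alpha> g D" "0 < \<alpha>" "\<alpha> \<le> 1"
  shows "remainder (\<lambda>p. c * f p + d * g p) p = c * remainder f p + d * remainder g p"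
proof -
  have l: "lift (\<lambda>p. c * f p + d * g p) x = c * lift f x + d * lift g x" for x
    by (simp add: lift_def algebra_simps)
  have "residual (\<lambda>p. c * f p + d * g p) v x = c * residual f v x + d * residual g v x" for v x
    by (simp add: residual_def center_def l sum.distrib sum_distrib_left[symmetric] add_divide_distrib algebra_simps)
  thus ?thesis
    unfolding remainder_def using integrable_residual[OF assms(1,3,4)] integrable_residual[OF assms(2,3,4)] by simp
qed

lemma markov_op_lincomb:
  assumes "holder_bound \<alpha> f C" "holder_bound \<alpha> g D" "0 < \<alpha>" "\<alpha> \<le> 1"
  shows "markov_op Q (\<lambda>p. c * f p + d * g p) = (\<lambda>p. c * markov_op Q f p + d * markov_op Q g p)"
proof
  fix p
  have l: "lift (\<lambda>p. c * f p + d * g p) x = c * lift f x + d * lift g x" for x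
    by (simp add: lift_def algebra_simps)
  show "markov_op Q (\<lambda>p. c * f p + d * g p) p = c * markov_op Q f p + d * markov_op Q g p"
    unfolding markov_op_lift l using integrable_lift[OF assms(1,3,4)] integrable_lift[OF assms(2,3,4)] by simp
qed

end

text \<open>Integrating out the newest factor first replaces \<open>f\<close> by \<open>markov_op Q f\<close> and shortens
  the product by one.\<close>
lemma markov_op_product_law:
  assumes "kraus_prob (Q :: (complex ^ 'a::finite ^ 'a) measure)" "f \<in> holder_space \<alpha>" "0 < \<alpha>" "\<alpha> \<le> 1"
  shows "markov_op (product_law Q n) f = (markov_op Q ^^ n) f"
  using assms(2)
proof (induction n arbitrary: f)
  case 0
  obtain C where C: "holder_bound \<alpha> f C" using 0 holder_space_iff by blast
  have "(\<lambda>v :: complex ^ 'a ^ 'a. lift f (v *v x)) \<in> borel_measurable borel" for x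
    using kraus_prob.lift_image_borel[OF assms(1) C assms(3,4)] .
  thus ?case by (intro ext) (simp add: markov_op_lift integral_return lift_unit_rep)
next
  case (Suc n)
  interpret Q: kraus_prob Q by fact
  obtain C where C: "holder_bound \<alpha> f C" using Suc.prems holder_space_iff by blast
  have cont: "continuous_on UNIV (\<lambda>v :: complex ^ 'a ^ 'a. lift f (v *v x))" for x
    by (rule continuous_on_compose2[OF continuous_lift[OF C assms(3)]]) (auto intro!: continuous_intros)
  have "markov_op (product_law Q (Suc n)) f = markov_op (product_law Q n) (markov_op Q f)"
  proof
    fix p
    have "markov_op (product_law Q (Suc n)) f p
       = (LINT W|product_law Q n. LINT v|Q. lift f (v *v (W *v unit_rep p)))"
      unfolding markov_op_lift product_law.simps
      by (subst integral_step_law[OF kraus_product_law[OF assms(1)] assms(1) cont]) (simp add: matrix_vector_mul_assoc)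
    thus "markov_op (product_law Q (Suc n)) f p = markov_op (product_law Q n) (markov_op Q f) p"
      by (simp add: lift_markov_op[symmetric] markov_op_lift[of "product_law Q n"])
  qed
  also have "\<dots> = (markov_op Q ^^ n) (markov_op Q f)"
    using Q.markov_op_holder[OF C assms(3,4)] by (intro Suc.IH) (auto simp: holder_space_iff)
  finally show ?case by (simp add: funpow_swap1)
qed

section \<open>Quadratic forms\<close>

definition cscale :: "complex \<Rightarrow> complex ^ 'k::finite ^ 'k \<Rightarrow> complex ^ 'k ^ 'k" where
  "cscale c A = map_matrix ((*) c) A"

lemma cscale_vector: "cscale c A *v x = c *s (A *v x)"
  by (simp add: cscale_def map_matrix_def matrix_vector_mult_def vec_eq_iff sum_distrib_left mult.assoc)

lemma quadform_cscale: "quadform (cscale c A) p = c * quadform A p"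
  by (simp add: quadform_def cscale_vector cinner_scale_right)

lemma quadform_add: "quadform (A + B) p = quadform A p + quadform B p"
  by (simp add: quadform_def matrix_vector_mult_add_rdistrib cinner_add_right)

lemma quadform_diff: "quadform (A - B) p = quadform A p - quadform B p"
  by (simp add: quadform_def matrix_vector_mult_diff_rdistrib cinner_diff_right)

lemma quadform_zero: "quadform 0 = 0"
  by (simp add: quadform_def fun_eq_iff)

lemma polarization:
  "A $ a $ b = (lift (quadform A) (axis a 1 + axis b 1) - lift (quadform A) (axis a 1 - axis b 1)
     - \<i> * (lift (quadform A) (axis a 1 + \<i> *s axis b 1) - lift (quadform A) (axis a 1 - \<i> *s axis b 1))) / 4"
proof -
  have "A $ a $ b = cinner (axis a 1) (A *v axis b 1)" by (simp add: cinner_axis matrix_axis_entry)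
  thus ?thesis
    by (simp add: lift_quadform cinner_simps matrix_vector_right_distrib matrix_vector_mult_diff_distrib matrix_vector_scaleC)
      (simp add: algebra_simps)
qed

lemma quadform_inject: "quadform A = quadform B \<Longrightarrow> A = B"
  by (simp add: vec_eq_iff polarization)

lemma norm_le_quadform:
  fixes A :: "complex ^ 'k::finite ^ 'k"
  assumes "\<And>p. cmod (quadform A p) \<le> C"
  shows "norm A \<le> 4 * (real CARD('k))\<^sup>2 * C"
proof -
  have 0: "0 \<le> C" using assms norm_ge_zero order_trans by blast
  have l: "cmod (lift (quadform A) x) \<le> 4 * C" if "norm x \<le> 2" for x
    using lift_bound[of "quadform A" C x, OF assms] power_mono[OF that, of 2] mult_left_mono[of "(norm x)\<^sup>2" 4 C] 0
    by (simp add: mult.commute)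
  have ax: "norm (axis a 1 + axis b 1 :: complex ^ 'k) \<le> 2" "norm (axis a 1 - axis b 1 :: complex ^ 'k) \<le> 2"
    "norm (axis a 1 + \<i> *s axis b 1 :: complex ^ 'k) \<le> 2" "norm (axis a 1 - \<i> *s axis b 1 :: complex ^ 'k) \<le> 2" for a b
    by (rule order_trans[OF norm_triangle_ineq] order_trans[OF norm_triangle_ineq4], simp add: norm_smult)+
  have "cmod (A $ a $ b) \<le> 4 * C" for a b
  proof -
    have "4 * cmod (A $ a $ b) = cmod (lift (quadform A) (axis a 1 + axis b 1) - lift (quadform A) (axis a 1 - axis b 1)
     - \<i> * (lift (quadform A) (axis a 1 + \<i> *s axis b 1) - lift (quadform A) (axis a 1 - \<i> *s axis b 1)))"
      by (subst polarization) (simp add: norm_divide)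
    also have "\<dots> \<le> (4 * C + 4 * C) + (4 * C + 4 * C)"
      by (rule order_trans[OF norm_triangle_ineq4], unfold norm_mult norm_ii mult_1,
          intro add_mono order_trans[OF norm_triangle_ineq4] l ax)
    finally show ?thesis by simp
  qed
  hence "(\<Sum>a\<in>UNIV. \<Sum>b\<in>UNIV. cmod (A $ a $ b)) \<le> (\<Sum>a\<in>(UNIV::'k set). \<Sum>b\<in>(UNIV::'k set). 4 * C)"
    by (intro sum_mono)
  thus ?thesis using norm_mat_le_sum[of A] by (simp add: power2_eq_square mult_ac)
qed

text \<open>Polarization recovers the entries of the matrices from finitely many values.\<close>
lemma quadform_closed:
  fixes A :: "nat \<Rightarrow> complex ^ 'k::finite ^ 'k"
  assumes "\<And>p. (\<lambda>j. quadform (A j) p) \<longlonglongrightarrow> f p"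
  shows "\<exists>B. f = quadform B"
proof -
  have l: "(\<lambda>j. lift (quadform (A j)) x) \<longlonglongrightarrow> lift f x" for x
    unfolding lift_def using assms by (auto intro!: tendsto_intros)
  define B where "B = (\<chi> a b. (lift f (axis a 1 + axis b 1) - lift f (axis a 1 - axis b 1)
     - \<i> * (lift f (axis a 1 + \<i> *s axis b 1) - lift f (axis a 1 - \<i> *s axis b 1))) / 4)"
  have "(\<lambda>j. A j $ a $ b) \<longlonglongrightarrow> B $ a $ b" for a b
    unfolding polarization[of "A _" a b] B_def vec_lambda_beta by (intro tendsto_intros l) simp
  hence "(\<lambda>j. quadform (A j) p) \<longlonglongrightarrow> quadform B p" for p
    unfolding quadform_def cinner_matrix_expand by (intro tendsto_sum tendsto_mult tendsto_const)
  hence "f p = quadform B p" for p using assms LIMSEQ_unique by blast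
  thus ?thesis by blast
qed

section \<open>Reduction of the peripheral spectrum to matrices\<close>

lemma shifted_op_zero: "shifted_op (Q :: (complex ^ 'a::finite ^ 'a) measure) z 0 = 0"
proof
  fix p
  have "lift (0 :: 'a cproj \<Rightarrow> complex) x = 0" for x by (simp add: lift_def)
  thus "shifted_op Q z 0 p = 0 p" by (simp add: shifted_op_def markov_op_lift)
qed

context kraus_prob begin

lemma cinner_quantum_map:
  "cinner x (quantum_map Q A *v y) = (LINT v|Q. cinner (v *v x) (A *v (v *v y)))"
proof -
  have lin: "bounded_linear (\<lambda>M :: complex ^ 'k ^ 'k. cinner x (M *v y))"
    unfolding linear_conv_bounded_linear[symmetric]
    by (rule linearI) (simp_all add: matrix_vector_mult_add_rdistrib cinner_simps scaleR_matrix_vector scaleR_conv_of_real[where 'a=complex])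
  have "integrable Q (\<lambda>v. ctrans v ** A ** v)" by (intro integrable_continuous continuous_intros)
  from integral_bounded_linear[OF lin this] show ?thesis
    unfolding quantum_map_def by (simp add: cinner_sandwich)
qed

lemma markov_op_quadform: "markov_op Q (quadform A) = quadform (quantum_map Q A)"
  by (rule ext) (simp add: markov_op_lift quadform_def cinner_quantum_map lift_quadform)

lemma markov_op_sup:
  assumes "holder_bound \<alpha> f C" "0 < \<alpha>" "\<alpha> \<le> 1" "\<And>p. cmod (f p) \<le> S"
  shows "cmod (markov_op Q f p) \<le> S"
proof -
  have "cmod (markov_op Q f p) \<le> (LINT v|Q. S * (norm (v *v unit_rep p))\<^sup>2)"
    unfolding markov_op_lift
    by (rule Bochner_Integration.integral_norm_bound_integral[OF integrable_lift[OF assms(1-3)]])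
      (auto intro!: integrable_continuous continuous_intros lift_bound assms(4))
  also have "\<dots> = S" by (simp add: unital unit_rep)
  finally show ?thesis .
qed

end

text \<open>Some power of the Markov operator differs by quadratic forms from a strict
  contraction.  Both the supremum and the Hoelder constant of \<open>R f\<close> are bounded by half of one
  constant for \<open>f\<close>.\<close>
locale contracting_remainder = kraus_prob Q for Q :: "(complex ^ 'k::finite ^ 'k) measure" +
  fixes \<alpha> :: real and N :: nat and R :: "('k cproj \<Rightarrow> complex) \<Rightarrow> 'k cproj \<Rightarrow> complex"
  assumes \<alpha>: "0 < \<alpha>" "\<alpha> \<le> 1"
    and R_bound: "\<And>f C. holder_bound \<alpha> f C \<Longrightarrow> holder_bound \<alpha> (R f) (C / 2)"
    and R_lincomb: "\<And>f g C D c d. holder_bound \<alpha> f C \<Longrightarrow> holder_bound \<alpha> g D \<Longrightarrow>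
        R (\<lambda>p. c * f p + d * g p) = (\<lambda>p. c * R f p + d * R g p)"
    and R_split: "\<And>f C. holder_bound \<alpha> f C \<Longrightarrow>
        \<exists>A. \<forall>p. (markov_op Q ^^ N) f p = R f p + quadform A p"
begin

lemma R_funpow_bound: "holder_bound \<alpha> f C \<Longrightarrow> holder_bound \<alpha> ((R ^^ j) f) (C / 2 ^ j)"
proof (induction j)
  case (Suc j)
  from R_bound[OF Suc.IH[OF Suc.prems]] show ?case by (simp add: mult.commute)
qed simp

lemma markov_op_add_scale:
  assumes "holder_bound \<alpha> f C"
  shows "markov_op Q (\<lambda>p. c * f p + quadform A p) = (\<lambda>p. c * markov_op Q f p + quadform (quantum_map Q A) p)"
  using markov_op_lincomb[OF assms quadform_bound[OF \<alpha>] \<alpha>, of c 1 A] by (simp add: markov_op_quadform)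

text \<open>Modulo quadratic forms, \<open>\<Pi> f = z f\<close> and hence \<open>R f = z^N f\<close>.  So \<open>f\<close> equals
  \<open>z^{-Nj} R^j f\<close> modulo quadratic forms for all \<open>j\<close>; these terms tend to 0, and limits of
  quadratic forms are quadratic forms.\<close>
lemma quadform_of_peripheral:
  assumes f: "holder_bound \<alpha> f C" and z: "cmod z = 1"
    and eig: "\<And>p. shifted_op Q z f p = quadform A p"
  shows "\<exists>B. f = quadform B"
proof -
  have z0: "z \<noteq> 0" using z by auto
  have one: "markov_op Q f p = z * f p + quadform (cscale (-1) A) p" for p
    using eig[of p] by (simp add: shifted_op_def quadform_cscale algebra_simps)
  have "\<exists>A. \<forall>p. (markov_op Q ^^ n) f p = z ^ n * f p + quadform A p" for n
  proof (induction n)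
    case 0
    show ?case by (rule exI[of _ 0]) (simp add: quadform_def)
  next
    case (Suc n)
    then obtain A' where "(markov_op Q ^^ n) f = (\<lambda>p. z ^ n * f p + quadform A' p)" by blast
    hence "(markov_op Q ^^ Suc n) f = (\<lambda>p. z ^ n * markov_op Q f p + quadform (quantum_map Q A') p)"
      by (simp add: markov_op_add_scale[OF f])
    hence "(markov_op Q ^^ Suc n) f p = z ^ Suc n * f p
        + quadform (cscale (z ^ n) (cscale (-1) A) + quantum_map Q A') p" for p
      by (simp add: one quadform_add quadform_cscale algebra_simps)
    thus ?case by blast
  qed
  then obtain A1 where A1: "\<And>p. (markov_op Q ^^ N) f p = z ^ N * f p + quadform A1 p" by blast
  obtain A2 where A2: "\<And>p. (markov_op Q ^^ N) f p = R f p + quadform A2 p" using R_split[OF f] by blast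
  define w where "w = inverse (z ^ N)"
  have w: "cmod w = 1" "w * z ^ N = 1" using z z0 by (simp_all add: w_def norm_inverse norm_power)
  have f_eq: "f = (\<lambda>p. w * R f p + quadform (cscale w (A2 - A1)) p)"
  proof
    fix p
    have "z ^ N * f p = R f p + (quadform A2 p - quadform A1 p)"
      using A1[of p] A2[of p] by (simp add: algebra_simps)
    hence "w * (z ^ N * f p) = w * R f p + quadform (cscale w (A2 - A1)) p"
      by (simp only: quadform_cscale quadform_diff distrib_left)
    thus "f p = w * R f p + quadform (cscale w (A2 - A1)) p"
      using w(2) by (simp add: mult.assoc[symmetric])
  qed
  have Rq: "\<exists>B. R (quadform A) = quadform B" for A
  proof -
    have "\<exists>B. (markov_op Q ^^ n) (quadform A) = quadform B" for n
      by (induction n) (auto simp: markov_op_quadform)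
    then obtain B where B: "(markov_op Q ^^ N) (quadform A) = quadform B" by blast
    obtain B' where "\<forall>p. (markov_op Q ^^ N) (quadform A) p = R (quadform A) p + quadform B' p"
      using R_split[OF quadform_bound[OF \<alpha>]] by blast
    hence "R (quadform A) = quadform (B - B')" using B by (auto simp: quadform_diff fun_eq_iff)
    thus ?thesis ..
  qed
  have iter: "\<exists>B. f = (\<lambda>p. w ^ j * (R ^^ j) f p + quadform B p)" for j
  proof (induction j)
    case 0
    show ?case by (rule exI[of _ 0]) (simp add: quadform_def)
  next
    case (Suc j)
    then obtain B where B: "f = (\<lambda>p. w ^ j * (R ^^ j) f p + quadform B p)" by blast
    have "\<exists>B'. (R ^^ j) f = (\<lambda>p. w * (R ^^ Suc j) f p + quadform B' p)"
    proof (induction j)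
      case 0
      thus ?case using f_eq by auto
    next
      case (Suc j)
      then obtain B' where B': "(R ^^ j) f = (\<lambda>p. w * (R ^^ Suc j) f p + quadform B' p)" by blast
      have "(R ^^ Suc j) f = R (\<lambda>p. w * (R ^^ Suc j) f p + 1 * quadform B' p)"
        using arg_cong[OF B', of R] by simp
      also have "\<dots> = (\<lambda>p. w * R ((R ^^ Suc j) f) p + 1 * R (quadform B') p)"
        by (rule R_lincomb[OF R_funpow_bound[OF f] quadform_bound[OF \<alpha>]])
      finally show ?case using Rq[of B'] by auto
    qed
    then obtain B' where B': "(R ^^ j) f = (\<lambda>p. w * (R ^^ Suc j) f p + quadform B' p)" by blast
    have "f p = w ^ Suc j * (R ^^ Suc j) f p + quadform (cscale (w ^ j) B' + B) p" for p
      using fun_cong[OF B, of p] fun_cong[OF B', of p] by (simp add: quadform_add quadform_cscale algebra_simps)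
    thus ?case by blast
  qed
  then obtain B where B: "\<And>j. f = (\<lambda>p. w ^ j * (R ^^ j) f p + quadform (B j) p)" by metis
  have "(\<lambda>j. quadform (B j) p) \<longlonglongrightarrow> f p" for p
  proof -
    have "(\<lambda>j. w ^ j * (R ^^ j) f p) \<longlonglongrightarrow> 0"
    proof (rule Lim_null_comparison)
      show "\<forall>\<^sub>F j in sequentially. norm (w ^ j * (R ^^ j) f p) \<le> C * (1/2) ^ j"
        using holder_boundD(1)[OF R_funpow_bound[OF f]] w(1)
        by (auto simp: norm_mult norm_power power_divide)
      show "(\<lambda>j. C * (1/2) ^ j) \<longlonglongrightarrow> 0"
        by (intro tendsto_mult_right_zero LIMSEQ_power_zero) simp
    qed
    hence "(\<lambda>j. f p - w ^ j * (R ^^ j) f p) \<longlonglongrightarrow> f p - 0" by (intro tendsto_intros)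
    moreover have "f p - w ^ j * (R ^^ j) f p = quadform (B j) p" for j using fun_cong[OF B[of j], of p] by simp
    ultimately show ?thesis by simp
  qed
  thus ?thesis by (rule quadform_closed)
qed

text \<open>With \<open>w = z^{-N}\<close> this is the Neumann series of \<open>(z^N - R)^{-1} h\<close>.\<close>
definition neumann :: "complex \<Rightarrow> ('k cproj \<Rightarrow> complex) \<Rightarrow> 'k cproj \<Rightarrow> complex" where
  "neumann w h p = (\<Sum>j. w ^ Suc j * (R ^^ j) h p)"

lemma neumann_term:
  assumes h: "holder_bound \<alpha> h C" and w: "cmod w = 1"
  shows "cmod (w ^ Suc j * (R ^^ j) h p) \<le> C * (1/2) ^ j"
  using holder_boundD(1)[OF R_funpow_bound[OF h, of j], of p] w by (simp add: norm_mult norm_power power_divide)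

lemma neumann_summable:
  assumes h: "holder_bound \<alpha> h C" and w: "cmod w = 1"
  shows "summable (\<lambda>j. w ^ Suc j * (R ^^ j) h p)"
  by (rule summable_comparison_test[OF _ summable_mult[OF summable_geometric[of "1/2"]]])
    (use neumann_term[OF assms] in auto)

lemma neumann_bound:
  assumes h: "holder_bound \<alpha> h C" and w: "cmod w = 1"
  shows "holder_bound \<alpha> (neumann w h) (2 * C)"
  unfolding holder_bound_def
proof (intro conjI allI)
  fix p q
  have geo: "summable (\<lambda>j. K * (1/2 :: real) ^ j)" "(\<Sum>j. K * (1/2) ^ j) = 2 * K" for K :: real
    using suminf_mult[OF summable_geometric[of "1/2::real"], of K] suminf_geometric[of "1/2::real"]
    by (auto intro: summable_mult)
  show "cmod (neumann w h p) \<le> 2 * C"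
    unfolding neumann_def geo(2)[of C, symmetric]
    by (rule norm_suminf_le[OF neumann_term[OF assms] geo(1)])
  let ?d = "proj_dist p q powr \<alpha>"
  have "neumann w h p - neumann w h q = (\<Sum>j. w ^ Suc j * (R ^^ j) h p - w ^ Suc j * (R ^^ j) h q)"
    unfolding neumann_def by (rule suminf_diff; rule neumann_summable[OF assms])
  also have "cmod \<dots> \<le> (\<Sum>j. (C * ?d) * (1/2) ^ j)"
  proof (rule norm_suminf_le[OF _ geo(1)])
    fix j
    have "cmod (w ^ Suc j * (R ^^ j) h p - w ^ Suc j * (R ^^ j) h q) = cmod ((R ^^ j) h p - (R ^^ j) h q)"
      using w by (simp add: right_diff_distrib[symmetric] norm_mult norm_power)
    also have "\<dots> \<le> C / 2 ^ j * ?d" by (rule holder_boundD(2)[OF R_funpow_bound[OF h]])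
    finally show "cmod (w ^ Suc j * (R ^^ j) h p - w ^ Suc j * (R ^^ j) h q) \<le> (C * ?d) * (1/2) ^ j"
      by (simp add: power_divide)
  qed
  finally show "cmod (neumann w h p - neumann w h q) \<le> 2 * C * ?d" by (simp add: geo(2))
qed

lemma neumann_split:
  assumes h: "holder_bound \<alpha> h C" and w: "cmod w = 1"
  shows "neumann w h = (\<lambda>p. w * h p + w * neumann w (R h) p)"
proof
  fix p
  have "neumann w h p = (\<Sum>j. w ^ Suc (Suc j) * (R ^^ Suc j) h p) + w ^ Suc 0 * (R ^^ 0) h p"
    unfolding neumann_def using suminf_split_head[OF neumann_summable[OF assms, of p]] by simp
  also have "(\<Sum>j. w ^ Suc (Suc j) * (R ^^ Suc j) h p) = (\<Sum>j. w * (w ^ Suc j * (R ^^ j) (R h) p))"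
    by (simp only: funpow_Suc_right o_apply power_Suc mult.assoc)
  also have "\<dots> = w * neumann w (R h) p"
    unfolding neumann_def by (rule suminf_mult[OF neumann_summable[OF R_bound[OF h] w]])
  finally show "neumann w h p = w * h p + w * neumann w (R h) p" by simp
qed

text \<open>By \<open>neumann_split\<close> the commutator at \<open>h\<close> is \<open>w\<close> times the one at \<open>R h\<close>.  So its size
  at \<open>h\<close> is its size at \<open>R^j h\<close>, which is of order \<open>2^{-j}\<close>.\<close>
lemma neumann_commute:
  assumes h: "holder_bound \<alpha> h C" and w: "cmod w = 1"
  shows "R (neumann w h) = neumann w (R h)"
proof
  fix p
  define e where "e h = R (neumann w h) p - neumann w (R h) p" for h
  have b: "cmod (e h) \<le> 2 * C" if "holder_bound \<alpha> h C" for h C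
    using holder_boundD(1)[OF holder_bound_diff[OF R_bound[OF neumann_bound[OF that w]] neumann_bound[OF R_bound[OF that] w]], of p]
    by (simp add: e_def)
  have s: "e h = w * e (R h)" if "holder_bound \<alpha> h C" for h C
  proof -
    have "R (neumann w h) = R (\<lambda>p. w * h p + w * neumann w (R h) p)"
      using neumann_split[OF that w] by simp
    also have "\<dots> = (\<lambda>p. w * R h p + w * R (neumann w (R h)) p)"
      by (rule R_lincomb[OF that neumann_bound[OF R_bound[OF that] w]])
    finally show ?thesis
      unfolding e_def using fun_cong[OF neumann_split[OF R_bound[OF that] w], of p] by (simp add: algebra_simps)
  qed
  have "cmod (e h) = cmod (e ((R ^^ j) h))" for j
  proof (induction j)
    case (Suc j)
    thus ?case using s[OF R_funpow_bound[OF h, of j]] w by (simp add: norm_mult)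
  qed simp
  hence "cmod (e h) \<le> 2 * C * (1/2) ^ j" for j
    using b[OF R_funpow_bound[OF h, of j]] by (simp add: power_divide)
  moreover have "(\<lambda>j. 2 * C * (1/2 :: real) ^ j) \<longlonglongrightarrow> 0"
    by (intro tendsto_mult_right_zero LIMSEQ_power_zero) simp
  ultimately have "cmod (e h) \<le> 0"
    by (intro LIMSEQ_le_const) auto
  thus "R (neumann w h) p = neumann w (R h) p" by (simp add: e_def)
qed

text \<open>The polynomial \<open>z^n - t^n\<close> is divisible by \<open>z - t\<close>.  The quotient is a fixed
  polynomial in the Markov operator, hence bounded.\<close>
lemma shifted_telescope:
  "\<exists>K\<ge>0. \<forall>g C. holder_bound \<alpha> g C \<longrightarrow> (\<exists>u. holder_bound \<alpha> u (K * C) \<and>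
     (\<forall>p. z ^ n * g p - (markov_op Q ^^ n) g p = shifted_op Q z u p))"
proof (induction n)
  case 0
  have "shifted_op Q z (\<lambda>p. 0) p = 0" for p
    using fun_cong[OF shifted_op_zero, of Q z p] by (simp add: zero_fun_def)
  thus ?case
    by (intro exI[of _ 0] conjI allI impI order_refl exI[of _ "\<lambda>p. 0"]) (auto simp: holder_bound_def)
next
  case (Suc n)
  then obtain K where K: "K \<ge> 0" and *: "\<And>g C. holder_bound \<alpha> g C \<Longrightarrow> (\<exists>u. holder_bound \<alpha> u (K * C) \<and>
     (\<forall>p. z ^ n * g p - (markov_op Q ^^ n) g p = shifted_op Q z u p))" by blast
  let ?M = "\<bar>markov_const \<alpha>\<bar>"
  have "\<exists>u. holder_bound \<alpha> u ((cmod z ^ n + ?M * K) * C) \<and>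
     (\<forall>p. z ^ Suc n * g p - (markov_op Q ^^ Suc n) g p = shifted_op Q z u p)"
    if g: "holder_bound \<alpha> g C" for g C
  proof -
    obtain u where u: "holder_bound \<alpha> u (K * C)"
      "\<And>p. z ^ n * g p - (markov_op Q ^^ n) g p = shifted_op Q z u p" using *[OF g] by blast
    have gn: "\<exists>D. holder_bound \<alpha> ((markov_op Q ^^ n) g) D" for n
      by (induction n) (use g markov_op_holder[OF _ \<alpha>] in auto)
    then obtain D where D: "holder_bound \<alpha> ((markov_op Q ^^ n) g) D" by blast
    have Mu: "holder_bound \<alpha> (markov_op Q u) (?M * (K * C))"
      using markov_op_holder[OF u(1) \<alpha>] holder_boundD(3)[OF u(1)]
      by (auto elim!: holder_bound_mono intro: mult_right_mono)
    (* (z^(n+1) - t^(n+1)) / (z - t) = z^n + t (z^n - t^n) / (z - t) *)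
    define u' where "u' p = z ^ n * g p + markov_op Q u p" for p
    have "holder_bound \<alpha> u' (cmod (z ^ n) * C + ?M * (K * C))"
      unfolding u'_def by (intro holder_bound_add holder_bound_scale g Mu)
    moreover have "z ^ Suc n * g p - (markov_op Q ^^ Suc n) g p = shifted_op Q z u' p" for p
    proof -
      have "markov_op Q u' = (\<lambda>p. z ^ n * markov_op Q g p + 1 * markov_op Q (markov_op Q u) p)"
        unfolding u'_def using markov_op_lincomb[OF g Mu \<alpha>, of "z ^ n" 1] by simp
      hence m1: "markov_op Q u' p = z ^ n * markov_op Q g p + markov_op Q (markov_op Q u) p" by simp
      have "markov_op Q u = (\<lambda>p. z * u p + (-1) * shifted_op Q z u p)"
        by (simp add: shifted_op_def fun_eq_iff)
      also have "\<dots> = (\<lambda>p. z * u p + (-1) * (z ^ n * g p - (markov_op Q ^^ n) g p))"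
        by (simp add: u(2))
      finally have e: "markov_op Q u = \<dots>" .
      have "markov_op Q (\<lambda>p. z ^ n * g p + (-1) * (markov_op Q ^^ n) g p)
          = (\<lambda>p. z ^ n * markov_op Q g p + (-1) * markov_op Q ((markov_op Q ^^ n) g) p)"
        by (rule markov_op_lincomb[OF g D \<alpha>])
      hence "markov_op Q (\<lambda>p. z * u p + (-1) * (z ^ n * g p + (-1) * (markov_op Q ^^ n) g p))
          = (\<lambda>p. z * markov_op Q u p + (-1) * (z ^ n * markov_op Q g p + (-1) * markov_op Q ((markov_op Q ^^ n) g) p))"
        using markov_op_lincomb[OF u(1) holder_bound_add[OF holder_bound_scale[OF g] holder_bound_scale[OF D]] \<alpha>, of z "-1" "z ^ n" "-1"]
        by simp
      hence "markov_op Q (markov_op Q u) p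
          = z * markov_op Q u p - (z ^ n * markov_op Q g p - (markov_op Q ^^ Suc n) g p)"
        using e by simp
      thus ?thesis unfolding shifted_op_def m1 by (simp add: u'_def algebra_simps)
    qed
    ultimately show ?thesis by (intro exI[of _ u']) (auto simp: norm_power algebra_simps)
  qed
  thus ?case using K by (intro exI[of _ "cmod z ^ n + ?M * K"]) auto
qed

text \<open>For \<open>g = (z^N - R)^{-1} h\<close> the function \<open>h\<close> is \<open>z^N g - \<Pi>^N g\<close> modulo quadratic forms,
  and \<open>z^N - \<Pi>^N\<close> factors through \<open>z - \<Pi>\<close>.\<close>
lemma shifted_solve_mod_quadform:
  assumes z: "cmod z = 1"
  shows "\<exists>K\<ge>0. \<forall>h C. holder_bound \<alpha> h C \<longrightarrow> (\<exists>u A. holder_bound \<alpha> u (K * C) \<and>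
     (\<forall>p. h p = shifted_op Q z u p + quadform A p))"
proof -
  obtain K where K: "K \<ge> 0" and *: "\<And>g C. holder_bound \<alpha> g C \<Longrightarrow> (\<exists>u. holder_bound \<alpha> u (K * C) \<and>
     (\<forall>p. z ^ N * g p - (markov_op Q ^^ N) g p = shifted_op Q z u p))" using shifted_telescope by metis
  have "\<exists>u A. holder_bound \<alpha> u (2 * K * C) \<and> (\<forall>p. h p = shifted_op Q z u p + quadform A p)"
    if h: "holder_bound \<alpha> h C" for h C
  proof -
    define w where "w = inverse (z ^ N)"
    have "z \<noteq> 0" using z by auto
    hence w: "cmod w = 1" "z ^ N * w = 1" using z by (simp_all add: w_def norm_inverse norm_power)
    let ?g = "neumann w h"
    obtain u where u: "holder_bound \<alpha> u (K * (2 * C))"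
      "\<And>p. z ^ N * ?g p - (markov_op Q ^^ N) ?g p = shifted_op Q z u p"
      using *[OF neumann_bound[OF h w(1)]] by blast
    obtain A where A: "\<And>p. (markov_op Q ^^ N) ?g p = R ?g p + quadform A p"
      using R_split[OF neumann_bound[OF h w(1)]] by blast
    have "h p = shifted_op Q z u p + quadform A p" for p
    proof -
      have "z ^ N * ?g p = (z ^ N * w) * h p + (z ^ N * w) * R ?g p"
        by (subst neumann_split[OF h w(1)]) (simp add: neumann_commute[OF h w(1)] algebra_simps)
      hence "z ^ N * ?g p = h p + R ?g p" by (simp only: w(2) mult_1)
      thus ?thesis using u(2)[of p] A[of p] by (simp add: algebra_simps)
    qed
    thus ?thesis using u(1) by (auto simp: mult_ac)
  qed
  thus ?thesis using K by (intro exI[of _ "2 * K"]) auto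
qed

text \<open>If \<open>b = (z - \<Pi>) f\<close> is an eigenvector, then \<open>\<Pi>^n f = z^n f - n z^{n-1} b\<close>.  The left
  side is bounded in \<open>n\<close>, so \<open>b = 0\<close>.\<close>
lemma peripheral_semisimple:
  assumes f: "holder_bound \<alpha> f C" and z: "cmod z = 1" and sq: "shifted_op Q z (shifted_op Q z f) = 0"
  shows "shifted_op Q z f = 0"
proof -
  define b where "b = shifted_op Q z f"
  have b: "\<exists>D. holder_bound \<alpha> b D"
    using holder_bound_diff[OF holder_bound_scale[OF f] markov_op_holder[OF f \<alpha>]] unfolding b_def shifted_op_def by blast
  then obtain D where D: "holder_bound \<alpha> b D" by blast
  have mb: "markov_op Q b = (\<lambda>p. z * b p)" using sq unfolding b_def[symmetric] by (simp add: shifted_op_def fun_eq_iff)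
  have mf: "markov_op Q f = (\<lambda>p. z * f p + (-1) * b p)" by (simp add: b_def shifted_op_def fun_eq_iff)
  have it: "z * (markov_op Q ^^ n) f p = z ^ Suc n * f p - of_nat n * z ^ n * b p" for n p
  proof (induction n arbitrary: p)
    case (Suc n)
    have "z \<noteq> 0" using z by auto
    hence "(markov_op Q ^^ n) f = (\<lambda>p. z ^ n * f p + (- of_nat n * z ^ n / z) * b p)"
      using Suc.IH by (auto simp: fun_eq_iff field_simps)
    hence "(markov_op Q ^^ Suc n) f = (\<lambda>p. z ^ n * markov_op Q f p + (- of_nat n * z ^ n / z) * markov_op Q b p)"
      by (simp only: funpow.simps o_apply markov_op_lincomb[OF f D \<alpha>])
    thus ?case using \<open>z \<noteq> 0\<close> by (simp add: mf mb field_simps)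
  qed simp
  have bd: "holder_bound \<alpha> ((markov_op Q ^^ n) f) (max 0 (markov_const \<alpha>) ^ n * C)" for n
  proof (induction n)
    case (Suc n)
    have "holder_bound \<alpha> (markov_op Q ((markov_op Q ^^ n) f)) (markov_const \<alpha> * (max 0 (markov_const \<alpha>) ^ n * C))"
      by (rule markov_op_holder[OF Suc \<alpha>])
    thus ?case using holder_boundD(3)[OF Suc]
      by (auto elim!: holder_bound_mono simp: mult.assoc intro!: mult_right_mono)
  qed (simp add: f)
  have sup: "cmod ((markov_op Q ^^ n) f p) \<le> C" for n p
  proof (induction n arbitrary: p)
    case (Suc n)
    show ?case using markov_op_sup[OF bd \<alpha> Suc] by simp
  qed (simp add: holder_boundD(1)[OF f])
  have "b p = 0" for p
  proof (rule ccontr)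
    assume "b p \<noteq> 0"
    then obtain n where n: "2 * C < real n * cmod (b p)" using reals_Archimedean3[of "cmod (b p)"] by auto
    have "of_nat n * z ^ n * b p = z ^ Suc n * f p - z * (markov_op Q ^^ n) f p" by (simp add: it)
    hence "real n * cmod (b p) = cmod (z ^ Suc n * f p - z * (markov_op Q ^^ n) f p)"
      using arg_cong[of _ _ cmod] z by (simp add: norm_mult norm_power) (metis mult.right_neutral norm_mult norm_of_nat norm_power power_one)
    also have "\<dots> \<le> C + C"
      using z sup[of n p] holder_boundD(1)[OF f, of p]
      by (intro order_trans[OF norm_triangle_ineq4] add_mono) (auto simp: norm_mult norm_power)
    finally show False using n by simp
  qed
  thus ?thesis unfolding b_def[symmetric] by (simp add: fun_eq_iff)
qed

lemma gen_eigenspace_eq: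
  assumes z: "cmod z = 1"
  shows "gen_eigenspace Q \<alpha> z = {f \<in> holder_space \<alpha>. shifted_op Q z f = 0}"
proof -
  have shift: "shifted_op Q z f \<in> holder_space \<alpha>" if "f \<in> holder_space \<alpha>" for f
  proof -
    obtain C where C: "holder_bound \<alpha> f C" using \<open>f \<in> holder_space \<alpha>\<close> holder_space_iff by blast
    from holder_bound_diff[OF holder_bound_scale[OF C] markov_op_holder[OF C \<alpha>]] show ?thesis
      unfolding shifted_op_def holder_space_iff by blast
  qed
  have z0: "shifted_op Q z 0 = 0" by (rule shifted_op_zero)
  have "shifted_op Q z f = 0" if "f \<in> holder_space \<alpha>" "(shifted_op Q z ^^ n) f = 0" for f n
    using that
  proof (induction n arbitrary: f)
    case 0
    hence "f = 0" by (simp only: funpow_0)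
    thus ?case by (simp only: z0)
  next
    case (Suc n)
    have "(shifted_op Q z ^^ n) (shifted_op Q z f) = 0" using Suc.prems(2) by (simp only: funpow_Suc_right o_apply)
    from Suc.IH[OF shift[OF Suc.prems(1)] this]
    show ?case using peripheral_semisimple z Suc.prems(1) holder_space_iff by blast
  qed
  moreover have "\<exists>n. (shifted_op Q z ^^ n) f = 0" if "shifted_op Q z f = 0" for f
    using that by (intro exI[of _ 1]) simp
  ultimately show ?thesis unfolding gen_eigenspace_def by blast
qed

text \<open>The operator \<open>z - \<Pi>\<close> in terms of the matrices of quadratic forms.\<close>
definition shift_matrix :: "complex \<Rightarrow> complex ^ 'k ^ 'k \<Rightarrow> complex ^ 'k ^ 'k" where
  "shift_matrix z A = cscale z A - quantum_map Q A"

lemma shifted_quadform: "shifted_op Q z (quadform A) = quadform (shift_matrix z A)"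
  by (simp add: shifted_op_def shift_matrix_def quadform_diff quadform_cscale markov_op_quadform fun_eq_iff)

lemma linear_shift_matrix: "linear (shift_matrix z)"
proof (rule linearI)
  have lc: "shift_matrix z (cscale c A + cscale d B) = cscale c (shift_matrix z A) + cscale d (shift_matrix z B)" for A B c d
  proof (rule quadform_inject)
    have q: "quadform (cscale c A + cscale d B) = (\<lambda>p. c * quadform A p + d * quadform B p)" for A B :: "complex ^ 'k ^ 'k"
      by (simp add: fun_eq_iff quadform_add quadform_cscale)
    show "quadform (shift_matrix z (cscale c A + cscale d B)) = quadform (cscale c (shift_matrix z A) + cscale d (shift_matrix z B))"
      unfolding shifted_quadform[symmetric] q
      unfolding shifted_op_def markov_op_lincomb[OF quadform_bound[OF \<alpha>] quadform_bound[OF \<alpha>] \<alpha>]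
      by (simp add: fun_eq_iff algebra_simps)
  qed
  have cs: "cscale 1 A = A" "cscale 0 A = 0" "cscale (of_real r) A = r *\<^sub>R A" for A :: "complex ^ 'k ^ 'k" and r
    by (simp_all add: cscale_def map_matrix_def vec_eq_iff scaleR_conv_of_real[where 'a=complex])
  show "shift_matrix z (A + B) = shift_matrix z A + shift_matrix z B" for A B
    using lc[of 1 A 1 B] by (simp add: cs)
  show "shift_matrix z (r *\<^sub>R A) = r *\<^sub>R shift_matrix z A" for r A
    using lc[of "of_real r" A 0 A] by (simp add: cs)
qed

lemma shifted_op_diff:
  assumes "holder_bound \<alpha> f C" "holder_bound \<alpha> g D"
  shows "shifted_op Q z (\<lambda>p. f p + c * g p) = (\<lambda>p. shifted_op Q z f p + c * shifted_op Q z g p)"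
  unfolding shifted_op_def using markov_op_lincomb[OF assms \<alpha>, of 1 c] by (simp add: fun_eq_iff algebra_simps)

text \<open>If \<open>shift_matrix z\<close> is injective, then as a linear map of a finite-dimensional space
  it is bijective with bounded inverse.  Together with the solution modulo quadratic forms
  this gives a bounded inverse of \<open>z - \<Pi>\<close> on all Hoelder functions, so that \<open>z\<close> is not in the
  spectrum.\<close>
lemma peripheral_value_eigen:
  assumes z: "z \<in> peripheral_spectrum Q \<alpha>"
  shows "\<exists>A. A \<noteq> 0 \<and> shift_matrix z A = 0"
proof (rule ccontr)
  assume neg: "\<not> ?thesis"
  have z1: "cmod z = 1" using z by (simp add: peripheral_spectrum_def)
  have lin: "linear (shift_matrix z)" by (rule linear_shift_matrix)
  have inj: "inj (shift_matrix z)"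
    using neg linear_injective_0[OF lin] by blast
  hence surj: "surj (shift_matrix z)" using eucl.linear_injective_imp_surjective[OF lin] by simp
  obtain B where B: "B > 0" "\<And>A. B * norm A \<le> norm (shift_matrix z A)"
    using linear_inj_bounded_below_pos[OF lin inj] by blast
  obtain K where K: "K \<ge> 0" "\<And>h C. holder_bound \<alpha> h C \<Longrightarrow> (\<exists>u A. holder_bound \<alpha> u (K * C) \<and>
     (\<forall>p. h p = shifted_op Q z u p + quadform A p))"
    using shifted_solve_mod_quadform[OF z1] by blast
  let ?k = "4 * (real CARD('k))\<^sup>2" and ?M = "\<bar>markov_const \<alpha>\<bar>"
  (* The factors 3 and 4 k^2 compare a matrix with its quadratic form, see quadform_bound and
     norm_le_quadform; 1 / B bounds the inverse on matrices. *)
  define K' where "K' = K + 3 * (?k * (1 + K + ?M * K) / B)"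
  have solve: "\<exists>u. holder_bound \<alpha> u (K' * C) \<and> shifted_op Q z u = h" if h: "holder_bound \<alpha> h C" for h C
  proof -
    obtain u A where u: "holder_bound \<alpha> u (K * C)" and A: "\<And>p. h p = shifted_op Q z u p + quadform A p"
      using K(2)[OF h] by blast
    have C: "0 \<le> C" by (rule holder_boundD(3)[OF h])
    have Mu: "cmod (markov_op Q u p) \<le> ?M * (K * C)" for p
      using holder_boundD(1)[OF markov_op_holder[OF u \<alpha>], of p] holder_boundD(3)[OF u]
      by (smt (verit) mult_right_mono)
    have "cmod (quadform A p) \<le> (1 + K + ?M * K) * C" for p
    proof -
      have "quadform A p = h p - (z * u p - markov_op Q u p)" using A[of p] by (simp add: shifted_op_def)
      also have "cmod \<dots> \<le> C + (K * C + ?M * (K * C))"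
        using holder_boundD(1)[OF h, of p] holder_boundD(1)[OF u, of p] Mu[of p] z1
        by (intro order_trans[OF norm_triangle_ineq4] add_mono) (auto simp: norm_mult)
      finally show ?thesis by (simp add: algebra_simps)
    qed
    hence nA: "norm A \<le> ?k * ((1 + K + ?M * K) * C)" by (rule norm_le_quadform)
    obtain A' where A': "A = shift_matrix z A'" using surj by (metis surjD)
    have "norm A' \<le> norm A / B" using B(2)[of A'] B(1) A' by (simp add: field_simps)
    also have "\<dots> \<le> ?k * ((1 + K + ?M * K) * C) / B" using nA B(1) by (simp add: divide_right_mono)
    finally have nA': "norm A' \<le> ?k * ((1 + K + ?M * K) * C) / B" .
    have "holder_bound \<alpha> (\<lambda>p. u p + 1 * quadform A' p) (K * C + 3 * norm A')"
      using holder_bound_add[OF u quadform_bound[OF \<alpha>, of A']] by simp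
    hence "holder_bound \<alpha> (\<lambda>p. u p + 1 * quadform A' p) (K' * C)"
    proof (rule holder_bound_mono)
      have "K' * C = K * C + 3 * (?k * ((1 + K + ?M * K) * C) / B)"
        by (simp add: K'_def distrib_right mult.assoc)
      thus "K * C + 3 * norm A' \<le> K' * C" using nA' by simp
    qed
    moreover have "shifted_op Q z (\<lambda>p. u p + 1 * quadform A' p) = h"
      using shifted_op_diff[OF u quadform_bound[OF \<alpha>], of z 1 A'] A by (simp add: shifted_quadform A' fun_eq_iff)
    ultimately show ?thesis by blast
  qed
  have uniq: "u = u'" if u: "u \<in> holder_space \<alpha>" "u' \<in> holder_space \<alpha>" "shifted_op Q z u = shifted_op Q z u'" for u u'
  proof -
    obtain C D where CD: "holder_bound \<alpha> u C" "holder_bound \<alpha> u' D" using u holder_space_iff by blast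
    let ?d = "\<lambda>p. u p + (-1) * u' p"
    have d: "holder_bound \<alpha> ?d (C + D)" using holder_bound_diff[OF CD] by simp
    have s: "shifted_op Q z ?d = quadform 0"
      using shifted_op_diff[OF CD, of z "-1"] u(3) by (simp add: fun_eq_iff quadform_def)
    obtain A where A: "?d = quadform A" using quadform_of_peripheral[OF d z1] s by metis
    have "shift_matrix z A = 0" using s unfolding A shifted_quadform by (rule quadform_inject)
    hence "A = 0" using neg by blast
    hence "?d p = 0" for p using A by (simp add: fun_eq_iff quadform_def)
    thus ?thesis by (simp add: fun_eq_iff)
  qed
  define S where "S h = (SOME u. holder_bound \<alpha> u (K' * holder_norm \<alpha> h) \<and> shifted_op Q z u = h)" for h
  have S: "holder_bound \<alpha> (S h) (K' * holder_norm \<alpha> h) \<and> shifted_op Q z (S h) = h" if "h \<in> holder_space \<alpha>" for h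
    unfolding S_def using someI_ex[OF solve[OF holder_bound_holder_norm[OF that]]] .
  have "z \<notin> spectrum_on Q \<alpha>"
    unfolding spectrum_on_def mem_Collect_eq not_not
  proof (intro exI[of _ S] conjI ballI)
    fix f :: "'k cproj \<Rightarrow> complex" assume f: "f \<in> holder_space \<alpha>"
    show "S f \<in> holder_space \<alpha>" unfolding holder_space_iff by (rule exI, rule conjunct1[OF S[OF f]])
    show "shifted_op Q z (S f) = f" by (rule conjunct2[OF S[OF f]])
    obtain C where C: "holder_bound \<alpha> f C" using f holder_space_iff by blast
    have sf: "shifted_op Q z f \<in> holder_space \<alpha>"
      unfolding shifted_op_def holder_space_iff
      using holder_bound_diff[OF holder_bound_scale[OF C] markov_op_holder[OF C \<alpha>]] by blast
    show "S (shifted_op Q z f) = f"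
    proof (rule uniq[OF _ f])
      show "S (shifted_op Q z f) \<in> holder_space \<alpha>"
        unfolding holder_space_iff by (rule exI, rule conjunct1[OF S[OF sf]])
      show "shifted_op Q z (S (shifted_op Q z f)) = shifted_op Q z f" by (rule conjunct2[OF S[OF sf]])
    qed
  next
    show "\<exists>B. \<forall>f\<in>holder_space \<alpha>. holder_norm \<alpha> (S f) \<le> B * holder_norm \<alpha> f"
    proof (intro exI[of _ "2 * K'"] ballI)
      fix f :: "'k cproj \<Rightarrow> complex" assume "f \<in> holder_space \<alpha>"
      from holder_norm_le[OF conjunct1[OF S[OF this]]] show "holder_norm \<alpha> (S f) \<le> 2 * K' * holder_norm \<alpha> f" by simp
    qed
  qed
  thus False using z by (simp add: peripheral_spectrum_def)
qed

text \<open>Kernel and range of a semisimple linear map are complementary: the map is injective on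
  its range, hence maps the range onto itself.\<close>
lemma shift_matrix_decompose:
  assumes z: "cmod z = 1"
  shows "\<exists>A1 A2. A = A1 + shift_matrix z A2 \<and> shift_matrix z A1 = 0"
proof -
  let ?L = "shift_matrix z"
  note lin = linear_shift_matrix[of z]
  have sq: "?L A = 0" if "?L (?L A) = 0" for A
  proof -
    have "shifted_op Q z (shifted_op Q z (quadform A)) = 0"
      by (simp add: shifted_quadform that) (simp add: quadform_def fun_eq_iff)
    hence "shifted_op Q z (quadform A) = 0" by (rule peripheral_semisimple[OF quadform_bound[OF \<alpha>] z])
    hence "quadform (?L A) = quadform 0" unfolding shifted_quadform by (simp add: quadform_def fun_eq_iff)
    thus ?thesis by (rule quadform_inject)
  qed
  have sub: "subspace (range ?L)" by (intro linear_subspace_image[OF lin] subspace_UNIV)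
  have "inj_on ?L (span (range ?L))"
  proof (rule inj_onI)
    fix x y assume "x \<in> span (range ?L)" "y \<in> span (range ?L)" and e: "?L x = ?L y"
    then obtain a b where ab: "x = ?L a" "y = ?L b" using sub by (auto simp: span_eq_iff[THEN iffD2])
    hence "?L (?L (a - b)) = 0" using e by (simp add: linear_diff[OF lin])
    from sq[OF this] show "x = y" using ab by (simp add: linear_diff[OF lin])
  qed
  hence "dim (?L ` range ?L) = dim (range ?L)" by (rule eucl.dim_image_eq[OF lin])
  hence "?L ` range ?L = range ?L"
    by (intro subspace_dim_equal linear_subspace_image[OF lin] sub) auto
  then obtain B where "?L A = ?L (?L B)" by (metis (no_types, lifting) imageE rangeI)
  hence "?L (A - ?L B) = 0" by (simp add: linear_diff[OF lin])
  thus ?thesis by (intro exI[of _ "A - ?L B"] exI[of _ B]) auto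
qed

text \<open>A one-dimensional kernel on matrices yields simplicity on Hoelder functions: kernels
  agree, the range misses the kernel since there are no Jordan blocks, and it is a complement
  since both solving modulo quadratic forms and the decomposition of matrices are available.\<close>
lemma simple_of_line:
  assumes z: "cmod z = 1" and B: "B \<noteq> 0" "shift_matrix z B = 0"
    and line: "\<And>A. shift_matrix z A = 0 \<Longrightarrow> \<exists>c. A = cscale c B"
  shows "simple_spectral_value Q \<alpha> z"
proof -
  have gen: "gen_eigenspace Q \<alpha> z = {\<lambda>p. c * quadform B p | c. True}"
  proof (intro set_eqI iffI)
    fix f assume "f \<in> gen_eigenspace Q \<alpha> z"
    hence f: "f \<in> holder_space \<alpha>" "shifted_op Q z f = 0" unfolding gen_eigenspace_eq[OF z] by auto
    then obtain C where C: "holder_bound \<alpha> f C" using holder_space_iff by blast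
    obtain A where A: "f = quadform A" using quadform_of_peripheral[OF C z, of 0] f(2) quadform_zero by metis
    have "quadform (shift_matrix z A) = quadform 0" using f(2) unfolding A shifted_quadform quadform_zero .
    then obtain c where "A = cscale c B" using line quadform_inject by blast
    thus "f \<in> {\<lambda>p. c * quadform B p | c. True}" using A by (auto simp: quadform_cscale fun_eq_iff)
  next
    fix f assume "f \<in> {\<lambda>p. c * quadform B p | c. True}"
    then obtain c where c: "f = (\<lambda>p. c * quadform B p)" by blast
    have "holder_bound \<alpha> f (cmod c * (3 * norm B))" unfolding c by (intro holder_bound_scale quadform_bound[OF \<alpha>])
    moreover have "shifted_op Q z f = 0"
    proof -
      have "shifted_op Q z (\<lambda>p. quadform 0 p + c * quadform B p) = (\<lambda>p. shifted_op Q z (quadform 0) p + c * shifted_op Q z (quadform B) p)"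
        by (rule shifted_op_diff[OF quadform_bound[OF \<alpha>] quadform_bound[OF \<alpha>]])
      thus ?thesis by (simp add: c quadform_zero shifted_op_zero shifted_quadform B(2) fun_eq_iff)
    qed
    ultimately show "f \<in> gen_eigenspace Q \<alpha> z" unfolding gen_eigenspace_eq[OF z] holder_space_iff by blast
  qed
  have Bq: "quadform B \<noteq> 0" using quadform_inject[of B 0] B(1) quadform_zero by auto
  have span: "gen_eigenspace Q \<alpha> z = cfun.span {quadform B}"
    unfolding gen cfun.span_singleton by auto
  have "cfun.independent {quadform B}" using Bq by (simp add: cfun.dependent_single)
  hence dim: "cfun.dim (gen_eigenspace Q \<alpha> z) = 1"
    unfolding span cfun.dim_span by (subst cfun.dim_eq_card_independent) auto
  have int: "gen_eigenspace Q \<alpha> z \<inter> shifted_op Q z ` holder_space \<alpha> = {0}"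
  proof (intro equalityI subsetI)
    fix f assume "f \<in> gen_eigenspace Q \<alpha> z \<inter> shifted_op Q z ` holder_space \<alpha>"
    then obtain u where u: "u \<in> holder_space \<alpha>" "f = shifted_op Q z u" "shifted_op Q z f = 0"
      unfolding gen_eigenspace_eq[OF z] by blast
    obtain C where "holder_bound \<alpha> u C" using u holder_space_iff by blast
    from peripheral_semisimple[OF this z] show "f \<in> {0}" using u by simp
  next
    fix f :: "'k cproj \<Rightarrow> complex" assume "f \<in> {0}"
    moreover have "(0 :: 'k cproj \<Rightarrow> complex) \<in> gen_eigenspace Q \<alpha> z"
      unfolding span using cfun.span_zero by (simp add: zero_fun_def)
    moreover have "shifted_op Q z (quadform 0) = 0" by (simp add: shifted_op_zero quadform_zero)
    moreover have "quadform (0 :: complex ^ 'k ^ 'k) \<in> holder_space \<alpha>" using quadform_bound[OF \<alpha>] holder_space_iff by blast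
    ultimately show "f \<in> gen_eigenspace Q \<alpha> z \<inter> shifted_op Q z ` holder_space \<alpha>" by (metis IntI imageI singletonD)
  qed
  have sum: "{u + w | u w. u \<in> gen_eigenspace Q \<alpha> z \<and> w \<in> shifted_op Q z ` holder_space \<alpha>} = holder_space \<alpha>"
  proof (intro equalityI subsetI)
    fix h assume "h \<in> {u + w | u w. u \<in> gen_eigenspace Q \<alpha> z \<and> w \<in> shifted_op Q z ` holder_space \<alpha>}"
    then obtain u w where uw: "h = u + shifted_op Q z w" "u \<in> holder_space \<alpha>" "w \<in> holder_space \<alpha>"
      unfolding gen_eigenspace_eq[OF z] by blast
    then obtain C D where "holder_bound \<alpha> u C" and w: "holder_bound \<alpha> w D" using holder_space_iff by blast
    from holder_bound_add[OF this(1) holder_bound_diff[OF holder_bound_scale[OF w] markov_op_holder[OF w \<alpha>]]]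
    show "h \<in> holder_space \<alpha>" unfolding uw(1) shifted_op_def holder_space_iff plus_fun_def by blast
  next
    fix h :: "'k cproj \<Rightarrow> complex" assume "h \<in> holder_space \<alpha>"
    then obtain C where "holder_bound \<alpha> h C" using holder_space_iff by blast
    then obtain u K A where u: "holder_bound \<alpha> u K" and A: "\<And>p. h p = shifted_op Q z u p + quadform A p"
      using shifted_solve_mod_quadform[OF z] by metis
    obtain A1 A2 where A12: "A = A1 + shift_matrix z A2" "shift_matrix z A1 = 0" using shift_matrix_decompose[OF z] by blast
    let ?w = "\<lambda>p. u p + 1 * quadform A2 p"
    have "?w \<in> holder_space \<alpha>" using holder_bound_add[OF u quadform_bound[OF \<alpha>, of A2]] holder_space_iff by auto
    moreover have "quadform A1 \<in> gen_eigenspace Q \<alpha> z"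
      unfolding gen_eigenspace_eq[OF z] using quadform_bound[OF \<alpha>, of A1] holder_space_iff
      by (auto simp: shifted_quadform A12(2) quadform_zero)
    moreover have "h = quadform A1 + shifted_op Q z ?w"
      using A shifted_op_diff[OF u quadform_bound[OF \<alpha>], of z 1 A2]
      by (simp add: shifted_quadform A12(1) quadform_add fun_eq_iff)
    ultimately show "h \<in> {u + w | u w. u \<in> gen_eigenspace Q \<alpha> z \<and> w \<in> shifted_op Q z ` holder_space \<alpha>}" by blast
  qed
  show ?thesis unfolding simple_spectral_value_def using dim int sum by blast
qed

end

text \<open>Two nested products: the first has a uniform contraction of areas, and a power of it
  makes the defect at most \<open>1 / (8 k)\<close>, which cancels the constant \<open>4 k\<close> of \<open>remainder_bound\<close>
  up to 1/2.\<close>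
lemma contracting_remainder_exists:
  assumes Q: "kraus_prob (Q :: (complex ^ 'k::finite ^ 'k) measure)"
    and pur: "\<And>x y. orthonormal x y \<Longrightarrow> \<exists>n. mean_area (product_law Q n) x y < 1"
    and \<alpha>: "0 < \<alpha>" "\<alpha> \<le> 1"
  obtains N R where "contracting_remainder Q \<alpha> N R"
proof -
  let ?k = "real CARD('k)"
  have "\<exists>n c. 0 \<le> c \<and> c < 1 \<and> (\<forall>x y. mean_area (product_law Q n) x y \<le> c * area x y)"
    by (rule uniform_area_contraction[OF Q]) (use pur in blast)+
  then obtain n c where c: "0 \<le> c" "c < 1" "\<And>x y. mean_area (product_law Q n) x y \<le> c * area x y"
    by blast
  have Qn: "kraus_prob (product_law Q n)" by (rule kraus_product_law[OF Q])
  obtain j where j: "holder_defect \<alpha> (product_law (product_law Q n) j) \<le> 1 / (8 * ?k)"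
    using holder_defect_small[OF Qn c \<alpha>, of "1 / (8 * ?k)"] by auto
  interpret Q: kraus_prob Q by fact
  interpret Qj: kraus_prob "product_law (product_law Q n) j" by (rule kraus_product_law[OF Qn])
  have mk: "markov_op (product_law (product_law Q n) j) f = (markov_op Q ^^ (n * j)) f" if "f \<in> holder_space \<alpha>" for f
  proof -
    have H: "(markov_op Q ^^ i) f \<in> holder_space \<alpha>" for i
    proof (induction i)
      case (Suc i)
      then show ?case using Q.markov_op_holder[OF _ \<alpha>] unfolding holder_space_iff by (metis comp_apply funpow.simps(2))
    qed (simp add: \<open>f \<in> holder_space \<alpha>\<close>)
    have "(markov_op (product_law Q n) ^^ j) f = (markov_op Q ^^ (n * j)) f"
    proof (induction j)
      case (Suc j)
      have "(markov_op (product_law Q n) ^^ Suc j) f = (markov_op Q ^^ n) ((markov_op Q ^^ (n * j)) f)"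
        using Suc markov_op_product_law[OF Q H \<alpha>] by simp
      thus ?case by (simp add: funpow_add)
    qed simp
    thus ?thesis using markov_op_product_law[OF Qn that \<alpha>] by simp
  qed
  have "contracting_remainder Q \<alpha> (n * j) Qj.remainder"
  proof
    fix f g :: "'k cproj \<Rightarrow> complex" and C D c d
    assume f: "holder_bound \<alpha> f C"
    have "4 * ?k * holder_defect \<alpha> (product_law (product_law Q n) j) \<le> 1 / 2" using j by (simp add: field_simps)
    hence "4 * ?k * holder_defect \<alpha> (product_law (product_law Q n) j) * C \<le> C / 2"
      using mult_right_mono[of _ "1/2" C] holder_boundD(3)[OF f] by fastforce
    thus "holder_bound \<alpha> (Qj.remainder f) (C / 2)" by (rule holder_bound_mono[OF Qj.remainder_bound[OF f \<alpha>]])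
    have "f \<in> holder_space \<alpha>" using f holder_space_iff by blast
    from fun_cong[OF mk[OF this]] show "\<exists>A. \<forall>p. (markov_op Q ^^ (n * j)) f p = Qj.remainder f p + quadform A p"
      using Qj.markov_op_split[OF f \<alpha>] by metis
    assume g: "holder_bound \<alpha> g D"
    show "Qj.remainder (\<lambda>p. c * f p + d * g p) = (\<lambda>p. c * Qj.remainder f p + d * Qj.remainder g p)"
      using Qj.remainder_lincomb[OF f g \<alpha>] by (simp add: fun_eq_iff)
  qed (use \<alpha> in auto)
  thus ?thesis using that by blast
qed

abbreviation clinear :: "(complex ^ 'k::finite \<Rightarrow> complex ^ 'k) \<Rightarrow> bool" where
  "clinear \<equiv> Vector_Spaces.linear (*s) (*s)"

lemma clinear_matrix: "clinear ((*v) (A :: complex ^ 'k::finite ^ 'k))"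
  by (rule matrix_vector_mul_linear_gen)

lemma clinear_simps:
  assumes "clinear U"
  shows "U (x + y) = U x + U y" "U (c *s x) = c *s U x" "U 0 = 0" "U (x - y) = U x - U y" "U (sum f S) = (\<Sum>i\<in>S. U (f i))"
  using assms by (simp_all add: vec.linear_add vec.linear_scale vec.linear_0 vec.linear_diff vec.linear_sum)

section \<open>Existence of eigenvectors\<close>

text \<open>The value of \<open>p(U) x\<close>.\<close>
definition poly_act :: "(complex ^ 'k::finite \<Rightarrow> complex ^ 'k) \<Rightarrow> complex poly \<Rightarrow> complex ^ 'k \<Rightarrow> complex ^ 'k" where
  "poly_act U p x = (\<Sum>i\<le>degree p. coeff p i *s (U ^^ i) x)"

lemma poly_act_upto: "degree p \<le> n \<Longrightarrow> poly_act U p x = (\<Sum>i\<le>n. coeff p i *s (U ^^ i) x)"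
  unfolding poly_act_def by (rule sum.mono_neutral_left) (auto simp: coeff_eq_0)

lemma poly_act_linear_factor:
  assumes "clinear U"
  shows "poly_act U ([:-c, 1:] * q) x = U (poly_act U q x) - c *s poly_act U q x"
proof -
  let ?n = "degree q"
  have d: "degree ([:-c, 1:] * q) \<le> Suc ?n" by (rule order_trans[OF degree_mult_le]) simp
  have c: "coeff ([:-c, 1:] * q) i = coeff (pCons 0 q) i - c * coeff q i" for i by simp
  have "poly_act U ([:-c, 1:] * q) x
      = (\<Sum>i\<le>Suc ?n. coeff (pCons 0 q) i *s (U ^^ i) x) - c *s (\<Sum>i\<le>Suc ?n. coeff q i *s (U ^^ i) x)"
    unfolding poly_act_upto[OF d] c vec.scale_left_diff_distrib sum_subtractf vec.scale_sum_right
    by (simp only: vec.scale_scale)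
  also have "(\<Sum>i\<le>Suc ?n. coeff q i *s (U ^^ i) x) = poly_act U q x"
    by (rule poly_act_upto[symmetric]) simp
  also have "(\<Sum>i\<le>Suc ?n. coeff (pCons 0 q) i *s (U ^^ i) x) = (\<Sum>i\<le>?n. coeff q i *s (U ^^ Suc i) x)"
    by (subst sum.atMost_Suc_shift) simp
  also have "\<dots> = U (poly_act U q x)"
    unfolding poly_act_def clinear_simps(5)[OF assms] by (simp add: clinear_simps(2)[OF assms])
  finally show ?thesis .
qed

text \<open>The vectors \<open>x, U x, ..., U^k x\<close> cannot be independent.\<close>
lemma annihilating_poly:
  assumes "clinear (U :: complex ^ 'k::finite \<Rightarrow> complex ^ 'k)"
  shows "\<exists>p. p \<noteq> 0 \<and> poly_act U p x = 0"
proof (rule ccontr)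
  assume neg: "\<not> ?thesis"
  let ?n = "CARD('k)" and ?f = "\<lambda>i. (U ^^ i) x"
  have inj: "inj_on ?f {..?n}"
  proof (rule inj_onI, rule ccontr)
    fix i j assume ij: "?f i = ?f j" "i \<noteq> j"
    let ?p = "monom (1::complex) i - monom 1 j"
    have "coeff ?p i \<noteq> 0" using ij by simp
    hence "?p \<noteq> 0" by (metis coeff_0)
    moreover have "poly_act U ?p x = (\<Sum>l\<le>max i j. coeff ?p l *s ?f l)"
      by (rule poly_act_upto) (rule degree_diff_le; simp add: degree_monom_eq)
    moreover have "\<dots> = (\<Sum>l\<le>max i j. (if l = i then ?f i else 0) - (if l = j then ?f j else 0))"
      by (intro sum.cong refl) (auto simp: vec.scale_left_diff_distrib)
    ultimately have "?p \<noteq> 0 \<and> poly_act U ?p x = 0" using ij by (simp add: sum_subtractf)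
    thus False using neg by blast
  qed
  have "vec.independent (?f ` {..?n})"
  proof (rule ccontr)
    assume "\<not> vec.independent (?f ` {..?n})"
    then obtain u where u: "\<exists>v\<in>?f ` {..?n}. u v \<noteq> 0" "(\<Sum>v\<in>?f ` {..?n}. u v *s v) = 0"
      using vec.dependent_finite[of "?f ` {..?n}"] by auto
    define p where "p = (\<Sum>i\<le>?n. monom (u (?f i)) i)"
    have c: "coeff p i = (if i \<le> ?n then u (?f i) else 0)" for i
      by (simp add: p_def coeff_sum)
    have "degree p \<le> ?n" by (intro degree_le) (simp add: c)
    hence "poly_act U p x = (\<Sum>i\<le>?n. u (?f i) *s ?f i)" by (simp add: poly_act_upto c)
    also have "\<dots> = 0" using u(2) by (simp add: sum.reindex[OF inj])
    finally have "poly_act U p x = 0" .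
    moreover have "p \<noteq> 0"
    proof -
      obtain i where "i \<le> ?n" "u (?f i) \<noteq> 0" using u(1) by auto
      hence "coeff p i \<noteq> 0" by (simp add: c)
      thus ?thesis by auto
    qed
    ultimately show False using neg by blast
  qed
  from vec.independent_card_le_dim[OF subset_UNIV this] inj
  show False unfolding vec_dim_card by (simp add: card_image)
qed

text \<open>Take a polynomial of least degree that annihilates a nonzero \<open>x\<close> in \<open>E\<close> and split off
  a linear factor \<open>t - c\<close>.  The remaining factor applied to \<open>x\<close> is nonzero by minimality and
  is an eigenvector for \<open>c\<close>.\<close>
lemma eigenvector_exists:
  assumes U: "clinear (U :: complex ^ 'k::finite \<Rightarrow> complex ^ 'k)"
    and E: "vec.subspace E" "E \<noteq> {0}" "\<And>x. x \<in> E \<Longrightarrow> U x \<in> E"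
  obtains c x where "x \<in> E" "x \<noteq> 0" "U x = c *s x"
proof -
  obtain x where x: "x \<in> E" "x \<noteq> 0" using E(1,2) vec.subspace_0 by blast
  define P where "P n = (\<exists>p. p \<noteq> 0 \<and> poly_act U p x = 0 \<and> degree p = n)" for n
  have "\<exists>n. P n" using annihilating_poly[OF U] unfolding P_def by blast
  from LeastI_ex[OF this] obtain p where p: "p \<noteq> 0" "poly_act U p x = 0" "degree p = (LEAST n. P n)"
    unfolding P_def[of "LEAST n. P n"] by blast
  have minimal: "poly_act U q x \<noteq> 0" if "q \<noteq> 0" "degree q < degree p" for q
    using not_less_Least[of "degree q" P] that p(3) unfolding P_def[of "degree q"] by auto
  have "degree p \<noteq> 0"
  proof
    assume "degree p = 0"
    then obtain a where "p = [:a:]" by (rule degree_eq_zeroE)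
    thus False using p(1,2) x(2) by (simp add: poly_act_def)
  qed
  hence "\<not> constant (poly p)" by (simp add: constant_degree)
  then obtain c where "poly p c = 0" using fundamental_theorem_of_algebra by blast
  then obtain q where q: "p = [:-c, 1:] * q" by (meson dvdE poly_eq_0_iff_dvd)
  hence q0: "q \<noteq> 0" using p(1) by auto
  have "degree p = Suc (degree q)" unfolding q by (subst degree_mult_eq) (use q0 in auto)
  hence y: "poly_act U q x \<noteq> 0" using minimal[OF q0] by simp
  have pw: "(U ^^ i) x \<in> E" for i by (induction i) (auto simp: x E(3))
  have "poly_act U q x \<in> E"
    unfolding poly_act_def using pw by (intro vec.subspace_sum[OF E(1)] vec.subspace_scale[OF E(1)])
  moreover have "U (poly_act U q x) = c *s poly_act U q x"
    using p(2) poly_act_linear_factor[OF U, of c q x] unfolding q by simp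
  ultimately show ?thesis using y that by blast
qed

section \<open>Orthogonal projectors\<close>

lemma inner_cinner: "inner x y = Re (cinner x (y :: complex ^ 'k::finite))"
  by (simp add: inner_vec_def cinner_def inner_complex_def)

lemma real_subspace: "vec.subspace F \<Longrightarrow> subspace (F :: (complex ^ 'k::finite) set)"
proof -
  have "r *\<^sub>R x = of_real r *s x" for r and x :: "complex ^ 'k"
    by (simp add: vec_eq_iff scaleR_conv_of_real[where 'a=complex])
  thus "vec.subspace F \<Longrightarrow> subspace F" unfolding vec.subspace_def subspace_def by simp
qed

text \<open>A complex subspace contains \<open>\<i> w\<close> along with \<open>w\<close>; so a vector that is orthogonal to it
  for the real inner product is orthogonal for the Hermitian one.\<close>
lemma orthogonal_decomposition:
  assumes F: "vec.subspace F"
  shows "\<exists>y\<in>F. \<forall>w\<in>F. cinner w (x - y) = 0"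
proof -
  obtain y z where yz: "y \<in> span F" "\<And>w. w \<in> span F \<Longrightarrow> orthogonal z w" "x = y + z"
    using orthogonal_subspace_decomp_exists[of F x] by blast
  have sp: "span F = F" by (rule span_eq_iff[THEN iffD2, OF real_subspace[OF F]])
  have re: "Re (cinner w z) = 0" if "w \<in> F" for w
    using yz(2)[of w] that sp unfolding orthogonal_def by (simp add: inner_cinner[symmetric] inner_commute)
  have "cinner w (x - y) = 0" if "w \<in> F" for w
  proof -
    have "Re (cinner (\<i> *s w) z) = 0" by (intro re vec.subspace_scale[OF F] that)
    thus ?thesis using re[OF that] yz(3) by (simp add: cinner_scale_left complex_eq_iff)
  qed
  thus ?thesis using yz(1) sp by blast
qed

lemma cinner_self_eq_0: "cinner x x = 0 \<longleftrightarrow> x = 0"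
  by (simp add: cinner_self)

text \<open>The definition by \<open>THE\<close> requires existence and uniqueness of the projector, which both
  follow from unique orthogonal decompositions.\<close>
lemma projector_onto_fix:
  assumes F: "vec.subspace F" and x: "x \<in> F"
  shows "projector_onto F *v x = (x :: complex ^ 'k::finite)"
proof -
  obtain p where p: "\<And>x. p x \<in> F" "\<And>x w. w \<in> F \<Longrightarrow> cinner w (x - p x) = 0"
    using orthogonal_decomposition[OF F] by metis
  have uniq: "y = p x" if "y \<in> F" "\<And>w. w \<in> F \<Longrightarrow> cinner w (x - y) = 0" for x y
  proof -
    have d: "y - p x \<in> F" by (intro vec.subspace_diff[OF F] that p)
    have "cinner (y - p x) (y - p x) = cinner (y - p x) (x - p x) - cinner (y - p x) (x - y)"
      by (simp add: cinner_simps)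
    also have "\<dots> = 0" using that(2)[OF d] p(2)[OF d] by simp
    finally show ?thesis by (simp add: cinner_self_eq_0)
  qed
  have lin: "clinear p"
  proof -
    have "p x + p y = p (x + y)" for x y
    proof (rule uniq)
      fix w assume w: "w \<in> F"
      show "cinner w (x + y - (p x + p y)) = 0"
        using p(2)[OF w, of x] p(2)[OF w, of y] by (simp add: cinner_simps)
    qed (intro vec.subspace_add[OF F] p)
    moreover have "c *s p x = p (c *s x)" for c x
    proof (rule uniq)
      fix w assume w: "w \<in> F"
      show "cinner w (c *s x - c *s p x) = 0"
        using p(2)[OF w, of x] by (simp add: cinner_simps)
    qed (intro vec.subspace_scale[OF F] p)
    ultimately show ?thesis
      unfolding Vector_Spaces.linear_iff by (simp add: vec.vector_space_axioms)
  qed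
  define P where "P = matrix p"
  have P: "P *v x = p x" for x unfolding P_def by (rule matrix_works[OF lin])
  have pF: "p x = x" if "x \<in> F" for x using uniq[of x x] that by simp
  have sym: "cinner (p x) y = cinner (p x) (p y)" "cinner x (p y) = cinner (p x) (p y)" for x y
    using p(2)[OF p(1)[of x], of y] p(2)[OF p(1)[of y], of x] cinner_commute[of x "p y"] cinner_commute[of "p x" "p y"]
    by (auto simp: cinner_simps)
  have "ctrans P *v x = P *v x" for x
  proof -
    have "cinner (ctrans P *v x - P *v x) y = 0" for y
      unfolding cinner_diff_left cinner_ctrans P using sym[of x y] by simp
    thus ?thesis using cinner_self_eq_0[of "ctrans P *v x - P *v x"] by simp
  qed
  hence "ctrans P = P" by (simp add: matrix_eq)
  moreover have "P ** P = P" by (simp add: matrix_eq matrix_vector_mul_assoc[symmetric] P pF[OF p(1)])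
  moreover have "range ((*v) P) = F" unfolding P using p(1) pF by (metis image_subset_iff rangeI subset_antisym subsetI)
  ultimately have ex: "orthogonal_projector P \<and> range ((*v) P) = F" by (simp add: orthogonal_projector_def)
  have all: "P' *v x = p x" if P': "orthogonal_projector P' \<and> range ((*v) P') = F" for P' x
  proof (rule uniq)
    show "P' *v x \<in> F" using P' by blast
    fix w assume "w \<in> F"
    then obtain u where u: "w = P' *v u" using P' by blast
    have "cinner w (x - P' *v x) = cinner (ctrans P' *v u) (x - P' *v x)" using P' u by (simp add: orthogonal_projector_def)
    also have "\<dots> = cinner u (P' *v x - (P' ** P') *v x)"
      unfolding cinner_ctrans by (simp add: matrix_vector_mult_diff_distrib matrix_vector_mul_assoc)
    finally show "cinner w (x - P' *v x) = 0" using P' by (simp add: orthogonal_projector_def)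
  qed
  have "projector_onto F = P"
    unfolding projector_onto_def
  proof (rule the_equality[where a=P])
    fix P' assume "orthogonal_projector P' \<and> range ((*v) P') = F"
    from all[OF this] show "P' = P" by (simp add: matrix_eq P)
  qed (rule ex)
  thus ?thesis using P pF[OF x] by simp
qed

section \<open>Invariant subspaces and peripheral eigenmatrices\<close>

lemma minimal_invariant_below:
  assumes "invariant_subspace Q F" "F \<noteq> {0}"
  shows "\<exists>G\<subseteq>F. minimal_invariant Q G"
  using assms
proof (induction "vec.dim F" arbitrary: F rule: less_induct)
  case less
  show ?case
  proof (cases "minimal_invariant Q F")
    case False
    then obtain F' where F': "invariant_subspace Q F'" "F' \<noteq> {0}" "F' \<subseteq> F" "F' \<noteq> F"
      using less.prems unfolding minimal_invariant_def by blast
    have "vec.span F' = F'" "vec.span F = F"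
      using F'(1) less.prems(1) unfolding invariant_subspace_def by (simp_all add: vec.span_eq_iff)
    hence "vec.span F' \<subset> vec.span F" using F'(3,4) by (simp only:)
    hence "vec.dim F' < vec.dim F" by (rule vec.dim_psubset)
    from less.hyps[OF this F'(1,2)] F'(3) show ?thesis by blast
  qed (use less.prems in blast)
qed

lemma power_eq_imp_diff:
  assumes "z \<noteq> 0" "i < j" "z ^ i = z ^ j" shows "z ^ (j - i) = (1 :: complex)"
proof -
  have "z ^ j = z ^ i * z ^ (j - i)" using assms(2) by (simp add: power_add[symmetric])
  thus ?thesis using assms(1,3) by simp
qed

locale ergodic_kraus = kraus_prob Q for Q :: "(complex ^ 'k::finite ^ 'k) measure" +
  assumes erg: "Erg Q"
begin

abbreviation E :: "(complex ^ 'k) set" where "E \<equiv> erg_space Q"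

lemma minimal_E: "minimal_invariant Q E"
  using erg unfolding Erg_def erg_space_def by (rule theI')

lemma E_props: "vec.subspace E" "E \<noteq> {0}" "invariant_subspace Q E" "AE v in Q. \<forall>x\<in>E. v *v x \<in> E"
  using minimal_E unfolding minimal_invariant_def invariant_subspace_def by (auto simp: image_subset_iff)

lemma E_subset: assumes "invariant_subspace Q F" "F \<noteq> {0}" shows "E \<subseteq> F"
proof -
  obtain G where "G \<subseteq> F" "minimal_invariant Q G" using minimal_invariant_below[OF assms] by blast
  moreover from this(2) have "G = E" using erg minimal_E unfolding Erg_def by blast
  ultimately show ?thesis by simp
qed

text \<open>A linear condition holds on a subspace as soon as it holds on a finite basis; this
  makes the exceptional null set independent of the vector.\<close>
lemma AE_on_subspace:
  assumes S: "vec.subspace S" and P: "\<And>v. vec.subspace {x. P v x}"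
    and ae: "\<And>x. x \<in> S \<Longrightarrow> AE v in Q. P v x"
  shows "AE v in Q. \<forall>x\<in>S. P v x"
proof -
  obtain B where B: "B \<subseteq> S" "vec.independent B" "S \<subseteq> vec.span B"
    by (rule vec.basis_exists[of S])
  have "AE v in Q. \<forall>x\<in>B. P v x"
    using vec.finiteI_independent[OF B(2)] B(1) ae by (intro AE_finite_allI) auto
  thus ?thesis
  proof eventually_elim
    case (elim v)
    hence "vec.span B \<subseteq> {x. P v x}" by (intro vec.span_minimal P) auto
    thus ?case using B(3) by blast
  qed
qed

lemma subspace_preimage: "vec.subspace T \<Longrightarrow> vec.subspace {x. (v :: complex ^ 'k ^ 'k) *v x \<in> T}"
  unfolding vec.subspace_def by (simp add: matrix_vector_right_distrib matrix_vector_scaleC)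

lemma invariant_subspaceI:
  assumes "vec.subspace S" "\<And>x. x \<in> S \<Longrightarrow> AE v in Q. v *v x \<in> S"
  shows "invariant_subspace Q S"
  using AE_on_subspace[of S "\<lambda>v x. v *v x \<in> S"] assms subspace_preimage
  unfolding invariant_subspace_def by (auto simp: image_subset_iff)

lemma AE_zero_imp: assumes "AE v in Q. v *v x = 0" shows "x = 0"
proof -
  have "(LINT v|Q. (norm (v *v x))\<^sup>2) = (LINT v|Q. 0)"
    by (rule integral_cong_AE) (use assms in \<open>auto intro!: measurable_Q borel_measurable_continuous_onI continuous_intros\<close>)
  thus ?thesis by (simp add: unital)
qed

end

text \<open>By the parallelogram law, equality at \<open>x\<close> and \<open>y\<close> forces equality at \<open>x + y\<close> and
  \<open>x - y\<close>.\<close>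
lemma top_space_subspace:
  fixes A :: "complex ^ 'k::finite ^ 'k"
  assumes "\<And>x. norm (A *v x) \<le> c * norm x" "0 \<le> c"
  shows "vec.subspace {x. norm (A *v x) = c * norm x}"
  unfolding vec.subspace_def
proof (intro conjI ballI allI; simp)
  fix x y assume xy: "norm (A *v x) = c * norm x" "norm (A *v y) = c * norm y"
  have par: "(norm (a + b))\<^sup>2 + (norm (a - b))\<^sup>2 = 2 * (norm a)\<^sup>2 + 2 * (norm b)\<^sup>2" for a b :: "complex ^ 'k"
    by (simp add: norm_add_sq norm_diff_sq)
  have sq: "(norm (A *v w))\<^sup>2 \<le> c\<^sup>2 * (norm w)\<^sup>2" for w
    using power_mono[OF assms(1)[of w], of 2] by (simp add: power_mult_distrib)
  have "(norm (A *v (x + y)))\<^sup>2 + (norm (A *v (x - y)))\<^sup>2 = c\<^sup>2 * (norm (x + y))\<^sup>2 + c\<^sup>2 * (norm (x - y))\<^sup>2"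
    unfolding distrib_left[symmetric] par
    using par[of "A *v x" "A *v y"] xy
    by (simp add: matrix_vector_right_distrib matrix_vector_mult_diff_distrib power_mult_distrib algebra_simps)
  hence "(norm (A *v (x + y)))\<^sup>2 = (c * norm (x + y))\<^sup>2" using sq[of "x + y"] sq[of "x - y"] by (simp add: power_mult_distrib)
  thus "norm (A *v (x + y)) = c * norm (x + y)" using assms(2) by (simp add: power2_eq_iff_nonneg)
next
  fix a x assume "norm (A *v x) = c * norm x"
  thus "norm (A *v (a *s x)) = c * norm (a *s x)" by (simp add: matrix_vector_scaleC norm_smult)
qed

context ergodic_kraus begin

text \<open>Restricted to \<open>E\<close>, such a map is a positive multiple of a unitary that commutes with
  almost every \<open>v\<close> up to the factor \<open>z\<close>.  In contrast to eigenmatrices of the quantum map,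
  these maps are closed under composition.\<close>
definition intertwiner :: "(complex ^ 'k \<Rightarrow> complex ^ 'k) \<Rightarrow> complex \<Rightarrow> bool" where
  "intertwiner U z \<longleftrightarrow> clinear U \<and> (\<exists>c>0. \<forall>x\<in>E. U x \<in> E \<and> norm (U x) = c * norm x) \<and>
     (AE v in Q. \<forall>x\<in>E. U (v *v x) = z *s (v *v U x))"

text \<open>Let \<open>c\<close> be the norm of \<open>A\<close> and \<open>|A y| = c |y|\<close>.  The eigenvalue equation and \<open>|z| = 1\<close>
  give \<open>\<integral>|A v y - z v A y|^2 = \<integral>|A v y|^2 - |A y|^2\<close>, and the right side is at most
  \<open>c^2 \<integral>|v y|^2 - c^2 |y|^2 = 0\<close>.  Hence almost surely \<open>A v y = z v A y\<close> and
  \<open>|A v y| = c |v y|\<close>.  So the vectors where \<open>A\<close> attains its norm form an invariant subspace,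
  and by the commutation relation the image of \<open>E\<close> is invariant, too.\<close>
lemma peripheral_intertwiner:
  assumes A: "quantum_map Q A = cscale z A" "A \<noteq> 0" and z: "cmod z = 1"
  shows "intertwiner ((*v) A) z"
proof -
  have "continuous_on (sphere 0 1) (\<lambda>x. norm (A *v x))" by (intro continuous_intros)
  moreover have "sphere (0 :: complex ^ 'k) 1 \<noteq> {}"
  proof -
    have "axis undefined 1 \<in> sphere (0 :: complex ^ 'k) 1" by simp
    thus ?thesis by blast
  qed
  ultimately obtain x0 where x0: "norm x0 = 1" "\<And>y. norm y = 1 \<Longrightarrow> norm (A *v y) \<le> norm (A *v x0)"
    using continuous_attains_sup[of "sphere (0 :: complex ^ 'k) 1" "\<lambda>x. norm (A *v x)"] by auto
  define c where "c = norm (A *v x0)"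
  have le: "norm (A *v x) \<le> c * norm x" for x
  proof (cases "x = 0")
    case False
    let ?y = "of_real (1 / norm x) *s x"
    have "norm ?y = 1" using False by (simp add: norm_smult norm_divide)
    from x0(2)[OF this] show ?thesis using False
      by (simp add: matrix_vector_scaleC norm_smult norm_divide c_def divide_le_eq)
  qed simp
  have "c \<noteq> 0"
  proof
    assume "c = 0"
    hence "A *v x = 0 *v x" for x using le[of x] by simp
    hence "A = 0" by (simp only: matrix_eq) blast
    thus False using A(2) by blast
  qed
  hence c: "0 < c" by (simp add: c_def)
  let ?S = "{x. norm (A *v x) = c * norm x}"
  have S: "vec.subspace ?S" using top_space_subspace[OF le] c by simp
  have key: "AE v in Q. A *v (v *v y) = z *s (v *v (A *v y)) \<and> norm (A *v (v *v y)) = c * norm (v *v y)"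
    if y: "y \<in> ?S" for y
  proof -
    (* D is the failure of commutation and H that of |A v y| = c |v y|.  Both are nonnegative,
       and the integral of their sum vanishes. *)
    let ?D = "\<lambda>v. (norm (A *v (v *v y) - z *s (v *v (A *v y))))\<^sup>2"
    let ?H = "\<lambda>v. c\<^sup>2 * (norm (v *v y))\<^sup>2 - (norm (A *v (v *v y)))\<^sup>2"
    have H0: "0 \<le> ?H v" for v
      using power_mono[OF le[of "v *v y"], of 2] by (simp add: power_mult_distrib)
    have "(LINT v|Q. cinner (A *v (v *v y)) (v *v (A *v y))) = (LINT v|Q. cnj (cinner (v *v (A *v y)) (A *v (v *v y))))"
      by (simp only: cinner_commute[symmetric])
    also have "\<dots> = cnj (cinner (A *v y) (quantum_map Q A *v y))"
      unfolding cinner_quantum_map by (rule Bochner_Integration.integral_cnj)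
    also have "\<dots> = cnj z * of_real ((norm (A *v y))\<^sup>2)"
      unfolding A(1) cscale_vector cinner_scale_right cinner_self by simp
    finally have i1: "(LINT v|Q. cinner (A *v (v *v y)) (v *v (A *v y))) = cnj z * of_real ((norm (A *v y))\<^sup>2)" .
    have "(LINT v|Q. Re (z * cinner (A *v (v *v y)) (v *v (A *v y)))) = Re (LINT v|Q. z * cinner (A *v (v *v y)) (v *v (A *v y)))"
      by (rule integral_Re) (intro integrable_continuous continuous_intros)
    also have "\<dots> = Re ((z * cnj z) * of_real ((norm (A *v y))\<^sup>2))"
      using i1 by (simp add: mult.assoc)
    also have "z * cnj z = 1" using z by (simp add: complex_norm_square[symmetric])
    finally have i2: "(LINT v|Q. Re (z * cinner (A *v (v *v y)) (v *v (A *v y)))) = (norm (A *v y))\<^sup>2" by simp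
    have "?D v + ?H v = c\<^sup>2 * (norm (v *v y))\<^sup>2 - 2 * Re (z * cinner (A *v (v *v y)) (v *v (A *v y))) + (norm (v *v (A *v y)))\<^sup>2" for v
      by (simp add: norm_diff_sq cinner_scale_right norm_smult z)
    hence "(LINT v|Q. ?D v + ?H v) = c\<^sup>2 * (LINT v|Q. (norm (v *v y))\<^sup>2)
        - 2 * (LINT v|Q. Re (z * cinner (A *v (v *v y)) (v *v (A *v y)))) + (LINT v|Q. (norm (v *v (A *v y)))\<^sup>2)"
      by (simp only:) (subst Bochner_Integration.integral_add Bochner_Integration.integral_diff,
         (intro integrable_continuous continuous_intros)+, simp)+
    also have "\<dots> = 0"
      unfolding unital i2 using y by (simp add: power_mult_distrib)
    finally have int: "(LINT v|Q. ?D v + ?H v) = 0" .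
    have "integrable Q (\<lambda>v. ?D v + ?H v)" by (intro integrable_continuous continuous_intros)
    from integral_nonneg_eq_0_iff_AE[OF this] int H0
    have "AE v in Q. ?D v + ?H v = 0" by (simp add: add_nonneg_nonneg)
    thus ?thesis
    proof eventually_elim
      case (elim v)
      hence "?D v = 0" "?H v = 0" using H0[of v] zero_le_power2[of "norm (A *v (v *v y) - z *s (v *v (A *v y)))"] by linarith+
      thus ?case using c by (simp add: power_mult_distrib[symmetric] power2_eq_iff_nonneg)
    qed
  qed
  have "invariant_subspace Q ?S"
    by (intro invariant_subspaceI S) (use key in \<open>auto elim: eventually_mono\<close>)
  moreover have "x0 \<in> ?S" "x0 \<noteq> 0" using x0(1) by (auto simp: c_def)
  hence "?S \<noteq> {0}" by blast
  ultimately have ES: "E \<subseteq> ?S" by (rule E_subset)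
  have comm: "AE v in Q. \<forall>x\<in>E. A *v (v *v x) = z *s (v *v (A *v x))"
  proof (rule AE_on_subspace[OF E_props(1)])
    show "vec.subspace {x. A *v (v *v x) = z *s (v *v (A *v x))}" for v
      unfolding vec.subspace_def by (simp add: matrix_vector_right_distrib matrix_vector_scaleC vec.scale_right_distrib mult.commute)
    show "AE v in Q. A *v (v *v x) = z *s (v *v (A *v x))" if "x \<in> E" for x
      using key[of x] ES that by (auto elim: eventually_mono)
  qed
  (* Since v A x = A (z^(-1) v x), the image of E under A is invariant. *)
  let ?F = "(*v) A ` E"
  have F: "vec.subspace ?F" by (rule vec.subspace_image) (use clinear_matrix E_props in auto)
  have zi: "z \<noteq> 0" using z by auto
  have "AE v in Q. (*v) v ` ?F \<subseteq> ?F"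
    using comm E_props(4)
  proof eventually_elim
    case (elim v)
    show ?case
    proof (intro image_subsetI)
      fix w assume "w \<in> ?F"
      then obtain x where x: "x \<in> E" "w = A *v x" by blast
      have "v *v w = A *v (inverse z *s (v *v x))"
        using elim(1)[rule_format, OF x(1)] zi x(2) by (simp add: matrix_vector_scaleC)
      moreover have "inverse z *s (v *v x) \<in> E" using elim(2) x(1) by (intro vec.subspace_scale[OF E_props(1)]) auto
      ultimately show "v *v w \<in> ?F" by blast
    qed
  qed
  hence "invariant_subspace Q ?F" using F by (simp add: invariant_subspace_def)
  moreover have "?F \<noteq> {0}"
  proof -
    obtain x where x: "x \<in> E" "x \<noteq> 0" using E_props(1,2) vec.subspace_0 by blast
    hence "A *v x \<noteq> 0" using ES c by auto
    thus ?thesis using x(1) by blast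
  qed
  ultimately have "E \<subseteq> ?F" by (rule E_subset)
  moreover have "vec.dim ?F \<le> vec.dim E" by (rule vec.dim_image_le[OF clinear_matrix])
  ultimately have FE: "E = ?F" by (intro vec.subspace_dim_equal E_props(1) F) auto
  show ?thesis unfolding intertwiner_def
    using clinear_matrix c ES FE comm by blast
qed

text \<open>Otherwise the matrix would be a nonzero multiple of an isometry on \<open>E\<close>.  This is how
  an eigenmatrix is determined by its restriction to \<open>E\<close>.\<close>
lemma peripheral_zero:
  assumes A: "quantum_map Q A = cscale z A" and z: "cmod z = 1" and "\<And>x. x \<in> E \<Longrightarrow> A *v x = 0"
  shows "A = 0"
proof (rule ccontr)
  assume "A \<noteq> 0"
  then obtain c where "c > 0" "\<forall>x\<in>E. norm (A *v x) = c * norm x"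
    using peripheral_intertwiner[OF A _ z] unfolding intertwiner_def by blast
  hence "x = 0" if "x \<in> E" for x using assms(3)[OF that] that by force
  thus False using E_props(1,2) vec.subspace_0 by blast
qed

lemma intertwiner_compose:
  assumes "intertwiner U a" "intertwiner V b" shows "intertwiner (U \<circ> V) (a * b)"
proof -
  obtain c where c: "c > 0" "\<And>x. x \<in> E \<Longrightarrow> U x \<in> E \<and> norm (U x) = c * norm x"
    using assms(1) unfolding intertwiner_def by blast
  obtain d where d: "d > 0" "\<And>x. x \<in> E \<Longrightarrow> V x \<in> E \<and> norm (V x) = d * norm x"
    using assms(2) unfolding intertwiner_def by blast
  have U: "clinear U" and V: "clinear V" using assms unfolding intertwiner_def by blast+
  have "AE v in Q. \<forall>x\<in>E. U (v *v x) = a *s (v *v U x)" "AE v in Q. \<forall>x\<in>E. V (v *v x) = b *s (v *v V x)"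
    using assms unfolding intertwiner_def by blast+
  hence "AE v in Q. \<forall>x\<in>E. (U \<circ> V) (v *v x) = (a * b) *s (v *v (U \<circ> V) x)"
  proof eventually_elim
    case (elim v)
    show ?case using elim d(2) by (simp add: clinear_simps(2)[OF U] mult.commute)
  qed
  moreover have "clinear (U \<circ> V)" by (rule Vector_Spaces.linear_compose[OF V U])
  moreover have "\<exists>e>0. \<forall>x\<in>E. (U \<circ> V) x \<in> E \<and> norm ((U \<circ> V) x) = e * norm x"
    using c d by (intro exI[of _ "c * d"]) auto
  ultimately show ?thesis unfolding intertwiner_def by blast
qed

lemma intertwiner_funpow: "intertwiner U a \<Longrightarrow> intertwiner (U ^^ n) (a ^ n)"
proof (induction n)
  case 0
  show ?case unfolding intertwiner_def
    by (simp add: id_def vec.linear_ident) (auto intro: exI[of _ 1])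
next
  case (Suc n)
  thus ?case using intertwiner_compose[of U a "U ^^ n" "a ^ n"] by (simp only: funpow.simps power_Suc)
qed

definition eigenspace :: "(complex ^ 'k \<Rightarrow> complex ^ 'k) \<Rightarrow> complex \<Rightarrow> (complex ^ 'k) set" where
  "eigenspace U a = {x \<in> E. U x = a *s x}"

lemma subspace_eigenspace: "clinear U \<Longrightarrow> vec.subspace (eigenspace U a)"
  using E_props(1) unfolding vec.subspace_def eigenspace_def
  by (simp add: clinear_simps vec.scale_right_distrib mult.commute)

lemma eigenspace_shift:
  assumes "intertwiner U z"
  shows "AE v in Q. \<forall>a. (*v) v ` eigenspace U a \<subseteq> eigenspace U (z * a)"
proof -
  have "AE v in Q. \<forall>x\<in>E. U (v *v x) = z *s (v *v U x)" using assms unfolding intertwiner_def by blast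
  with E_props(4) show ?thesis
  proof eventually_elim
    case (elim v)
    thus ?case by (auto simp: eigenspace_def matrix_vector_scaleC)
  qed
qed

lemma eigenspace_shift_nonzero:
  assumes "intertwiner U z" "eigenspace U a \<noteq> {0}"
  shows "eigenspace U (z * a) \<noteq> {0}"
proof
  assume z: "eigenspace U (z * a) = {0}"
  have U: "clinear U" using assms(1) unfolding intertwiner_def by blast
  have "x = 0" if "x \<in> eigenspace U a" for x
  proof (rule AE_zero_imp)
    show "AE v in Q. v *v x = 0"
      using eigenspace_shift[OF assms(1)] z that by (auto elim!: eventually_mono)
  qed
  thus False using assms(2) vec.subspace_0[OF subspace_eigenspace[OF U, of a]] by blast
qed

lemma isometry_cinner:
  assumes U: "clinear U" "\<And>x. x \<in> E \<Longrightarrow> norm (U x) = c * norm x" and xy: "x \<in> E" "y \<in> E"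
  shows "cinner (U x) (U y) = of_real (c\<^sup>2) * cinner x y"
proof -
  have re: "Re (cinner (U x) (U y)) = c\<^sup>2 * Re (cinner x y)" if "x \<in> E" "y \<in> E" for x y
  proof -
    have "(norm (U (x + y)))\<^sup>2 = (c * norm (x + y))\<^sup>2" using U(2)[of "x + y"] vec.subspace_add[OF E_props(1)] that by simp
    thus ?thesis
      unfolding clinear_simps[OF U(1)] power_mult_distrib norm_add_sq by (simp add: U(2) that power_mult_distrib algebra_simps)
  qed
  have "Re (cinner (U (\<i> *s x)) (U y)) = c\<^sup>2 * Re (cinner (\<i> *s x) y)"
    by (intro re vec.subspace_scale[OF E_props(1)] xy)
  with re[OF xy] show ?thesis
    by (simp add: complex_eq_iff clinear_simps[OF U(1)] cinner_scale_left)
qed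

text \<open>Eigenspaces of a multiple of a unitary.\<close>
lemma eigenspace_orthogonal:
  assumes "intertwiner U z" "a \<noteq> b" "x \<in> eigenspace U a" "y \<in> eigenspace U b"
  shows "cinner x y = 0"
proof (cases "x = 0")
  case False
  obtain c where c: "c > 0" "\<And>x. x \<in> E \<Longrightarrow> norm (U x) = c * norm x" and U: "clinear U"
    using assms(1) unfolding intertwiner_def by blast
  have e: "x \<in> E" "y \<in> E" "U x = a *s x" "U y = b *s y" using assms unfolding eigenspace_def by auto
  have a: "cmod a = c" using c(2)[OF e(1)] e(3) False by (simp add: norm_smult)
  have "cnj a * b * cinner x y = cinner (a *s x) (b *s y)" by (simp add: cinner_scale_left cinner_scale_right)
  also have "\<dots> = of_real (c\<^sup>2) * cinner x y"
    using isometry_cinner[OF U c(2) e(1,2)] unfolding e(3,4) .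
  also have "of_real (c\<^sup>2) = cnj a * a" using complex_norm_square[of a] by (simp add: a mult.commute)
  finally have "cnj a * ((b - a) * cinner x y) = 0" by (simp add: algebra_simps)
  moreover have "a \<noteq> 0" using a c(1) by auto
  ultimately show ?thesis using assms(2) by simp
qed simp

lemma eigenspace_exists:
  assumes "intertwiner U z" shows "\<exists>a. eigenspace U a \<noteq> {0}"
proof -
  have "clinear U" "\<And>x. x \<in> E \<Longrightarrow> U x \<in> E" using assms unfolding intertwiner_def by blast+
  from eigenvector_exists[OF this(1) E_props(1,2) this(2)] obtain a x where "x \<in> E" "x \<noteq> 0" "U x = a *s x" .
  hence "x \<in> eigenspace U a" "x \<noteq> 0" by (auto simp: eigenspace_def)
  thus ?thesis by blast
qed

lemma intertwiner_one:
  assumes "intertwiner U 1" shows "\<exists>a. \<forall>x\<in>E. U x = a *s x"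
proof -
  obtain a where a: "eigenspace U a \<noteq> {0}" using eigenspace_exists[OF assms] by blast
  have U: "clinear U" using assms unfolding intertwiner_def by blast
  have "invariant_subspace Q (eigenspace U a)"
    unfolding invariant_subspace_def using subspace_eigenspace[OF U] eigenspace_shift[OF assms]
    by (auto elim!: eventually_mono)
  from E_subset[OF this a] show ?thesis unfolding eigenspace_def by blast
qed

text \<open>Almost every \<open>v\<close> maps the eigenspace for \<open>a\<close> to that for \<open>z a\<close>, and no eigenspace is
  killed.  Starting from one eigenvalue \<open>a\<close>, all \<open>z^n a\<close> are eigenvalues.  Orthogonality
  leaves room for finitely many only, so \<open>z\<close> is a root of unity, and the orbit of eigenspaces
  spans an invariant subspace, which is \<open>E\<close>.\<close>
lemma intertwiner_cycle:
  assumes U: "intertwiner U z"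
  obtains l Es where "1 \<le> l" "z ^ l = 1" "\<And>i. 0 < i \<Longrightarrow> i < l \<Longrightarrow> z ^ i \<noteq> 1" "is_cycle Q l Es"
proof -
  obtain a where a: "eigenspace U a \<noteq> {0}" using eigenspace_exists[OF U] by blast
  have lin: "clinear U" using U unfolding intertwiner_def by blast
  obtain c where c: "c > 0" "\<And>x. x \<in> E \<Longrightarrow> norm (U x) = c * norm x" using U unfolding intertwiner_def by blast
  let ?L = "\<lambda>n. eigenspace U (z ^ n * a)"
  have nz: "?L n \<noteq> {0}" for n
  proof (induction n)
    case (Suc n)
    from eigenspace_shift_nonzero[OF U this] show ?case by (simp add: mult.assoc)
  qed (simp add: a)
  have "\<exists>x. x \<in> ?L n \<and> x \<noteq> 0" for n
    using nz[of n] vec.subspace_0[OF subspace_eigenspace[OF lin]] by blast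
  then obtain x where x: "\<And>n. x n \<in> ?L n" "\<And>n. x n \<noteq> 0" by metis
  have "cmod (z ^ n * a) = c" for n
    using x[of n] c(2)[of "x n"] by (auto simp: eigenspace_def norm_smult)
  from this[of 0] this[of 1] have a0: "a \<noteq> 0" and z1: "cmod z = 1" using c(1) by (auto simp: norm_mult)
  have z0: "z \<noteq> 0" using z1 by auto
  have "\<exists>n. 0 < n \<and> z ^ n = 1"
  proof (rule ccontr)
    assume no: "\<not> ?thesis"
    have dist: "z ^ i * a \<noteq> z ^ j * a" if "i \<noteq> j" for i j
    proof -
      have *: False if ij: "i < j" "z ^ i = z ^ j" for i j :: nat
      proof -
        have "z ^ (j - i) = 1" by (rule power_eq_imp_diff[OF z0 ij])
        moreover have "0 < j - i" using ij(1) by simp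
        ultimately show False using no by blast
      qed
      show ?thesis using *[of i j] *[of j i] that a0 by (metis mult_right_cancel nat_neq_iff)
    qed
    have orth: "cinner (x i) (x j) = 0" if "i \<noteq> j" for i j
      by (rule eigenspace_orthogonal[OF U dist[OF that] x(1) x(1)])
    have inj: "inj x"
    proof (rule injI, rule ccontr)
      fix i j assume "x i = x j" "i \<noteq> j"
      hence "cinner (x i) (x i) = 0" using orth[of i j] by simp
      thus False using x(2) cinner_self_eq_0 by blast
    qed
    have "independent (range x)"
    proof (rule pairwise_orthogonal_independent)
      show "pairwise orthogonal (range x)"
        using orth by (auto simp: pairwise_def orthogonal_def inner_cinner) (metis orth zero_complex.sel(1))
      show "0 \<notin> range x" using x(2) by (metis imageE)
    qed
    hence "finite (range x)" by (rule independent_imp_finite)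
    thus False using inj finite_imageD infinite_UNIV_nat by blast
  qed
  from LeastI_ex[OF this] have l: "0 < (LEAST n. 0 < n \<and> z ^ n = 1)" "z ^ (LEAST n. 0 < n \<and> z ^ n = 1) = 1" by auto
  define l where "l = (LEAST n. 0 < n \<and> z ^ n = 1)"
  have l: "1 \<le> l" "z ^ l = 1" using l by (simp_all add: l_def)
  have min: "z ^ i \<noteq> 1" if "0 < i" "i < l" for i using not_less_Least[of i "\<lambda>n. 0 < n \<and> z ^ n = 1"] that unfolding l_def by blast
  let ?V = "vec.span (\<Union>i\<in>{1..l}. ?L i)"
  have VE: "?V \<subseteq> E" by (rule vec.span_minimal[OF _ E_props(1)]) (auto simp: eigenspace_def)
  have sh: "AE v in Q. \<forall>i\<in>{1..l}. (*v) v ` ?L i \<subseteq> ?L (if i = l then 1 else i + 1)"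
    using eigenspace_shift[OF U]
  proof eventually_elim
    case (elim v)
    show ?case
    proof
      fix i assume "i \<in> {1..l}"
      have "z * (z ^ i * a) = z ^ (if i = l then 1 else i + 1) * a"
        using l(2) by (auto simp: mult.assoc)
      thus "(*v) v ` ?L i \<subseteq> ?L (if i = l then 1 else i + 1)"
        using elim[rule_format, of "z ^ i * a"] by (simp only:)
    qed
  qed
  have "AE v in Q. (*v) v ` ?V \<subseteq> ?V"
    using sh
  proof eventually_elim
    case (elim v)
    have "?V \<subseteq> {x. v *v x \<in> ?V}"
    proof (rule vec.span_minimal[OF _ subspace_preimage[OF vec.subspace_span]], rule UN_least, rule subsetI)
      fix i y assume i: "i \<in> {1..l}" and y: "y \<in> ?L i"
      have "v *v y \<in> ?L (if i = l then 1 else i + 1)" using elim i y by blast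
      moreover have "(if i = l then 1 else i + 1) \<in> {1..l}" using i by auto
      ultimately show "y \<in> {x. v *v x \<in> ?V}" by (intro CollectI vec.span_base UN_I)
    qed
    thus ?case by blast
  qed
  hence "invariant_subspace Q ?V" by (simp add: invariant_subspace_def)
  moreover have "x 1 \<in> ?V" using x(1)[of 1] l(1) by (intro vec.span_base UN_I[of 1]) auto
  hence "?V \<noteq> {0}" using x(2) by blast
  ultimately have V: "?V = E" using E_subset VE by blast
  have "is_cycle Q l ?L"
    unfolding is_cycle_def
  proof (intro conjI ballI impI)
    fix i j x y assume ij: "i \<in> {1..l}" "j \<in> {1..l}" "i \<noteq> j" and xy: "x \<in> ?L i" "y \<in> ?L j"
    have *: False if h: "i < j" "z ^ i = z ^ j" "i \<in> {1..l}" "j \<in> {1..l}" for i j :: nat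
    proof -
      have "z ^ (j - i) = 1" by (rule power_eq_imp_diff[OF z0 h(1,2)])
      moreover have "0 < j - i" "j - i < l" using h by auto
      ultimately show False using min by blast
    qed
    have "z ^ i * a \<noteq> z ^ j * a" using *[of i j] *[of j i] ij a0 by (metis mult_right_cancel nat_neq_iff)
    from eigenspace_orthogonal[OF U this xy] show "cinner x y = 0" .
  qed (use l V sh subspace_eigenspace[OF lin] in auto)
  with l min that show ?thesis by blast
qed

end

section \<open>Roots of unity and the period\<close>

text \<open>Replace \<open>z\<close> by a power that equals \<open>cis (2 pi / l)\<close>.  Bezout's identity for \<open>l\<close> and
  \<open>m\<close> gives \<open>x / l - y / m = gcd l m / (l m) = 1 / lcm l m\<close>; the negative exponent \<open>-y\<close> is
  replaced by \<open>(m - 1) y\<close>.\<close>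
lemma root_unity_lcm:
  fixes z :: complex
  assumes "1 \<le> l" "1 \<le> m" "z ^ l = 1" "\<And>i. 0 < i \<Longrightarrow> i < l \<Longrightarrow> z ^ i \<noteq> 1"
  obtains a b where "z ^ a * cis (2 * pi / real m) ^ b = cis (2 * pi / real (lcm l m))"
proof -
  have z0: "z \<noteq> 0" using assms(1,3) by (metis not_one_le_zero power_0_left zero_neq_one)
  have inj: "inj_on (\<lambda>i. z ^ i) {..<l}"
  proof (rule inj_onI, rule ccontr)
    have *: False if h: "i < j" "z ^ i = z ^ j" "j < l" for i j :: nat
    proof -
      have "z ^ (j - i) = 1" by (rule power_eq_imp_diff[OF z0 h(1,2)])
      thus False using assms(4)[of "j - i"] h by auto
    qed
    fix i j assume "i \<in> {..<l}" "j \<in> {..<l}" "z ^ i = z ^ j" "i \<noteq> j"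
    thus False using *[of i j] *[of j i] by (metis lessThan_iff nat_neq_iff)
  qed
  have "(\<lambda>i. z ^ i) ` {..<l} = {w. w ^ l = 1}"
  proof (rule card_subset_eq)
    show "finite {w :: complex. w ^ l = 1}" using assms(1) by (intro finite_roots_unity) auto
    show "(\<lambda>i. z ^ i) ` {..<l} \<subseteq> {w. w ^ l = 1}"
      using assms(3) by (auto simp: power_mult[symmetric] mult.commute[of _ l]) (simp add: power_mult)
    show "card ((\<lambda>i. z ^ i) ` {..<l}) = card {w :: complex. w ^ l = 1}"
      using assms(1) inj by (simp add: card_image card_roots_unity_eq)
  qed
  moreover have "cis (2 * pi / real l) ^ l = 1"
    using assms(1) by (simp add: Complex.DeMoivre)
  ultimately obtain i where i: "z ^ i = cis (2 * pi / real l)" by (metis (mono_tags, lifting) imageE mem_Collect_eq)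
  obtain x y where xy: "m * x = l * y + gcd m l" using bezout_nat[of m l] assms(2) by auto
  define w where "w = cis (2 * pi / real m)"
  have wm: "w ^ m = 1" using assms(2) by (simp add: w_def Complex.DeMoivre)
  have "w ^ ((m - 1) * y) * w ^ y = (w ^ m) ^ y"
    using assms(2) by (simp add: power_mult[symmetric] power_add[symmetric]) (metis Suc_diff_1 add.commute less_eq_Suc_le mult_Suc One_nat_def)
  hence wy: "w ^ ((m - 1) * y) * w ^ y = 1" using wm by simp
  have "cis (2 * pi / real (lcm l m)) * w ^ y = cis (2 * pi / real l) ^ x"
  proof -
    have "gcd m l * lcm l m = m * l" using gcd_mult_lcm[of m l] by (simp add: lcm.commute[of l m])
    hence g: "real (gcd m l) * real (lcm l m) = real m * real l" by (metis of_nat_mult)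
    have r: "real m * real x = real l * real y + real (gcd m l)" using arg_cong[OF xy, of real] by simp
    have pos: "real m > 0" "real l > 0" "real (lcm l m) > 0" using assms(1,2) by (auto simp: lcm_pos_nat)
    have "1 / real (lcm l m) = real (gcd m l) / (real m * real l)" using g pos by (simp add: field_simps)
    hence "1 / real (lcm l m) + real y / real m = (real (gcd m l) + real l * real y) / (real m * real l)"
      using pos by (simp add: add_divide_distrib)
    also have "real (gcd m l) + real l * real y = real m * real x" using r by simp
    also have "real m * real x / (real m * real l) = real x / real l" using pos by simp
    finally have "1 / real (lcm l m) + real y / real m = real x / real l" .
    hence "2 * pi * (1 / real (lcm l m) + real y / real m) = 2 * pi * (real x / real l)" by simp
    hence "2 * pi / real (lcm l m) + real y * (2 * pi / real m) = real x * (2 * pi / real l)" by (simp add: algebra_simps)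
    thus ?thesis by (simp add: w_def Complex.DeMoivre cis_mult)
  qed
  hence "z ^ (i * x) * w ^ ((m - 1) * y) = cis (2 * pi / real (lcm l m)) * (w ^ ((m - 1) * y) * w ^ y)"
    by (simp add: power_mult i mult_ac)
  hence "z ^ (i * x) * w ^ ((m - 1) * y) = cis (2 * pi / real (lcm l m))" by (simp only: wy mult_1_right)
  thus ?thesis using that unfolding w_def by blast
qed

lemma cis_order:
  assumes "0 < i" "i < n" shows "cis (2 * pi / real n) ^ i \<noteq> 1"
proof
  assume e: "cis (2 * pi / real n) ^ i = 1"
  have "cis (2 * pi * real i / real n) = cis (real i * (2 * pi / real n))" by (simp add: mult_ac)
  also have "\<dots> = cis (2 * pi * real 0 / real n)" using e by (simp add: Complex.DeMoivre)
  finally have "cis (2 * pi * real i / real n) = cis (2 * pi * real 0 / real n)" .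
  moreover have "inj_on (\<lambda>k. cis (2 * pi * real k / real n)) {..<n}"
    using Complex.bij_betw_roots_unity[of n] assms unfolding bij_betw_def by simp
  ultimately have "i = 0" using inj_onD[of "\<lambda>k. cis (2 * pi * real k / real n)" "{..<n}" i 0] assms by simp
  thus False using assms by simp
qed

lemma cscale_add: "cscale a (A + A') = cscale a A + cscale a A'"
  by (simp add: cscale_def map_matrix_def vec_eq_iff distrib_left)

lemma cscale_cscale: "cscale a (cscale b A) = cscale (a * b) A"
  by (simp only: matrix_eq cscale_vector vec.scale_scale) simp

lemma cscale_zero: "cscale a 0 = 0"
  by (simp add: cscale_def map_matrix_def vec_eq_iff)

lemma cscale_sum: "cscale a (sum f S) = (\<Sum>r\<in>S. cscale a (f r))"
  by (induction S rule: infinite_finite_induct) (simp_all add: cscale_add cscale_zero)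

locale periodic_kraus = ergodic_kraus Q for Q :: "(complex ^ 'k::finite ^ 'k) measure" +
  fixes m :: nat and Es :: "nat \<Rightarrow> (complex ^ 'k) set" and M :: "nat \<Rightarrow> complex ^ 'k ^ 'k"
  assumes period: "is_period Q m" and cycle: "is_cycle Q m Es" and attached: "attached_matrices Q m Es M"
begin

definition omega :: complex where "omega = cis (2 * pi / real m)"

text \<open>An eigenmatrix of the quantum map for the eigenvalue \<open>omega ^ b\<close>.  On the subspace
  with index \<open>r\<close> of the cycle it is multiplication by \<open>omega ^ (b r)\<close>.\<close>
definition fourier_matrix :: "nat \<Rightarrow> complex ^ 'k ^ 'k" where "fourier_matrix b = (\<Sum>r\<in>{1..m}. cscale (omega ^ (b * r)) (M r))"

lemma m_pos: "1 \<le> m" using cycle unfolding is_cycle_def by blast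

lemma omega_m: "omega ^ m = 1" using m_pos by (simp add: omega_def Complex.DeMoivre)

lemma omega_norm: "cmod omega = 1" by (simp add: omega_def)

lemma M_on_cycle:
  assumes "r \<in> {1..m}" "s \<in> {1..m}" "x \<in> Es s" shows "M r *v x = (if r = s then x else 0)"
proof -
  have "vec.subspace (Es s)" using cycle assms unfolding is_cycle_def by blast
  hence "M r *v x = (M r ** projector_onto (Es s)) *v x"
    using projector_onto_fix[OF _ assms(3)] by (simp add: matrix_vector_mul_assoc[symmetric])
  also have "\<dots> = (if r = s then projector_onto (Es s) else 0) *v x"
    using attached assms(1,2) unfolding attached_matrices_def by auto
  finally show ?thesis using \<open>vec.subspace (Es s)\<close> projector_onto_fix[OF _ assms(3)] by auto
qed

lemma cscale_sum_vector: "(\<Sum>r\<in>S. cscale (c r) (N r)) *v x = (\<Sum>r\<in>S. c r *s (N r *v x))"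
  by (induction S rule: infinite_finite_induct) (auto simp: matrix_vector_mult_add_rdistrib cscale_vector)

lemma fourier_matrix_on_cycle:
  assumes "s \<in> {1..m}" "x \<in> Es s" shows "fourier_matrix b *v x = omega ^ (b * s) *s x"
proof -
  have "fourier_matrix b *v x = (\<Sum>r\<in>{1..m}. if r = s then omega ^ (b * s) *s x else 0)"
    unfolding fourier_matrix_def cscale_sum_vector by (intro sum.cong refl) (simp add: M_on_cycle[OF _ assms])
  thus ?thesis using assms by simp
qed

text \<open>The definition of a cycle admits zero subspaces.  But no nonzero vector is killed by
  almost every \<open>v\<close>, so a zero subspace forces its predecessor, and then all of them, to
  vanish.\<close>
lemma cycle_nonzero: assumes "r \<in> {1..m}" shows "Es r \<noteq> {0}"
proof
  assume r: "Es r = {0}"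
  have sub: "0 \<in> Es i" if "i \<in> {1..m}" for i
    using cycle that vec.subspace_0 unfolding is_cycle_def by blast
  have pred: "Es i = {0}" if "i \<in> {1..m}" "Es (if i = m then 1 else i + 1) = {0}" for i
  proof -
    note i = that(1) and nx = that(2)
    have "AE v in Q. \<forall>i\<in>{1..m}. (*v) v ` Es i \<subseteq> Es (if i = m then 1 else i + 1)"
      using cycle unfolding is_cycle_def by blast
    hence "AE v in Q. (*v) v ` Es i \<subseteq> {0}"
    proof eventually_elim
      case (elim v)
      show ?case using bspec[OF elim i] unfolding nx .
    qed
    hence "x = 0" if "x \<in> Es i" for x
      by (intro AE_zero_imp) (use that in \<open>auto elim!: eventually_mono\<close>)
    thus ?thesis using sub[OF i] by blast
  qed
  have down: "Es i = {0}" if "Es n = {0}" "n \<le> m" "1 \<le> i" "i \<le> n" for i n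
    using that(4,1,2,3)
  proof (induction i rule: inc_induct)
    case (step i)
    thus ?case using pred[of i] by auto
  qed
  have "Es 1 = {0}" using down[OF r] assms by auto
  hence "Es m = {0}" using pred[of m] m_pos by auto
  hence "Es i = {0}" if "i \<in> {1..m}" for i using down[of m i] that by auto
  hence "(\<Union>i\<in>{1..m}. Es i) = {0}" using m_pos by auto
  hence "E = {0}" using cycle unfolding is_cycle_def by (metis vec.span_empty vec.span_insert_0)
  thus False using E_props(2) by blast
qed

lemma cycle_vector:
  assumes "r \<in> {1..m}" obtains x where "x \<in> Es r" "x \<noteq> 0"
proof -
  have "0 \<in> Es r" using cycle assms vec.subspace_0 unfolding is_cycle_def by blast
  hence "\<exists>x. x \<in> Es r \<and> x \<noteq> 0" using cycle_nonzero[OF assms] by blast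
  thus ?thesis using that by blast
qed

lemma E_induct:
  assumes "vec.subspace {x. P x}" "\<And>r x. r \<in> {1..m} \<Longrightarrow> x \<in> Es r \<Longrightarrow> P x" "x \<in> E" shows "P x"
proof -
  have "vec.span (\<Union>i\<in>{1..m}. Es i) \<subseteq> {x. P x}" by (rule vec.span_minimal[OF _ assms(1)]) (use assms(2) in blast)
  thus ?thesis using cycle assms(3) unfolding is_cycle_def by blast
qed

lemma quantum_map_sum: "quantum_map Q (\<Sum>r\<in>S. cscale (c r) (N r)) = (\<Sum>r\<in>S. cscale (c r) (quantum_map Q (N r)))"
  if "finite S"
proof -
  have "cinner x (quantum_map Q (\<Sum>r\<in>S. cscale (c r) (N r)) *v y) = cinner x ((\<Sum>r\<in>S. cscale (c r) (quantum_map Q (N r))) *v y)" for x y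
  proof -
    have "cinner x (quantum_map Q (\<Sum>r\<in>S. cscale (c r) (N r)) *v y)
        = (LINT v|Q. (\<Sum>r\<in>S. c r * cinner (v *v x) (N r *v (v *v y))))"
      unfolding cinner_quantum_map cscale_sum_vector cinner_sum_right cinner_scale_right ..
    also have "\<dots> = (\<Sum>r\<in>S. c r * cinner x (quantum_map Q (N r) *v y))"
      unfolding cinner_quantum_map integral_mult_right_zero[symmetric]
      by (intro Bochner_Integration.integral_sum integrable_continuous continuous_intros)
    finally show ?thesis unfolding cscale_sum_vector cinner_sum_right cinner_scale_right .
  qed
  hence "cinner z (quantum_map Q (\<Sum>r\<in>S. cscale (c r) (N r)) *v y - (\<Sum>r\<in>S. cscale (c r) (quantum_map Q (N r))) *v y) = 0" for z y
    by (simp add: cinner_diff_right)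
  hence "quantum_map Q (\<Sum>r\<in>S. cscale (c r) (N r)) *v y = (\<Sum>r\<in>S. cscale (c r) (quantum_map Q (N r))) *v y" for y
    by (subst eq_iff_diff_eq_0, subst cinner_self_eq_0[symmetric])
  thus ?thesis by (simp only: matrix_eq) blast
qed

lemma quantum_map_lincomb:
  "quantum_map Q (cscale a A + cscale b A') = cscale a (quantum_map Q A) + cscale b (quantum_map Q A')"
  using quantum_map_sum[of "{True, False}" "\<lambda>r. if r then a else b" "\<lambda>r. if r then A else A'"] by simp

text \<open>Shifting the index by one costs the factor \<open>omega ^ b\<close>; the cyclic shift is consistent
  at the ends since \<open>omega ^ m = 1\<close>.\<close>
lemma quantum_map_fourier_matrix: "quantum_map Q (fourier_matrix b) = cscale (omega ^ b) (fourier_matrix b)"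
proof -
  let ?prev = "\<lambda>r. if r = 1 then m else r - 1" and ?next = "\<lambda>r. if r = m then 1 else r + 1"
  have "quantum_map Q (fourier_matrix b) = (\<Sum>r\<in>{1..m}. cscale (omega ^ (b * r)) (M (?prev r)))"
    unfolding fourier_matrix_def quantum_map_sum[OF finite_atLeastAtMost]
    using attached unfolding attached_matrices_def by (intro sum.cong refl) auto
  also have "\<dots> = (\<Sum>r\<in>{1..m}. cscale (omega ^ b * omega ^ (b * r)) (M r))"
  proof (rule sum.reindex_bij_witness[of _ ?next ?prev])
    fix r assume r: "r \<in> {1..m}"
    show "cscale (omega ^ b * omega ^ (b * ?prev r)) (M (?prev r)) = cscale (omega ^ (b * r)) (M (?prev r))"
    proof (cases "r = 1")
      case True
      have "omega ^ (b * m) = 1" using omega_m by (simp add: mult.commute[of b] power_mult)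
      thus ?thesis using True by simp
    next
      case False
      hence "b + b * (r - 1) = b * r" using r by (cases r) auto
      thus ?thesis using False by (simp add: power_add[symmetric])
    qed
  qed (use m_pos in auto)
  also have "\<dots> = cscale (omega ^ b) (fourier_matrix b)" by (simp add: fourier_matrix_def cscale_sum cscale_cscale)
  finally show ?thesis .
qed

lemma fourier_matrix_nonzero: "fourier_matrix b \<noteq> 0"
proof
  assume "fourier_matrix b = 0"
  have one: "1 \<in> {1..m}" using m_pos by simp
  obtain x where x: "x \<in> Es 1" "x \<noteq> 0" by (rule cycle_vector[OF one])
  have "fourier_matrix b *v x = omega ^ (b * 1) *s x" using fourier_matrix_on_cycle[of 1 x b] x m_pos by auto
  hence "norm (omega ^ (b * 1) *s x) = 0" using \<open>fourier_matrix b = 0\<close> by simp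
  thus False using x by (simp add: norm_smult norm_power omega_norm)
qed

lemma intertwiner_fourier_matrix: "intertwiner ((*v) (fourier_matrix 1)) omega"
  using peripheral_intertwiner[OF quantum_map_fourier_matrix fourier_matrix_nonzero] omega_norm by (metis power_one_right)

text \<open>If \<open>z\<close> has order \<open>l\<close>, then some product of powers of the given intertwiner and of the
  first Fourier matrix has a factor of order \<open>lcm l m\<close>.  This yields a cycle of that length,
  so \<open>lcm l m \<le> m\<close>.\<close>
lemma intertwiner_root_of_unity:
  assumes U: "intertwiner U z" shows "z ^ m = 1"
proof -
  obtain l Ls where l: "1 \<le> l" "z ^ l = 1" "\<And>i. 0 < i \<Longrightarrow> i < l \<Longrightarrow> z ^ i \<noteq> 1" "is_cycle Q l Ls"
    using intertwiner_cycle[OF U] by blast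
  obtain a b where ab: "z ^ a * cis (2 * pi / real m) ^ b = cis (2 * pi / real (lcm l m))"
    using root_unity_lcm[OF l(1) m_pos l(2,3)] by blast
  let ?L = "lcm l m"
  have L: "0 < ?L" using l(1) m_pos by (auto simp: lcm_pos_nat)
  have "intertwiner ((U ^^ a) \<circ> ((*v) (fourier_matrix 1) ^^ b)) (z ^ a * omega ^ b)"
    by (intro intertwiner_compose intertwiner_funpow U intertwiner_fourier_matrix)
  then obtain l' Ls' where l': "1 \<le> l'" "cis (2 * pi / real ?L) ^ l' = 1" "is_cycle Q l' Ls'"
    using intertwiner_cycle[of _ "cis (2 * pi / real ?L)"] ab unfolding omega_def by metis
  have "?L \<le> l'" using cis_order[of l' ?L] l'(1,2) by (meson not_le_imp_less less_le_trans zero_less_one)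
  also have "l' \<le> m" using period l'(3) unfolding is_period_def by blast
  finally have "?L = m" using L m_pos by (meson dvd_imp_le dvd_lcm2 le_antisym)
  hence "l dvd m" by (metis dvd_lcm1)
  then obtain q where "m = l * q" ..
  thus ?thesis using l(2) by (simp add: power_mult)
qed

text \<open>Since \<open>z = omega ^ b\<close>, composing \<open>A'\<close> with the power \<open>m - b\<close> of the first Fourier
  matrix gives an intertwiner with factor 1, which is scalar on \<open>E\<close>.  This determines \<open>A'\<close> on
  \<open>E\<close>, hence everywhere.\<close>
lemma peripheral_structure:
  assumes A: "quantum_map Q A = cscale z A" "A \<noteq> 0" and z: "cmod z = 1"
  obtains b where "b < m" "z = omega ^ b"
    "\<And>A'. quantum_map Q A' = cscale z A' \<Longrightarrow> \<exists>k. A' = cscale k (fourier_matrix b)"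
proof -
  have "z ^ m = 1" by (rule intertwiner_root_of_unity[OF peripheral_intertwiner[OF A z]])
  then obtain b where "b < m" "z = cis (2 * pi * real b / real m)"
  proof -
    have "(\<lambda>k. cis (2 * pi * real k / real m)) ` {..<m} = {z. z ^ m = 1}"
      using Complex.bij_betw_roots_unity[of m] m_pos unfolding bij_betw_def by simp
    hence "z \<in> (\<lambda>k. cis (2 * pi * real k / real m)) ` {..<m}" using \<open>z ^ m = 1\<close> by simp
    thus ?thesis using that by auto
  qed
  hence b: "b < m" "z = omega ^ b" by (simp_all add: omega_def Complex.DeMoivre mult_ac)
  have "\<exists>k. A' = cscale k (fourier_matrix b)" if A': "quantum_map Q A' = cscale z A'" for A'
  proof (cases "A' = 0")
    case True
    have "cscale 0 (fourier_matrix b) = 0" by (simp add: cscale_def map_matrix_def vec_eq_iff)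
    thus ?thesis using True by metis
  next
    case False
    have "intertwiner ((*v) A' \<circ> ((*v) (fourier_matrix 1) ^^ (m - b))) (z * omega ^ (m - b))"
      by (intro intertwiner_compose intertwiner_funpow peripheral_intertwiner[OF A' False z] intertwiner_fourier_matrix)
    moreover have "z * omega ^ (m - b) = 1" using b omega_m by (simp add: power_add[symmetric])
    ultimately have "intertwiner ((*v) A' \<circ> ((*v) (fourier_matrix 1) ^^ (m - b))) 1" by simp
    from intertwiner_one[OF this] obtain k where k: "\<And>x. x \<in> E \<Longrightarrow> A' *v (((*v) (fourier_matrix 1) ^^ (m - b)) x) = k *s x"
      by auto
    have pw: "((*v) (fourier_matrix 1) ^^ n) x = omega ^ (n * r) *s x" if "r \<in> {1..m}" "x \<in> Es r" for n r x
      by (induction n) (simp_all add: matrix_vector_scaleC fourier_matrix_on_cycle[OF that] power_add mult.commute)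
    have EsE: "x \<in> E" if "r \<in> {1..m}" "x \<in> Es r" for r x
    proof -
      have "x \<in> vec.span (\<Union>i\<in>{1..m}. Es i)" by (rule vec.span_base) (use that in blast)
      thus ?thesis using cycle unfolding is_cycle_def by blast
    qed
    let ?D = "A' - cscale k (fourier_matrix b)"
    have D: "?D *v x = 0" if "r \<in> {1..m}" "x \<in> Es r" for r x
    proof -
      have "omega ^ ((m - b) * r) *s (A' *v x) = k *s x"
        using k[OF EsE[OF that]] pw[OF that] by (simp add: matrix_vector_scaleC)
      hence "omega ^ (b * r) *s (omega ^ ((m - b) * r) *s (A' *v x)) = omega ^ (b * r) *s (k *s x)" by simp
      moreover have "omega ^ (b * r) * omega ^ ((m - b) * r) = 1"
      proof -
        have "b * r + (m - b) * r = m * r" using b(1) by (simp add: distrib_right[symmetric])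
        hence "omega ^ (b * r) * omega ^ ((m - b) * r) = omega ^ (m * r)" by (simp only: power_add[symmetric])
        also have "\<dots> = 1" by (simp only: power_mult omega_m power_one)
        finally show ?thesis .
      qed
      ultimately have "A' *v x = k *s (omega ^ (b * r) *s x)" by (simp add: mult.commute)
      thus ?thesis by (simp add: matrix_vector_mult_diff_rdistrib cscale_vector fourier_matrix_on_cycle[OF that])
    qed
    have "?D *v x = 0" if "x \<in> E" for x
    proof (rule E_induct[OF _ D that])
      show "vec.subspace {x. ?D *v x = 0}"
        unfolding vec.subspace_def by (simp add: matrix_vector_right_distrib matrix_vector_scaleC)
    qed
    moreover have "quantum_map Q ?D = cscale z ?D"
    proof -
      have D_eq: "A' - cscale k N = cscale 1 A' + cscale (- k) N" for N
        by (simp add: cscale_def map_matrix_def vec_eq_iff)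
      have "quantum_map Q ?D = cscale 1 (cscale z A') + cscale (- k) (cscale z (fourier_matrix b))"
        unfolding D_eq quantum_map_lincomb A' quantum_map_fourier_matrix b(2) ..
      also have "\<dots> = cscale z ?D"
        unfolding D_eq cscale_add cscale_cscale by (simp only: mult.commute)
      finally show ?thesis .
    qed
    ultimately have "?D = 0" using peripheral_zero z by blast
    thus ?thesis by auto
  qed
  with b that show ?thesis by blast
qed

end

section \<open>Normalisation of the measure\<close>

text \<open>The Frobenius norm becomes \<open>sqrt k\<close>, except that 0 stays 0.\<close>
definition rescale :: "complex ^ 'k::finite ^ 'k \<Rightarrow> complex ^ 'k ^ 'k" where
  "rescale v = (sqrt (real CARD('k)) / norm v) *\<^sub>R v"

text \<open>The mean of \<open>|v|^2\<close> is the trace of the identity, so this is a probability density for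
  admissible measures.\<close>
definition weight :: "complex ^ 'k::finite ^ 'k \<Rightarrow> real" where
  "weight v = (norm v)\<^sup>2 / real CARD('k)"

definition normalized :: "(complex ^ 'k::finite ^ 'k) measure \<Rightarrow> (complex ^ 'k ^ 'k) measure" where
  "normalized \<mu> = distr (density \<mu> (\<lambda>v. ennreal (weight v))) borel rescale"

lemma rescale_borel [measurable]: "rescale \<in> borel_measurable (borel :: (complex ^ 'k::finite ^ 'k) measure)"
  unfolding rescale_def[abs_def] by measurable

lemma weight_borel [measurable]: "weight \<in> borel_measurable (borel :: (complex ^ 'k::finite ^ 'k) measure)"
  unfolding weight_def[abs_def] by measurable

lemma weight_nonneg [simp]: "0 \<le> weight v" by (simp add: weight_def)

lemma weight_pos_iff: "0 < weight v \<longleftrightarrow> v \<noteq> 0" by (simp add: weight_def zero_less_divide_iff)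

lemma rescale_weight:
  fixes v :: "complex ^ 'k::finite ^ 'k" and g :: "complex ^ 'k ^ 'k \<Rightarrow> 'b::real_vector"
  assumes "\<And>c v. 0 \<le> c \<Longrightarrow> g (c *\<^sub>R v) = c\<^sup>2 *\<^sub>R g v"
  shows "weight v *\<^sub>R g (rescale v) = g v"
proof (cases "v = 0")
  case True
  have "g 0 = 0" using assms[of 0 0] by simp
  thus ?thesis using True by (simp add: weight_def)
next
  case False
  have "g (rescale v) = (sqrt (real CARD('k)) / norm v)\<^sup>2 *\<^sub>R g v"
    unfolding rescale_def by (rule assms) simp
  thus ?thesis using False by (simp add: weight_def power_divide)
qed

context
  fixes \<mu> :: "(complex ^ 'k::finite ^ 'k) measure"
  assumes sets_\<mu>: "sets \<mu> = sets borel"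
begin

lemma space_\<mu>: "space \<mu> = UNIV" using sets_eq_imp_space_eq[OF sets_\<mu>] by simp

lemma borel_\<mu>: "f \<in> borel_measurable borel \<longleftrightarrow> f \<in> borel_measurable \<mu>"
  using measurable_cong_sets[OF sets_\<mu> refl] by blast

lemma rescale_\<mu>: "rescale \<in> measurable (density \<mu> w) borel"
  by (simp add: measurable_cong_sets[OF sets_\<mu> refl] rescale_borel)

text \<open>For a function that is homogeneous of degree two, the weight and the scaling cancel.
  For a function that is not measurable, both integrals are 0 by convention.\<close>
lemma integral_normalized:
  fixes g :: "complex ^ 'k ^ 'k \<Rightarrow> 'b::{banach, second_countable_topology}"
  assumes hom: "\<And>c v. 0 \<le> c \<Longrightarrow> g (c *\<^sub>R v) = c\<^sup>2 *\<^sub>R g v"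
  shows "(LINT v|normalized \<mu>. g v) = (LINT v|\<mu>. g v)"
proof (cases "g \<in> borel_measurable borel")
  case True
  have "(LINT v|normalized \<mu>. g v) = (LINT v|density \<mu> (\<lambda>v. ennreal (weight v)). g (rescale v))"
    unfolding normalized_def by (rule integral_distr[OF rescale_\<mu> True])
  also have "\<dots> = (LINT v|\<mu>. weight v *\<^sub>R g (rescale v))"
    by (rule integral_density)
      (use measurable_compose[OF rescale_borel True] weight_borel in \<open>simp_all add: borel_\<mu>[symmetric]\<close>)
  finally show ?thesis by (simp add: rescale_weight[of g, OF hom])
next
  case False
  hence "\<not> integrable \<mu> g" using borel_\<mu> borel_measurable_integrable by blast
  moreover have "\<not> integrable (normalized \<mu>) g"
    using False borel_measurable_integrable[of "normalized \<mu>" g] by (auto simp: normalized_def)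
  ultimately show ?thesis by (simp add: not_integrable_integral_eq)
qed

text \<open>The weight vanishes only at the zero matrix.\<close>
lemma AE_normalized:
  assumes P: "{v. P v} \<in> sets borel" and inv: "\<And>c v. 0 < c \<Longrightarrow> P (c *\<^sub>R v) \<longleftrightarrow> P v"
  shows "(AE v in normalized \<mu>. P v) \<longleftrightarrow> (AE v in \<mu>. v \<noteq> 0 \<longrightarrow> P v)"
proof -
  have "(AE v in normalized \<mu>. P v) \<longleftrightarrow> (AE v in density \<mu> (\<lambda>v. ennreal (weight v)). P (rescale v))"
    unfolding normalized_def using P by (subst AE_distr_iff[OF rescale_\<mu>]) auto
  also have "\<dots> \<longleftrightarrow> (AE v in \<mu>. 0 < ennreal (weight v) \<longrightarrow> P (rescale v))"
    by (intro AE_density measurable_compose[OF _ measurable_ennreal]) (simp add: borel_\<mu>[symmetric])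
  also have "(\<lambda>v. 0 < ennreal (weight v) \<longrightarrow> P (rescale v)) = (\<lambda>v. v \<noteq> 0 \<longrightarrow> P v)"
    by (auto simp: fun_eq_iff weight_pos_iff rescale_def inv)
  finally show ?thesis .
qed

lemma markov_op_normalized: "markov_op (normalized \<mu>) f = markov_op \<mu> f"
proof
  fix p
  show "markov_op (normalized \<mu>) f p = markov_op \<mu> f p"
    unfolding markov_op_lift
  proof (rule integral_normalized)
    fix c :: real and v :: "complex ^ 'k ^ 'k" assume "0 \<le> c"
    thus "lift f ((c *\<^sub>R v) *v unit_rep p) = c\<^sup>2 *\<^sub>R lift f (v *v unit_rep p)"
      by (simp add: scaleR_matrix_vector lift_scale scaleR_conv_of_real[where 'a=complex])
  qed
qed

lemma ctrans_scaleR: "ctrans (c *\<^sub>R (v :: complex ^ 'k ^ 'k)) = c *\<^sub>R ctrans v"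
  by (simp add: ctrans_def map_matrix_def transpose_def vec_eq_iff)

lemma quantum_map_normalized: "quantum_map (normalized \<mu>) X = quantum_map \<mu> X"
  unfolding quantum_map_def
  by (rule integral_normalized) (simp add: ctrans_scaleR scaleR_mat_mult power2_eq_square)

lemma closed_maps_into:
  fixes S T :: "(complex ^ 'k) set"
  assumes T: "vec.subspace T"
  shows "closed {v :: complex ^ 'k ^ 'k. (*v) v ` S \<subseteq> T}"
proof -
  have "closed T" by (rule closed_subspace[OF real_subspace[OF T]])
  hence "closed ((\<lambda>v :: complex ^ 'k ^ 'k. v *v x) -` T)" for x
    by (intro closed_vimage continuous_intros)
  hence "closed (\<Inter>x\<in>S. (\<lambda>v :: complex ^ 'k ^ 'k. v *v x) -` T)" by blast
  also have "(\<Inter>x\<in>S. (\<lambda>v :: complex ^ 'k ^ 'k. v *v x) -` T) = {v. (*v) v ` S \<subseteq> T}" by auto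
  finally show ?thesis .
qed

lemma maps_into_scale:
  assumes T: "vec.subspace T" and c: "0 < (c::real)"
  shows "(*v) (c *\<^sub>R (v :: complex ^ 'k ^ 'k)) ` S \<subseteq> T \<longleftrightarrow> (*v) v ` S \<subseteq> T"
proof -
  have "of_real c *s y \<in> T \<longleftrightarrow> y \<in> T" for y
    using vec.subspace_scale[OF T, of y "of_real c"] vec.subspace_scale[OF T, of "of_real c *s y" "inverse (of_real c)"] c by auto
  thus ?thesis by (simp add: image_subset_iff scaleR_matrix_vector)
qed

lemma zero_maps_into:
  assumes "vec.subspace T" shows "(*v) (0 :: complex ^ 'k ^ 'k) ` S \<subseteq> T"
  using vec.subspace_0[OF assms] by auto

lemma invariant_subspace_normalized: "invariant_subspace (normalized \<mu>) S \<longleftrightarrow> invariant_subspace \<mu> S"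
proof (cases "vec.subspace S")
  case True
  have "(AE v in normalized \<mu>. (*v) v ` S \<subseteq> S) \<longleftrightarrow> (AE v in \<mu>. v \<noteq> 0 \<longrightarrow> (*v) v ` S \<subseteq> S)"
    by (rule AE_normalized) (use closed_maps_into[OF True] maps_into_scale[OF True] in \<open>auto intro!: borel_closed\<close>)
  also have "\<dots> \<longleftrightarrow> (AE v in \<mu>. (*v) v ` S \<subseteq> S)"
    using zero_maps_into[OF True, of S] by (intro AE_cong) metis
  finally show ?thesis by (simp add: invariant_subspace_def)
qed (simp add: invariant_subspace_def)

lemma minimal_invariant_normalized: "minimal_invariant (normalized \<mu>) S \<longleftrightarrow> minimal_invariant \<mu> S"
  by (simp add: minimal_invariant_def invariant_subspace_normalized)

lemma erg_space_normalized: "erg_space (normalized \<mu>) = erg_space \<mu>"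
  by (simp add: erg_space_def minimal_invariant_normalized)

lemma Erg_normalized: "Erg (normalized \<mu>) \<longleftrightarrow> Erg \<mu>"
  by (simp add: Erg_def minimal_invariant_normalized)

lemma is_cycle_normalized: "is_cycle (normalized \<mu>) l Es \<longleftrightarrow> is_cycle \<mu> l Es"
proof (cases "\<forall>i\<in>{1..l}. vec.subspace (Es i)")
  case True
  let ?n = "\<lambda>i. if i = l then 1 else i + 1"
  let ?P = "\<lambda>v. \<forall>i\<in>{1..l}. (*v) v ` Es i \<subseteq> Es (?n i)"
  have n: "vec.subspace (Es (?n i))" if "i \<in> {1..l}" for i
    using True that by (cases "i = l") auto
  have cl: "{v. ?P v} \<in> sets borel"
  proof -
    have "closed (\<Inter>i\<in>{1..l}. {v :: complex ^ 'k ^ 'k. (*v) v ` Es i \<subseteq> Es (?n i)})"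
      using closed_maps_into[OF n] by (intro closed_INT ballI)
    also have "(\<Inter>i\<in>{1..l}. {v :: complex ^ 'k ^ 'k. (*v) v ` Es i \<subseteq> Es (?n i)}) = {v. ?P v}" by blast
    finally show ?thesis by (rule borel_closed)
  qed
  have "(AE v in normalized \<mu>. ?P v) \<longleftrightarrow> (AE v in \<mu>. v \<noteq> 0 \<longrightarrow> ?P v)"
    by (rule AE_normalized[OF cl]) (intro ball_cong refl maps_into_scale n)
  also have "\<dots> \<longleftrightarrow> (AE v in \<mu>. ?P v)"
  proof -
    have "?P 0" by (intro ballI zero_maps_into n)
    hence "(v \<noteq> 0 \<longrightarrow> ?P v) \<longleftrightarrow> ?P v" for v by (metis (no_types))
    thus ?thesis by (simp only:)
  qed
  finally show ?thesis unfolding is_cycle_def erg_space_normalized by blast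
qed (auto simp: is_cycle_def)

end

lemma admissible_normalized:
  assumes adm: "admissible (\<mu> :: (complex ^ 'k::finite ^ 'k) measure)"
  shows "kraus_prob (normalized \<mu>)" "prob_space (density \<mu> (\<lambda>v. ennreal (weight v)))"
proof -
  have sets: "sets \<mu> = sets borel" and I: "(LINT v|\<mu>. ctrans v ** v) = mat 1"
    using adm unfolding admissible_def by auto
  have "mat 1 \<noteq> (0 :: complex ^ 'k ^ 'k)"
    by (simp add: vec_eq_iff mat_def)
  with I have "(LINT v|\<mu>. ctrans v ** v) \<noteq> 0" by simp
  hence int: "integrable \<mu> (\<lambda>v. ctrans v ** v)"
    using not_integrable_integral_eq[of \<mu> "\<lambda>v. ctrans v ** v"] by blast
  have lin: "bounded_linear (\<lambda>A :: complex ^ 'k ^ 'k. Re (cinner x (A *v x)))" for x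
    unfolding linear_conv_bounded_linear[symmetric]
    by (rule linearI) (simp_all add: matrix_vector_mult_add_rdistrib cinner_simps scaleR_matrix_vector)
  have e: "Re (cinner x ((ctrans v ** v) *v x)) = (norm (v *v x))\<^sup>2" for x and v :: "complex ^ 'k ^ 'k"
    unfolding cinner_gram cinner_self by simp
  have ix: "integrable \<mu> (\<lambda>v. (norm (v *v x))\<^sup>2)" for x
    using integrable_bounded_linear[OF lin int] unfolding e .
  have ux: "(LINT v|\<mu>. (norm (v *v x))\<^sup>2) = (norm x)\<^sup>2" for x
    using integral_bounded_linear[OF lin int, of x] unfolding e I by (simp add: cinner_self)
  have iw: "integrable \<mu> weight" and uw: "(LINT v|\<mu>. weight v) = 1"
    unfolding weight_def[abs_def] norm_mat_columns by (simp_all add: ix ux)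
  show P: "prob_space (density \<mu> (\<lambda>v. ennreal (weight v)))"
  proof
    have "emeasure (density \<mu> (\<lambda>v. ennreal (weight v))) (space \<mu>) = (\<integral>\<^sup>+v. ennreal (weight v) * indicator (space \<mu>) v \<partial>\<mu>)"
      using iw by (intro emeasure_density) auto
    also have "\<dots> = (\<integral>\<^sup>+v. ennreal (weight v) \<partial>\<mu>)" by (intro nn_integral_cong) simp
    also have "\<dots> = 1" using nn_integral_eq_integral[OF iw] uw by simp
    finally show "emeasure (density \<mu> (\<lambda>v. ennreal (weight v))) (space (density \<mu> (\<lambda>v. ennreal (weight v)))) = 1" by simp
  qed
  interpret P: prob_space "density \<mu> (\<lambda>v. ennreal (weight v))" by (rule P)
  interpret N: prob_space "normalized \<mu>"
    unfolding normalized_def by (rule P.prob_space_distr[OF rescale_\<mu>[OF sets]])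
  show "kraus_prob (normalized \<mu>)"
  proof
    show "sets (normalized \<mu>) = sets borel" by (simp add: normalized_def)
    have "norm (rescale v) \<le> sqrt (real CARD('k))" for v :: "complex ^ 'k ^ 'k"
      by (simp add: rescale_def)
    hence "AE v in normalized \<mu>. norm v \<le> sqrt (real CARD('k))"
      unfolding normalized_def
      by (subst AE_distr_iff[OF rescale_\<mu>[OF sets]]) auto
    thus "\<exists>B. AE v in normalized \<mu>. norm v \<le> B" ..
    show "(LINT v|normalized \<mu>. (norm (v *v x))\<^sup>2) = (norm x)\<^sup>2" for x
      unfolding ux[of x, symmetric]
      by (rule integral_normalized[OF sets]) (simp add: scaleR_matrix_vector norm_smult power_mult_distrib)
  qed
qed

section \<open>Product measures\<close>

text \<open>If no extension of the prescribed values exists, the definition falls back to the null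
  measure.\<close>
lemma extend_measure_dichotomy:
  assumes "G ` I \<subseteq> Pow \<Omega>"
  shows "(\<forall>A. emeasure (extend_measure \<Omega> I G \<mu>) A = 0) \<or> (\<forall>i\<in>I. emeasure (extend_measure \<Omega> I G \<mu>) (G i) = \<mu> i)"
proof (cases "\<exists>\<mu>'. (\<forall>i\<in>I. \<mu>' (G i) = \<mu> i) \<and> measure_space \<Omega> (sigma_sets \<Omega> (G`I)) \<mu>'")
  case True
  then obtain \<mu>' where \<mu>': "\<And>i. i \<in> I \<Longrightarrow> \<mu>' (G i) = \<mu> i" "measure_space \<Omega> (sigma_sets \<Omega> (G`I)) \<mu>'" by blast
  have "emeasure (extend_measure \<Omega> I G \<mu>) (G i) = \<mu> i" if "i \<in> I" for i
    by (rule emeasure_extend_measure[OF refl, where \<mu>'=\<mu>'])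
      (use \<mu>' that assms in \<open>auto simp: measure_space_def sets_extend_measure\<close>)
  thus ?thesis by blast
next
  case False
  hence "extend_measure \<Omega> I G \<mu> = measure_of \<Omega> (G`I) (\<lambda>_. 0)" unfolding extend_measure_def by auto
  thus ?thesis by (simp add: emeasure_sigma)
qed

text \<open>For factors that are not sigma-finite the product measure need not be determined by
  its values on boxes.  In any case it is null or has the expected values on boxes.\<close>
lemma PiM_dichotomy:
  assumes I: "finite I" "I \<noteq> {}"
  shows "(\<forall>A. emeasure (PiM I M) A = 0) \<or>
    (\<forall>X. (\<forall>i\<in>I. X i \<in> sets (M i)) \<longrightarrow> emeasure (PiM I M) (Pi\<^sub>E I X) = (\<Prod>i\<in>I. emeasure (M i) (X i)))"
proof -
  let ?\<Omega> = "\<Pi>\<^sub>E i\<in>I. space (M i)"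
  let ?J = "{(J, X). (J \<noteq> {} \<or> I = {}) \<and> finite J \<and> J \<subseteq> I \<and> X \<in> (\<Pi> j\<in>J. sets (M j))}"
  let ?G = "\<lambda>(J, X). prod_emb I M J (\<Pi>\<^sub>E j\<in>J. X j)"
  let ?m = "\<lambda>(J, X). \<Prod>j\<in>J \<union> {i\<in>I. emeasure (M i) (space (M i)) \<noteq> 1}. if j \<in> J then emeasure (M j) (X j) else emeasure (M j) (space (M j))"
  have "(\<forall>A. emeasure (PiM I M) A = 0) \<or> (\<forall>i\<in>?J. emeasure (PiM I M) (?G i) = ?m i)"
    unfolding PiM_def by (rule extend_measure_dichotomy) (auto simp: prod_emb_def)
  moreover have "emeasure (PiM I M) (Pi\<^sub>E I X) = (\<Prod>i\<in>I. emeasure (M i) (X i))"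
    if all: "\<forall>i\<in>?J. emeasure (PiM I M) (?G i) = ?m i" and X: "\<forall>i\<in>I. X i \<in> sets (M i)" for X
  proof -
    have "(I, X) \<in> ?J" using I X by auto
    from bspec[OF all this] have "emeasure (PiM I M) (prod_emb I M I (Pi\<^sub>E I X))
       = (\<Prod>j\<in>I \<union> {i\<in>I. emeasure (M i) (space (M i)) \<noteq> 1}. if j \<in> I then emeasure (M j) (X j) else emeasure (M j) (space (M j)))"
      by simp
    also have "I \<union> {i\<in>I. emeasure (M i) (space (M i)) \<noteq> 1} = I" by blast
    also have "prod_emb I M I (Pi\<^sub>E I X) = Pi\<^sub>E I X"
      using X sets.sets_into_space by (intro prod_emb_PiE_same_index) blast
    finally show ?thesis by (simp cong: prod.cong)
  qed
  ultimately show ?thesis by blast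
qed

text \<open>An admissible measure can have an infinite atom at the zero matrix and is sigma-finite
  away from it.\<close>
definition off_zero :: "(complex ^ 'k::finite ^ 'k) measure \<Rightarrow> (complex ^ 'k ^ 'k) measure" where
  "off_zero \<mu> = density \<mu> (indicator (- {0}))"

lemma sets_off_zero [simp]: "sets (off_zero \<mu>) = sets \<mu>" by (simp add: off_zero_def)

lemma sigma_finite_off_zero:
  assumes adm: "admissible (\<mu> :: (complex ^ 'k::finite ^ 'k) measure)"
  shows "sigma_finite_measure (off_zero \<mu>)"
proof -
  have sets: "sets \<mu> = sets borel" using adm unfolding admissible_def by auto
  interpret P: prob_space "density \<mu> (\<lambda>v. ennreal (weight v))" by (rule admissible_normalized(2)[OF adm])
  (* Dividing the probability density by the weight again gives the part off zero, and a finite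
     density preserves sigma-finiteness. *)
  let ?h = "\<lambda>v :: complex ^ 'k ^ 'k. ennreal (1 / weight v)"
  have wm: "weight \<in> borel_measurable \<mu>" using borel_\<mu>[OF sets] weight_borel by blast
  have "density (density \<mu> (\<lambda>v. ennreal (weight v))) ?h = density \<mu> (\<lambda>v. ennreal (weight v) * ?h v)"
    using wm by (intro density_density_eq) auto
  also have "(\<lambda>v. ennreal (weight v) * ?h v) = indicator (- {0 :: complex ^ 'k ^ 'k})"
  proof
    fix v :: "complex ^ 'k ^ 'k"
    show "ennreal (weight v) * ?h v = indicator (- {0}) v"
      using weight_pos_iff[of v] by (cases "v = 0") (auto simp: ennreal_mult'[symmetric] weight_def)
  qed
  finally have "off_zero \<mu> = density (density \<mu> (\<lambda>v. ennreal (weight v))) ?h" by (simp add: off_zero_def)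
  moreover have "sigma_finite_measure (density (density \<mu> (\<lambda>v. ennreal (weight v))) ?h)"
    using wm by (subst P.sigma_finite_iff_density_finite) auto
  ultimately show ?thesis by simp
qed

text \<open>On tuples without zero entries the product measure agrees on boxes with the product of
  the sigma-finite parts, hence equals it.  The other tuples satisfy the condition by
  assumption.\<close>
lemma AE_PiM_off_zero:
  fixes \<mu> :: "(complex ^ 'k::finite ^ 'k) measure"
  assumes adm: "admissible \<mu>" and I: "finite I" "I \<noteq> {}"
    and ae: "AE v in PiM I (\<lambda>_. off_zero \<mu>). P v"
    and zero: "\<And>v i. i \<in> I \<Longrightarrow> v i = 0 \<Longrightarrow> P v"
  shows "AE v in PiM I (\<lambda>_. \<mu>). P v"
proof -
  have sets: "sets \<mu> = sets borel" using adm unfolding admissible_def by auto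
  interpret S: sigma_finite_measure "off_zero \<mu>" by (rule sigma_finite_off_zero[OF adm])
  interpret product_sigma_finite "\<lambda>_. off_zero \<mu>" ..
  let ?M = "PiM I (\<lambda>_. \<mu>)"
  let ?Z = "Pi\<^sub>E I (\<lambda>_. - {0 :: complex ^ 'k ^ 'k})"
  have Z: "?Z \<in> sets ?M" using I sets by (intro sets_PiM_I_finite) auto
  have setsM: "sets ?M = sets (PiM I (\<lambda>_. off_zero \<mu>))" by (intro sets_PiM_cong) auto
  from PiM_dichotomy[OF I, of "\<lambda>_. \<mu>"] show ?thesis
  proof
    assume "\<forall>A. emeasure ?M A = 0"
    thus ?thesis by (intro AE_I[where N = "space ?M"]) auto
  next
    assume box: "\<forall>X. (\<forall>i\<in>I. X i \<in> sets \<mu>) \<longrightarrow> emeasure ?M (Pi\<^sub>E I X) = (\<Prod>i\<in>I. emeasure \<mu> (X i))"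
    have eq: "density ?M (indicator ?Z) = PiM I (\<lambda>_. off_zero \<mu>)"
    proof (rule PiM_eqI[OF I(1)])
      show "sets (density ?M (indicator ?Z)) = sets (PiM I (\<lambda>_. off_zero \<mu>))" by (simp add: setsM)
      fix A assume A: "\<And>i. i \<in> I \<Longrightarrow> A i \<in> sets (off_zero \<mu>)"
      have PA: "Pi\<^sub>E I A \<in> sets ?M" using A I by (intro sets_PiM_I_finite) auto
      have "emeasure (density ?M (indicator ?Z)) (Pi\<^sub>E I A) = emeasure ?M (?Z \<inter> Pi\<^sub>E I A)"
        using PA Z by (subst emeasure_density) (auto simp: indicator_inter_arith[symmetric])
      also have "?Z \<inter> Pi\<^sub>E I A = Pi\<^sub>E I (\<lambda>i. - {0} \<inter> A i)" by (auto simp: PiE_iff)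
      also have "emeasure ?M \<dots> = (\<Prod>i\<in>I. emeasure \<mu> (- {0} \<inter> A i))"
        using A sets by (intro box[rule_format]) auto
      also have "\<dots> = (\<Prod>i\<in>I. emeasure (off_zero \<mu>) (A i))"
      proof (rule prod.cong[OF refl])
        fix i assume "i \<in> I"
        hence "A i \<in> sets \<mu>" using A by simp
        thus "emeasure \<mu> (- {0} \<inter> A i) = emeasure (off_zero \<mu>) (A i)"
          unfolding off_zero_def using sets
          by (subst emeasure_density) (auto simp: indicator_inter_arith[symmetric])
      qed
      finally show "emeasure (density ?M (indicator ?Z)) (Pi\<^sub>E I A) = (\<Prod>i\<in>I. emeasure (off_zero \<mu>) (A i))" .
    qed
    have "AE v in density ?M (indicator ?Z). P v" unfolding eq by (rule ae)
    hence "AE v in ?M. 0 < (indicator ?Z v :: ennreal) \<longrightarrow> P v"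
      using Z by (subst (asm) AE_density) auto
    thus ?thesis
    proof (rule AE_mp, intro AE_I2 impI)
      fix v assume v: "v \<in> space ?M" and imp: "0 < (indicator ?Z v :: ennreal) \<longrightarrow> P v"
      show "P v"
      proof (cases "v \<in> ?Z")
        case False
        then obtain i where "i \<in> I" "v i = 0" using v by (auto simp: space_PiM PiE_iff)
        thus ?thesis by (rule zero)
      qed (use imp in auto)
    qed
  qed
qed

lemma left_prod_cong: "(\<And>i. 1 \<le> i \<Longrightarrow> i \<le> n \<Longrightarrow> v i = w i) \<Longrightarrow> left_prod v n = left_prod w n"
  by (induction n) auto

lemma left_prod_zero: "v i = 0 \<Longrightarrow> 1 \<le> i \<Longrightarrow> i \<le> n \<Longrightarrow> left_prod v n = 0"
  by (induction n) (auto simp: le_Suc_eq)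

lemma left_prod_measurable:
  assumes "sets N = sets (borel :: (complex ^ 'k::finite ^ 'k) measure)" "{1..n} \<subseteq> I"
  shows "(\<lambda>v. left_prod v n) \<in> borel_measurable (PiM I (\<lambda>_. N))"
  using assms(2)
proof (induction n)
  case (Suc n)
  have IH: "(\<lambda>v. left_prod v n) \<in> borel_measurable (PiM I (\<lambda>_. N))" using Suc by (auto simp: subset_eq)
  have "(\<lambda>v. v (Suc n)) \<in> measurable (PiM I (\<lambda>_. N)) N"
    using Suc.prems by (intro measurable_component_singleton) auto
  hence "(\<lambda>v. v (Suc n)) \<in> borel_measurable (PiM I (\<lambda>_. N))" using measurable_cong_sets[OF refl assms(1)] by blast
  with IH have "(\<lambda>v. (left_prod v n, v (Suc n))) \<in> measurable (PiM I (\<lambda>_. N)) (borel \<Otimes>\<^sub>M borel)" by measurable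
  from measurable_compose[OF this measurable_mult_pair[OF refl refl]] show ?case by simp
qed simp

text \<open>By induction on the number of factors.  The condition that almost every \<open>v\<close> satisfies
  \<open>G (v W)\<close> is again measurable and invariant under scaling of \<open>W\<close>; invariance under scaling
  is what allows to pass between the measure and its normalisation.\<close>
lemma AE_left_prod:
  fixes \<mu> :: "(complex ^ 'k::finite ^ 'k) measure"
  assumes adm: "admissible \<mu>"
  assumes "{W. G W} \<in> sets borel" "\<And>c W. 0 < c \<Longrightarrow> G (c *\<^sub>R W) \<longleftrightarrow> G W"
    and "AE W in product_law (normalized \<mu>) n. G W"
  shows "AE v in PiM {1..n} (\<lambda>_. off_zero \<mu>). G (left_prod v n)"
  using assms(2-)
proof (induction n arbitrary: G)
  case 0
  have pred: "Measurable.pred borel G" using 0(1) by (simp add: pred_def)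
  have "AE W in return borel (mat 1). G W" using 0(3) by (simp only: product_law.simps)
  hence "G (mat 1)" by (subst (asm) AE_return) (use pred in simp_all)
  thus ?case by simp
next
  case (Suc n)
  let ?Q = "normalized \<mu>"
  have sets: "sets \<mu> = sets borel" using adm unfolding admissible_def by auto
  interpret Q: kraus_prob ?Q by (rule admissible_normalized(1)[OF adm])
  interpret S: sigma_finite_measure "off_zero \<mu>" by (rule sigma_finite_off_zero[OF adm])
  interpret product_sigma_finite "\<lambda>_. off_zero \<mu>" ..
  have kp: "kraus_prob (product_law ?Q n)" by (rule kraus_product_law[OF Q.kraus_prob_axioms])
  define G' where "G' W = (AE v in ?Q. G (v ** W))" for W
  have slice: "{v. G (v ** W)} \<in> sets borel" for W :: "complex ^ 'k ^ 'k"
  proof -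
    have "(\<lambda>v :: complex ^ 'k ^ 'k. v ** W) \<in> borel_measurable borel" by (intro borel_measurable_continuous_onI continuous_intros)
    from measurable_sets[OF this Suc.prems(1)] show ?thesis by (simp add: vimage_def)
  qed
  have "{p :: (complex ^ 'k ^ 'k) \<times> (complex ^ 'k ^ 'k). \<not> G (snd p ** fst p)} \<in> sets (borel \<Otimes>\<^sub>M ?Q)"
  proof -
    have "(\<lambda>(W, v). v ** W) -` (- {W. G W}) \<inter> space (borel \<Otimes>\<^sub>M ?Q) \<in> sets (borel \<Otimes>\<^sub>M ?Q)"
      by (rule measurable_sets[OF measurable_mult_pair[OF refl Q.sets_Q]]) (use Suc.prems(1) in auto)
    also have "(\<lambda>(W, v). v ** W) -` (- {W. G W}) \<inter> space (borel \<Otimes>\<^sub>M ?Q)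
        = {p :: (complex ^ 'k ^ 'k) \<times> (complex ^ 'k ^ 'k). \<not> G (snd p ** fst p)}"
      by (auto simp: space_pair_measure)
    finally show ?thesis .
  qed
  from Q.measurable_emeasure_Pair[OF this]
  have m: "(\<lambda>W. emeasure ?Q {v. \<not> G (v ** W)}) \<in> borel_measurable borel" by (simp add: vimage_def)
  have "G' W \<longleftrightarrow> emeasure ?Q {v. \<not> G (v ** W)} = 0" for W
    unfolding G'_def
  proof (rule AE_iff_measurable)
    have "- {v. G (v ** W)} \<in> sets borel" using slice[of W] by auto
    also have "- {v. G (v ** W)} = {v. \<not> G (v ** W)}" by auto
    finally show "{v. \<not> G (v ** W)} \<in> sets ?Q" by (simp add: Q.sets_Q)
  qed simp
  hence "{W. G' W} = (\<lambda>W. emeasure ?Q {v. \<not> G (v ** W)}) -` {0} \<inter> space borel" by auto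
  hence G'_meas: "{W. G' W} \<in> sets borel" using measurable_sets[OF m, of "{0}"] by simp
  have G'_inv: "G' (c *\<^sub>R W) \<longleftrightarrow> G' W" if "0 < c" for c W
    unfolding G'_def scaleR_mat_mult Suc.prems(2)[OF that] ..
  have "AE W in product_law ?Q n. G' W"
    using Suc.prems(3) unfolding G'_def product_law.simps by (subst (asm) AE_step_law[OF kp Q.kraus_prob_axioms Suc.prems(1)])
  hence "AE v in PiM {1..n} (\<lambda>_. off_zero \<mu>). G' (left_prod v n)"
    by (rule Suc.IH[OF G'_meas, rotated]) (rule G'_inv)
  hence "AE v in PiM {1..n} (\<lambda>_. off_zero \<mu>). AE y in off_zero \<mu>. G (y ** left_prod v n)"
  proof eventually_elim
    case (elim v)
    hence "AE y in \<mu>. y \<noteq> 0 \<longrightarrow> G (y ** left_prod v n)"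
      unfolding G'_def
      by (subst (asm) AE_normalized[OF sets slice]) (simp_all add: scaleR_mat_mult Suc.prems(2))
    thus ?case unfolding off_zero_def using sets by (subst AE_density) (auto elim: eventually_mono)
  qed
  moreover define bad where "bad v = (indicator (- {W. G W}) (left_prod v (Suc n)) :: ennreal)" for v
  have bm: "bad \<in> borel_measurable (PiM (insert (Suc n) {1..n}) (\<lambda>_. off_zero \<mu>))"
    unfolding bad_def
    by (rule measurable_compose[OF left_prod_measurable borel_measurable_indicator])
      (use sets Suc.prems(1) in auto)
  moreover have "bad (v(Suc n := y)) = indicator (- {W. G W}) (y ** left_prod v n)" for v y
    using left_prod_cong[of n "v(Suc n := y)" v] by (simp add: bad_def)
  ultimately have "AE v in PiM {1..n} (\<lambda>_. off_zero \<mu>). (\<integral>\<^sup>+ y. bad (v(Suc n := y)) \<partial>off_zero \<mu>) = 0"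
  proof (elim eventually_mono)
    fix v assume ae: "AE y in off_zero \<mu>. G (y ** left_prod v n)"
      and b: "\<And>v y. bad (v(Suc n := y)) = indicator (- {W. G W}) (y ** left_prod v n)"
    have "(\<integral>\<^sup>+ y. bad (v(Suc n := y)) \<partial>off_zero \<mu>) = (\<integral>\<^sup>+ y. 0 \<partial>off_zero \<mu>)"
      unfolding b by (rule nn_integral_cong_AE) (use ae in \<open>auto elim: eventually_mono\<close>)
    thus "(\<integral>\<^sup>+ y. bad (v(Suc n := y)) \<partial>off_zero \<mu>) = 0" by simp
  qed
  hence "(\<integral>\<^sup>+ v. (\<integral>\<^sup>+ y. bad (v(Suc n := y)) \<partial>off_zero \<mu>) \<partial>PiM {1..n} (\<lambda>_. off_zero \<mu>)) = (\<integral>\<^sup>+ v. 0 \<partial>PiM {1..n} (\<lambda>_. off_zero \<mu>))"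
    by (rule nn_integral_cong_AE)
  hence "(\<integral>\<^sup>+ v. bad v \<partial>PiM (insert (Suc n) {1..n}) (\<lambda>_. off_zero \<mu>)) = 0"
    by (subst product_nn_integral_insert[OF _ _ bm]) auto
  hence "AE v in PiM (insert (Suc n) {1..n}) (\<lambda>_. off_zero \<mu>). bad v = 0"
    by (subst (asm) nn_integral_0_iff_AE[OF bm])
  hence ae: "AE v in PiM (insert (Suc n) {1..n}) (\<lambda>_. off_zero \<mu>). G (left_prod v (Suc n))"
    by (rule eventually_mono) (simp add: bad_def indicator_def split: if_splits)
  have "insert (Suc n) {1..n} = {1..Suc n}" by auto
  from ae[unfolded this] show ?case .
qed

section \<open>Purification\<close>

text \<open>The matrix \<open>x x* + y y*\<close>; for orthonormal vectors, the projector onto their span.\<close>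
definition plane_projector :: "complex ^ 'k::finite \<Rightarrow> complex ^ 'k \<Rightarrow> complex ^ 'k ^ 'k" where
  "plane_projector x y = (\<chi> i j. x $ i * cnj (x $ j) + y $ i * cnj (y $ j))"

lemma plane_projector_apply: "plane_projector x y *v w = cinner x w *s x + cinner y w *s y"
  by (simp add: plane_projector_def vec_eq_iff matrix_vector_mult_def cinner_def sum_distrib_left sum_distrib_right
      sum.distrib[symmetric] algebra_simps)

lemma plane_projector_ctrans: "ctrans (plane_projector x y) = plane_projector x y"
  by (simp add: plane_projector_def ctrans_def map_matrix_def transpose_def vec_eq_iff mult.commute)

lemma plane_projector_orthogonal:
  assumes "orthonormal x y" shows "orthogonal_projector (plane_projector x y)"
proof -
  have o: "cinner x x = 1" "cinner y y = 1" "cinner x y = 0" "cinner y x = 0"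
    using assms cinner_commute[of y x] by (auto simp: orthonormal_def cinner_self)
  have "plane_projector x y ** plane_projector x y = plane_projector x y"
    by (simp add: matrix_eq matrix_vector_mul_assoc[symmetric] plane_projector_apply cinner_simps o)
  thus ?thesis by (simp add: orthogonal_projector_def plane_projector_ctrans)
qed

text \<open>If all rows were multiples of one row, the image would be a line containing the
  orthonormal vectors \<open>x\<close> and \<open>y\<close>.\<close>
lemma plane_projector_rank:
  assumes "orthonormal x (y :: complex ^ 'k::finite)" shows "rank (plane_projector x y) \<noteq> 1"
proof
  let ?P = "plane_projector x y"
  assume "rank ?P = 1"
  hence "vec.dim (rows ?P) = 1" by (simp add: row_rank_def_gen)
  moreover obtain B where B: "B \<subseteq> rows ?P" "rows ?P \<subseteq> vec.span B" "card B = vec.dim (rows ?P)"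
    by (rule vec.basis_exists[of "rows ?P"])
  ultimately obtain r where r: "B = {r}" using card_1_singletonE by metis
  have "\<exists>c. ?P $ i = c *s r" for i
  proof -
    have "?P $ i \<in> rows ?P" by (auto simp: rows_def row_def)
    hence "?P $ i \<in> vec.span {r}" using B(2) r by blast
    thus ?thesis by (auto simp: vec.span_singleton)
  qed
  then obtain c where c: "\<And>i. ?P $ i = c i *s r" by metis
  define d where "d = (\<chi> i. c i)"
  have ap: "?P *v w = (\<Sum>j\<in>UNIV. r $ j * w $ j) *s d" for w
    by (simp add: matrix_vector_mult_def vec_eq_iff c d_def sum_distrib_left mult_ac)
  have o: "cinner x x = 1" "cinner y y = 1" "cinner x y = 0" "cinner y x = 0"
    using assms cinner_commute[of y x] by (auto simp: orthonormal_def cinner_self)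
  obtain a b where ab: "x = a *s d" "y = b *s d"
    using ap[of x] ap[of y] by (simp add: plane_projector_apply o)
  hence "cnj a * b * cinner d d = 0" "cnj a * a * cinner d d = 1" "cnj b * b * cinner d d = 1"
    using o by (simp_all add: cinner_simps mult_ac)
  thus False by (metis complex_cnj_zero_iff mult_eq_0_iff zero_neq_one)
qed

text \<open>On the plane, \<open>W\<close> is a multiple of an isometry.\<close>
lemma plane_projector_compress:
  assumes n: "norm (W *v x) = norm (W *v y)" and o: "cinner (W *v x) (W *v y) = 0" and xy: "orthonormal x y"
  shows "plane_projector x y ** ctrans W ** W ** plane_projector x y
    = map_matrix ((*) (of_real ((norm (W *v x))\<^sup>2))) (plane_projector x y)"
    (is "?P ** _ ** _ ** _ = ?R")
proof -
  have o': "cinner (W *v y) (W *v x) = 0" using o cinner_commute by (metis complex_cnj_zero)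
  have oo: "cinner x x = 1" "cinner y y = 1" "cinner x y = 0" "cinner y x = 0"
    using xy cinner_commute[of y x] by (auto simp: orthonormal_def cinner_self)
  have sa: "cinner u (?P *v w) = cinner (?P *v u) w" for u w
    using cinner_ctrans[of ?P u w] by (simp add: plane_projector_ctrans)
  have "cinner u ((?P ** ctrans W ** W ** ?P) *v w) = cinner u (?R *v w)" for u w
  proof -
    have "(?P ** ctrans W ** W ** ?P) *v w = ?P *v ((ctrans W ** W) *v (?P *v w))"
      by (simp add: matrix_vector_mul_assoc matrix_mul_assoc)
    hence "cinner u ((?P ** ctrans W ** W ** ?P) *v w) = cinner (W *v (?P *v u)) (W *v (?P *v w))"
      by (simp add: sa cinner_gram)
    also have "\<dots> = of_real ((norm (W *v x))\<^sup>2) * (cnj (cinner x u) * cinner x w + cnj (cinner y u) * cinner y w)"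
      unfolding plane_projector_apply matrix_vector_right_distrib matrix_vector_scaleC cinner_simps o o'
        cinner_self n by (simp add: algebra_simps)
    also have "\<dots> = cinner u (?R *v w)"
      using cscale_vector[of "of_real ((norm (W *v x))\<^sup>2)" ?P w] cinner_commute[of u x] cinner_commute[of u y]
      by (simp add: cscale_def plane_projector_apply cinner_simps algebra_simps)
    finally show ?thesis .
  qed
  hence "cinner u ((?P ** ctrans W ** W ** ?P) *v w - ?R *v w) = 0" for u w by (simp add: cinner_diff_right)
  hence "(?P ** ctrans W ** W ** ?P) *v w - ?R *v w = 0" for w using cinner_self_eq_0 by blast
  thus ?thesis by (simp add: matrix_eq)
qed

text \<open>If the mean area is always 1, then equality holds almost surely in
  \<open>area \<le> (|W x|^2 + |W y|^2) / 2\<close>: products map \<open>x, y\<close> to orthogonal vectors of equal length.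
  The projector onto the plane of \<open>x, y\<close> then satisfies the hypothesis of (Pur), but has rank
  two.\<close>
lemma Pur_contraction:
  fixes \<mu> :: "(complex ^ 'k::finite ^ 'k) measure"
  assumes adm: "admissible \<mu>" and pur: "Pur \<mu>" and xy: "orthonormal x y"
  shows "\<exists>n. mean_area (product_law (normalized \<mu>) n) x y < 1"
proof (rule ccontr)
  assume neg: "\<not> ?thesis"
  let ?Q = "normalized \<mu>" and ?P = "plane_projector x y"
  define G where "G W = (area (W *v x) (W *v y) = ((norm (W *v x))\<^sup>2 + (norm (W *v y))\<^sup>2) / 2)" for W :: "complex ^ 'k ^ 'k"
  have G_meas: "{W. G W} \<in> sets borel"
    unfolding G_def by (intro borel_closed closed_Collect_eq continuous_intros) auto
  have G_inv: "G (c *\<^sub>R W) \<longleftrightarrow> G W" if "0 < c" for c W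
  proof -
    have a: "area ((c *\<^sub>R W) *v x) ((c *\<^sub>R W) *v y) = c\<^sup>2 * area (W *v x) (W *v y)"
      using that by (simp add: scaleR_matrix_vector area_scale power2_eq_square)
    have b: "((norm ((c *\<^sub>R W) *v x))\<^sup>2 + (norm ((c *\<^sub>R W) *v y))\<^sup>2) / 2 = c\<^sup>2 * (((norm (W *v x))\<^sup>2 + (norm (W *v y))\<^sup>2) / 2)"
      by (simp add: scaleR_matrix_vector norm_smult power_mult_distrib algebra_simps)
    show ?thesis unfolding G_def a b using that by simp
  qed
  have ae: "AE W in product_law ?Q n. G W" for n
  proof -
    interpret K: kraus_prob "product_law ?Q n" by (rule kraus_product_law[OF admissible_normalized(1)[OF adm]])
    let ?H = "\<lambda>W :: complex ^ 'k ^ 'k. ((norm (W *v x))\<^sup>2 + (norm (W *v y))\<^sup>2) / 2 - area (W *v x) (W *v y)"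
    have i: "integrable (product_law ?Q n) (\<lambda>W. (norm (W *v x))\<^sup>2)" "integrable (product_law ?Q n) (\<lambda>W. (norm (W *v y))\<^sup>2)"
      "integrable (product_law ?Q n) (\<lambda>W. area (W *v x) (W *v y))"
      by (intro K.integrable_continuous continuous_intros)+
    have "(LINT W|product_law ?Q n. ?H W) = 1 - mean_area (product_law ?Q n) x y"
      using i xy by (simp add: mean_area_def K.unital orthonormal_def)
    also have "\<dots> \<le> 0" using neg by (simp add: not_less)
    finally have le: "(LINT W|product_law ?Q n. ?H W) \<le> 0" .
    have ge: "0 \<le> ?H W" for W using area_le_mean[of "W *v x" "W *v y"] by simp
    hence "(LINT W|product_law ?Q n. ?H W) = 0" using le by (intro antisym integral_nonneg_AE AE_I2) auto
    moreover have "integrable (product_law ?Q n) ?H" using i by simp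
    ultimately have "AE W in product_law ?Q n. ?H W = 0" using ge integral_nonneg_eq_0_iff_AE by blast
    thus ?thesis unfolding G_def by (auto elim: eventually_mono)
  qed
  have "AE v in PiM {1..n} (\<lambda>_. \<mu>).
        \<exists>c. ?P ** ctrans (left_prod v n) ** left_prod v n ** ?P = map_matrix ((*) c) ?P" if n: "1 \<le> n" for n
  proof (rule AE_PiM_off_zero[OF adm])
    have "AE v in PiM {1..n} (\<lambda>_. off_zero \<mu>). G (left_prod v n)"
      by (rule AE_left_prod[OF adm G_meas _ ae]) (rule G_inv)
    thus "AE v in PiM {1..n} (\<lambda>_. off_zero \<mu>).
        \<exists>c. ?P ** ctrans (left_prod v n) ** left_prod v n ** ?P = map_matrix ((*) c) ?P"
    proof eventually_elim
      case (elim v)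
      from area_eq_mean[OF elim[unfolded G_def]] show ?case using plane_projector_compress[OF _ _ xy] by blast
    qed
    fix v :: "nat \<Rightarrow> complex ^ 'k ^ 'k" and i assume "i \<in> {1..n}" "v i = 0"
    hence z: "left_prod v n = 0" using left_prod_zero by auto
    have "?P ** ctrans (left_prod v n) ** left_prod v n ** ?P = map_matrix ((*) 0) ?P"
      unfolding z by (simp add: matrix_eq matrix_vector_mul_assoc[symmetric]) (simp add: map_matrix_def matrix_vector_mult_def vec_eq_iff)
    thus "\<exists>c. ?P ** ctrans (left_prod v n) ** left_prod v n ** ?P = map_matrix ((*) c) ?P" ..
  qed (use n in auto)
  moreover have "?P \<noteq> 0"
  proof
    assume "?P = 0"
    hence "?P *v x = 0" by simp
    hence "x = 0" using xy cinner_commute[of y x] by (simp add: plane_projector_apply orthonormal_def cinner_self)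
    thus False using xy by (simp add: orthonormal_def)
  qed
  ultimately have "rank ?P = 1" using pur plane_projector_orthogonal[OF xy] unfolding Pur_def by blast
  thus False using plane_projector_rank[OF xy] by blast
qed

section \<open>Span, dimension and simplicity\<close>

lemma sum_fun_apply: "(sum F S :: 'a \<Rightarrow> complex) x = (\<Sum>i\<in>S. F i x)"
  by (induction S rule: infinite_finite_induct) auto

locale periodic_contracting = periodic_kraus Q m Es M + contracting_remainder Q \<alpha> N R
  for Q :: "(complex ^ 'k::finite ^ 'k) measure" and m Es M \<alpha> N R
begin

lemma shift_zero_iff: "shift_matrix z A = 0 \<longleftrightarrow> quantum_map Q A = cscale z A"
  unfolding shift_matrix_def by (metis eq_iff_diff_eq_0)

lemma spectral_values_simple:
  assumes "z \<in> peripheral_spectrum Q \<alpha>" shows "simple_spectral_value Q \<alpha> z"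
proof -
  have z: "cmod z = 1" using assms by (simp add: peripheral_spectrum_def)
  obtain A where A: "A \<noteq> 0" "quantum_map Q A = cscale z A"
    using peripheral_value_eigen[OF assms] shift_zero_iff by blast
  obtain b where b: "z = omega ^ b" "\<And>A'. quantum_map Q A' = cscale z A' \<Longrightarrow> \<exists>k. A' = cscale k (fourier_matrix b)"
    using peripheral_structure[OF A(2,1) z] by metis
  show ?thesis
  proof (rule simple_of_line[OF z fourier_matrix_nonzero[of b]])
    show "shift_matrix z (fourier_matrix b) = 0" using quantum_map_fourier_matrix[of b] b(1) shift_zero_iff by simp
    show "\<exists>c. A' = cscale c (fourier_matrix b)" if "shift_matrix z A' = 0" for A'
      using b(2) that shift_zero_iff by blast
  qed
qed

abbreviation cycle_forms :: "('k cproj \<Rightarrow> complex) set" where "cycle_forms \<equiv> (\<lambda>r. quadform (M r)) ` {1..m}"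

lemma quadform_sum: "quadform (\<Sum>r\<in>S. cscale (c r) (T r)) p = (\<Sum>r\<in>S. c r * quadform (T r) p)"
proof -
  have "quadform 0 p = 0" by (simp add: quadform_def)
  thus ?thesis by (induction S rule: infinite_finite_induct) (simp_all add: quadform_add quadform_cscale)
qed

lemma quadform_fourier_matrix: "quadform (fourier_matrix b) p = (\<Sum>r\<in>{1..m}. omega ^ (b * r) * quadform (M r) p)"
  unfolding fourier_matrix_def by (rule quadform_sum)

lemma eigenvectors_in_span: "peripheral_eigenvectors Q \<alpha> \<subseteq> cfun.span cycle_forms"
proof
  fix f assume "f \<in> peripheral_eigenvectors Q \<alpha>"
  then obtain z where f: "f \<in> holder_space \<alpha>" "f \<noteq> 0" and z: "cmod z = 1" and e: "markov_op Q f = (\<lambda>p. z * f p)"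
    unfolding peripheral_eigenvectors_def by blast
  obtain C where C: "holder_bound \<alpha> f C" using f(1) holder_space_iff by blast
  have s: "shifted_op Q z f = 0" using e by (simp add: shifted_op_def fun_eq_iff)
  obtain A where A: "f = quadform A" using quadform_of_peripheral[OF C z, of 0] s quadform_zero by metis
  have "quadform (shift_matrix z A) = quadform 0" using s unfolding A shifted_quadform quadform_zero .
  hence "quantum_map Q A = cscale z A" using quadform_inject shift_zero_iff by blast
  moreover have "A \<noteq> 0" using A f(2) quadform_zero by auto
  ultimately obtain b where "\<And>A'. quantum_map Q A' = cscale z A' \<Longrightarrow> \<exists>k. A' = cscale k (fourier_matrix b)"
    using peripheral_structure[OF _ _ z, of A] by blast
  then obtain k where k: "A = cscale k (fourier_matrix b)" using \<open>quantum_map Q A = cscale z A\<close> by blast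
  have "f = (\<Sum>r\<in>{1..m}. (\<lambda>p. (k * omega ^ (b * r)) * quadform (M r) p))"
  proof
    fix p
    have "f p = (\<Sum>r\<in>{1..m}. k * (omega ^ (b * r) * quadform (M r) p))"
      unfolding A k quadform_cscale quadform_fourier_matrix sum_distrib_left ..
    thus "f p = (\<Sum>r\<in>{1..m}. (\<lambda>p. (k * omega ^ (b * r)) * quadform (M r) p)) p"
      unfolding sum_fun_apply mult.assoc .
  qed
  also have "\<dots> \<in> cfun.span cycle_forms"
    by (intro cfun.span_sum cfun.span_scale cfun.span_base) blast
  finally show "f \<in> cfun.span cycle_forms" .
qed

lemma eigenvector_fourier_matrix: "quadform (fourier_matrix b) \<in> peripheral_eigenvectors Q \<alpha>"
proof -
  have "quadform (fourier_matrix b) \<noteq> 0" using quadform_inject[of "fourier_matrix b" 0] fourier_matrix_nonzero quadform_zero by auto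
  moreover have "quadform (fourier_matrix b) \<in> holder_space \<alpha>" using quadform_bound[OF \<alpha>] holder_space_iff by blast
  moreover have "markov_op Q (quadform (fourier_matrix b)) = (\<lambda>p. omega ^ b * quadform (fourier_matrix b) p)"
    by (simp add: markov_op_quadform quantum_map_fourier_matrix quadform_cscale fun_eq_iff)
  moreover have "cmod (omega ^ b) = 1" by (simp add: norm_power omega_norm)
  ultimately show ?thesis unfolding peripheral_eigenvectors_def by blast
qed

text \<open>A geometric sum of the root of unity \<open>omega ^ (m - r + s)\<close>, which is 1 only for
  \<open>r = s\<close>.  The exponent \<open>m - r\<close> stands for \<open>-r\<close>.\<close>
lemma omega_orthogonality:
  assumes "r \<in> {1..m}" "s \<in> {1..m}"
  shows "(\<Sum>b<m. omega ^ (b * (m - r)) * omega ^ (b * s)) = (if r = s then of_nat m else 0)"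
proof -
  let ?e = "m - r + s"
  have "(\<Sum>b<m. omega ^ (b * (m - r)) * omega ^ (b * s)) = (\<Sum>b<m. (omega ^ ?e) ^ b)"
    by (intro sum.cong refl) (simp only: power_add[symmetric] power_mult[symmetric] distrib_left mult.commute add.commute)
  also have "\<dots> = (if r = s then of_nat m else 0)"
  proof (cases "r = s")
    case True
    hence "?e = m" using assms by simp
    thus ?thesis using True omega_m by simp
  next
    case False
    have "omega ^ ?e \<noteq> 1"
    proof (cases "?e < m")
      case True
      thus ?thesis unfolding omega_def using assms by (intro cis_order) auto
    next
      case False
      hence "?e = m + (s - r)" using assms \<open>r \<noteq> s\<close> by auto
      hence "omega ^ ?e = omega ^ (s - r)" by (simp add: power_add omega_m)
      moreover have "omega ^ (s - r) \<noteq> 1" unfolding omega_def using assms False \<open>r \<noteq> s\<close> by (intro cis_order) auto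
      ultimately show ?thesis by simp
    qed
    moreover have "(omega ^ ?e) ^ m = 1" by (simp add: power_mult[symmetric] mult.commute[of _ m]) (simp add: power_mult omega_m)
    ultimately show ?thesis using False by (simp add: geometric_sum)
  qed
  finally show ?thesis .
qed

text \<open>Fourier inversion over the \<open>m\<close>-th roots of unity.\<close>
lemma quadform_M_in_span:
  assumes r: "r \<in> {1..m}" shows "quadform (M r) \<in> cfun.span (peripheral_eigenvectors Q \<alpha>)"
proof -
  have "quadform (M r) p = (\<Sum>b<m. (omega ^ (b * (m - r)) / of_nat m) * quadform (fourier_matrix b) p)" for p
  proof -
    have "(\<Sum>b<m. (omega ^ (b * (m - r)) / of_nat m) * quadform (fourier_matrix b) p)
        = (\<Sum>b<m. \<Sum>s\<in>{1..m}. (omega ^ (b * (m - r)) * omega ^ (b * s)) * (quadform (M s) p / of_nat m))"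
      unfolding quadform_fourier_matrix sum_distrib_left by (intro sum.cong refl) simp
    also have "\<dots> = (\<Sum>s\<in>{1..m}. (\<Sum>b<m. omega ^ (b * (m - r)) * omega ^ (b * s)) * (quadform (M s) p / of_nat m))"
      by (subst sum.swap) (simp only: sum_distrib_right)
    also have "\<dots> = (\<Sum>s\<in>{1..m}. if s = r then quadform (M r) p else 0)"
      using m_pos by (intro sum.cong refl) (simp add: omega_orthogonality[OF r])
    also have "\<dots> = quadform (M r) p" using r by simp
    finally show ?thesis by simp
  qed
  hence "quadform (M r) = (\<Sum>b<m. (\<lambda>p. (omega ^ (b * (m - r)) / of_nat m) * quadform (fourier_matrix b) p))"
    by (intro ext) (simp only: sum_fun_apply)
  also have "\<dots> \<in> cfun.span (peripheral_eigenvectors Q \<alpha>)"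
    by (intro cfun.span_sum cfun.span_scale cfun.span_base eigenvector_fourier_matrix)
  finally show ?thesis .
qed

lemma span_eq: "cfun.span (peripheral_eigenvectors Q \<alpha>) = cfun.span cycle_forms"
proof
  show "cfun.span (peripheral_eigenvectors Q \<alpha>) \<subseteq> cfun.span cycle_forms"
    by (rule cfun.span_minimal[OF eigenvectors_in_span cfun.subspace_span])
  show "cfun.span cycle_forms \<subseteq> cfun.span (peripheral_eigenvectors Q \<alpha>)"
    by (rule cfun.span_minimal[OF _ cfun.subspace_span]) (use quadform_M_in_span in blast)
qed

text \<open>At a point in the cycle subspace with index \<open>s\<close> the form of \<open>M r\<close> is 1 if \<open>r = s\<close> and
  0 otherwise.\<close>
lemma dim_span: "cfun.dim (cfun.span cycle_forms) = m"
proof -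
  have "\<exists>p. \<forall>r\<in>{1..m}. quadform (M r) p = (if r = s then 1 else 0)" if s: "s \<in> {1..m}" for s
  proof -
    obtain x where x: "x \<in> Es s" "x \<noteq> 0" by (rule cycle_vector[OF s])
    have "quadform (M r) (proj_class x) * of_real ((norm x)\<^sup>2) = (if r = s then of_real ((norm x)\<^sup>2) else 0)" if "r \<in> {1..m}" for r
    proof -
      have "quadform (M r) (proj_class x) * of_real ((norm x)\<^sup>2) = lift (quadform (M r)) x" using x(2) by (simp add: lift_def)
      also have "\<dots> = (if r = s then of_real ((norm x)\<^sup>2) else 0)"
        unfolding lift_quadform M_on_cycle[OF that s x(1)] by (simp add: cinner_self)
      finally show ?thesis .
    qed
    moreover have "complex_of_real ((norm x)\<^sup>2) \<noteq> 0" using x(2) by simp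
    ultimately have "\<forall>r\<in>{1..m}. quadform (M r) (proj_class x) = (if r = s then 1 else 0)"
      by (metis (no_types, lifting) mult_cancel_right1 mult_eq_0_iff)
    thus ?thesis by blast
  qed
  then obtain p where p: "\<And>r s. r \<in> {1..m} \<Longrightarrow> s \<in> {1..m} \<Longrightarrow> quadform (M r) (p s) = (if r = s then 1 else 0)"
    by metis
  have inj: "inj_on (\<lambda>r. quadform (M r)) {1..m}"
  proof (rule inj_onI)
    fix r s assume rs: "r \<in> {1..m}" "s \<in> {1..m}" "quadform (M r) = quadform (M s)"
    have "quadform (M r) (p r) = 1" using p[OF rs(1,1)] by simp
    hence "quadform (M s) (p r) = 1" using rs(3) by simp
    thus "r = s" using p[OF rs(2,1)] by (auto split: if_splits)
  qed
  have "cfun.independent cycle_forms"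
  proof (rule ccontr)
    assume "\<not> cfun.independent cycle_forms"
    then obtain u where u: "\<exists>v\<in>cycle_forms. u v \<noteq> 0" "(\<Sum>v\<in>cycle_forms. (\<lambda>x. u v * v x)) = 0"
      using cfun.dependent_finite[of cycle_forms] by auto
    have "u (quadform (M s)) = 0" if s: "s \<in> {1..m}" for s
    proof -
      have "0 = (\<Sum>v\<in>cycle_forms. (\<lambda>x. u v * v x)) (p s)" unfolding u(2) by simp
      also have "\<dots> = (\<Sum>v\<in>cycle_forms. u v * v (p s))" by (rule sum_fun_apply)
      also have "\<dots> = (\<Sum>r\<in>{1..m}. u (quadform (M r)) * quadform (M r) (p s))" by (simp only: sum.reindex[OF inj] o_def)
      also have "\<dots> = (\<Sum>r\<in>{1..m}. if r = s then u (quadform (M s)) else 0)"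
        by (intro sum.cong refl) (simp add: p[OF _ s])
      also have "\<dots> = u (quadform (M s))" using s by simp
      finally show ?thesis by simp
    qed
    thus False using u(1) by blast
  qed
  thus ?thesis unfolding cfun.dim_span using inj by (simp add: cfun.dim_eq_card_independent card_image)
qed

end

theorem lemma4p10:
  fixes \<mu> :: "(complex ^ 'k::finite ^ 'k) measure"
    and \<alpha> :: real and m :: nat
    and Es :: "nat \<Rightarrow> (complex ^ 'k) set"
    and M :: "nat \<Rightarrow> complex ^ 'k ^ 'k"
    and \<F> :: "('k cproj \<Rightarrow> complex) set"
  assumes "admissible \<mu>"
    and "Pur \<mu>"
    and "Erg \<mu>"
    and "0 < \<alpha>" and "\<alpha> \<le> 1"
    and "is_period \<mu> m"
    and "is_cycle \<mu> m Es"
    and "attached_matrices \<mu> m Es M"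
    and "\<F> = cfun.span (peripheral_eigenvectors \<mu> \<alpha>)"
  shows "\<F> = cfun.span ((\<lambda>r p. cinner (unit_rep p) (M r *v unit_rep p)) ` {1..m})
    \<and> cfun.dim \<F> = m
    \<and> (\<forall>z\<in>peripheral_spectrum \<mu> \<alpha>. simple_spectral_value \<mu> \<alpha> z)"
proof -
  let ?Q = "normalized \<mu>"
  have sets: "sets \<mu> = sets borel" using assms(1) unfolding admissible_def by blast
  have Q: "kraus_prob ?Q" by (rule admissible_normalized(1)[OF assms(1)])
  have pur: "\<exists>n. mean_area (product_law ?Q n) x y < 1" if "orthonormal x y" for x y
    by (rule Pur_contraction[OF assms(1,2) that])
  obtain N R where "contracting_remainder ?Q \<alpha> N R"
    by (rule contracting_remainder_exists[OF Q _ assms(4,5)]) (use pur in blast)+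
  then interpret contracting_remainder ?Q \<alpha> N R .
  have mk: "markov_op ?Q = markov_op \<mu>" using markov_op_normalized[OF sets] by blast
  have sh: "shifted_op ?Q = shifted_op \<mu>" by (simp add: shifted_op_def mk fun_eq_iff)
  have ps: "peripheral_spectrum ?Q \<alpha> = peripheral_spectrum \<mu> \<alpha>"
    by (simp add: peripheral_spectrum_def spectrum_on_def sh)
  have pe: "peripheral_eigenvectors ?Q \<alpha> = peripheral_eigenvectors \<mu> \<alpha>"
    by (simp add: peripheral_eigenvectors_def mk)
  have ss: "simple_spectral_value ?Q \<alpha> z = simple_spectral_value \<mu> \<alpha> z" for z
    by (simp add: simple_spectral_value_def gen_eigenspace_def sh)
  interpret periodic_contracting ?Q m Es M \<alpha> N R
  proof
    show "Erg ?Q" using assms(3) Erg_normalized[OF sets] by blast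
    show "is_period ?Q m" using assms(6) unfolding is_period_def is_cycle_normalized[OF sets] .
    show "is_cycle ?Q m Es" using assms(7) is_cycle_normalized[OF sets] by blast
    show "attached_matrices ?Q m Es M"
      using assms(8) unfolding attached_matrices_def quantum_map_normalized[OF sets] .
  qed
  have "(\<lambda>r p. cinner (unit_rep p) (M r *v unit_rep p)) ` {1..m} = cycle_forms"
    by (simp add: quadform_def[abs_def])
  thus ?thesis
    using span_eq dim_span spectral_values_simple by (simp add: assms(9) pe[symmetric] ps[symmetric] ss[symmetric])
qed

end
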